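(* Let $\Omega\subset\mathbf{R}^N$ be a bounded smooth domain, let $1<\gamma<N$ and $\gamma^*=N\gamma/(N-\gamma)$. Let $f:\Omega\times\mathbf{R}\to\mathbf{R}$ be a Carath\'eodory function, $F(x,t)=\int_0^t f(x,s)\,ds$ and $A_\infty(x)=\limsup_{|s|\to\infty}\frac{F(x,s)}{|s|^\gamma}$. Suppose: (i) there are a constant $a\ge0$ and a nonnegative $b\in L^{\frac{\gamma^*}{\gamma^*-1}}(\Omega)$ such that $|f(x,s)|\le a|s|^{\gamma^*-1}+b(x)$ for all $s\in\mathbf{R}$ and a.e. $x\in\Omega$; (ii) there are a constant $A\ge0$ and a nonnegative $B\in L^1(\Omega)$ such that $F(x,s)\le A|s|^\gamma+B(x)$ for all $s\in\mathbf{R}$ and a.e. $x\in\Omega$; (iii) $$\inf_{v\in W_0^{1,\gamma}(\Omega),\ |v|_{L^\gamma}=1}\left\{\int_\Omega\left(\sqrt{1+|\nabla v|^2}-1\right)^\gamma dx-\int_{\{v\ne0\}}A_\infty(x)|v(x)|^\gamma\,dx\right\}>0.$$ Then for each $h\in L^{\frac{\gamma}{\gamma-1}}(\Omega)$ the problem $$-\mathrm{div}\left(\gamma\frac{(\sqrt{1+|\nabla u|^2}-1)^{\gamma-1}}{\sqrt{1+|\nabla u|^2}}\nabla u\right)=f(x,u)+h\ \text{ in }\Omega,\qquad u=0\ \text{ on }\partial\Omega,$$ admits a weak solution $u\in W_0^{1,\gamma}(\Omega)$.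
   Context: $|v|_{L^\gamma}$ is the norm of $L^\gamma(\Omega)$. By (ii), $A_\infty\le A$ a.e., so the integral of $A_\infty|v|^\gamma$ is well defined in $[-\infty,\infty)$. A weak solution is a $u\in W_0^{1,\gamma}(\Omega)$ such that $\int_\Omega\gamma\frac{(\sqrt{1+|\nabla u|^2}-1)^{\gamma-1}}{\sqrt{1+|\nabla u|^2}}\nabla u\cdot\nabla v\,dx=\int_\Omega f(x,u)v\,dx+\int_\Omega hv\,dx$ for all $v\in W_0^{1,\gamma}(\Omega)$. *)

theory Defs
  imports "HOL-Analysis.Analysis"
begin

text \<open>Open sets with smooth boundary and test functions.\<close>

primrec k_smooth :: "nat \<Rightarrow> ('a::euclidean_space \<Rightarrow> real) \<Rightarrow> bool" where
  "k_smooth 0 \<phi> \<longleftrightarrow> continuous_on UNIV \<phi>"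
| "k_smooth (Suc k) \<phi> \<longleftrightarrow>
     (\<forall>x. \<phi> differentiable (at x)) \<and>
     (\<forall>i\<in>Basis. k_smooth k (\<lambda>x. frechet_derivative \<phi> (at x) i))"

definition smooth :: "('a::euclidean_space \<Rightarrow> real) \<Rightarrow> bool" where
  "smooth \<phi> \<longleftrightarrow> (\<forall>k. k_smooth k \<phi>)"

text \<open>Near each boundary point the set is the strict epigraph of a smooth function over the
  hyperplane orthogonal to some unit vector \<open>e\<close>. A function on that hyperplane is represented by
  a function on the whole space that is constant in the direction \<open>e\<close>.\<close>

definition smooth_boundary :: "'a::euclidean_space set \<Rightarrow> bool" where
  "smooth_boundary \<Omega> \<longleftrightarrow>
     (\<forall>x0\<in>frontier \<Omega>. \<exists>r>0. \<exists>e \<psi>. norm e = 1 \<and> smooth \<psi> \<and>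
        (\<forall>x t. \<psi> (x + t *\<^sub>R e) = \<psi> x) \<and>
        \<Omega> \<inter> ball x0 r = {x \<in> ball x0 r. x \<bullet> e > \<psi> x})"

definition bounded_smooth_domain :: "'a::euclidean_space set \<Rightarrow> bool" where
  "bounded_smooth_domain \<Omega> \<longleftrightarrow>
     open \<Omega> \<and> connected \<Omega> \<and> \<Omega> \<noteq> {} \<and> bounded \<Omega> \<and> smooth_boundary \<Omega>"

definition test_function :: "'a::euclidean_space set \<Rightarrow> ('a \<Rightarrow> real) \<Rightarrow> bool" where
  "test_function \<Omega> \<phi> \<longleftrightarrow>
     smooth \<phi> \<and> compact (closure {x. \<phi> x \<noteq> 0}) \<and> closure {x. \<phi> x \<noteq> 0} \<subseteq> \<Omega>"

text \<open>Lebesgue and Sobolev spaces. Elements are functions, not equivalence classes; their values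
  outside \<open>\<Omega>\<close> are irrelevant.\<close>

definition Lp :: "'a::euclidean_space set \<Rightarrow> real \<Rightarrow> ('a \<Rightarrow> 'b::euclidean_space) set" where
  "Lp \<Omega> p = {g. g \<in> borel_measurable (lebesgue_on \<Omega>) \<and>
                integrable (lebesgue_on \<Omega>) (\<lambda>x. norm (g x) powr p)}"

definition Lp_norm :: "'a::euclidean_space set \<Rightarrow> real \<Rightarrow> ('a \<Rightarrow> 'b::euclidean_space) \<Rightarrow> real" where
  "Lp_norm \<Omega> p g = (LINT x|lebesgue_on \<Omega>. norm (g x) powr p) powr (1 / p)"

definition locally_integrable ::
    "'a::euclidean_space set \<Rightarrow> ('a \<Rightarrow> 'b::euclidean_space) \<Rightarrow> bool" where
  "locally_integrable \<Omega> g \<longleftrightarrow> (\<forall>K. compact K \<and> K \<subseteq> \<Omega> \<longrightarrow> integrable (lebesgue_on K) g)"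

definition has_weak_grad :: "'a::euclidean_space set \<Rightarrow> ('a \<Rightarrow> real) \<Rightarrow> ('a \<Rightarrow> 'a) \<Rightarrow> bool" where
  "has_weak_grad \<Omega> v G \<longleftrightarrow> locally_integrable \<Omega> v \<and> locally_integrable \<Omega> G \<and>
     (\<forall>\<phi>. test_function \<Omega> \<phi> \<longrightarrow> (\<forall>i\<in>Basis.
        (LINT x|lebesgue_on \<Omega>. v x * frechet_derivative \<phi> (at x) i) =
        - (LINT x|lebesgue_on \<Omega>. (G x \<bullet> i) * \<phi> x)))"

text \<open>The weak gradient is unique almost everywhere in \<open>\<Omega>\<close>, so the choice below is immaterial.\<close>

definition weak_grad :: "'a::euclidean_space set \<Rightarrow> ('a \<Rightarrow> real) \<Rightarrow> 'a \<Rightarrow> 'a" where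
  "weak_grad \<Omega> v = (SOME G. has_weak_grad \<Omega> v G)"

definition W1 :: "'a::euclidean_space set \<Rightarrow> real \<Rightarrow> ('a \<Rightarrow> real) set" where
  "W1 \<Omega> p = {v \<in> Lp \<Omega> p. \<exists>G\<in>Lp \<Omega> p. has_weak_grad \<Omega> v G}"

definition W1_norm :: "'a::euclidean_space set \<Rightarrow> real \<Rightarrow> ('a \<Rightarrow> real) \<Rightarrow> real" where
  "W1_norm \<Omega> p v = Lp_norm \<Omega> p v + Lp_norm \<Omega> p (weak_grad \<Omega> v)"

definition W1_0 :: "'a::euclidean_space set \<Rightarrow> real \<Rightarrow> ('a \<Rightarrow> real) set" where
  "W1_0 \<Omega> p = {v \<in> W1 \<Omega> p.
     \<forall>\<epsilon>>0. \<exists>\<phi>. test_function \<Omega> \<phi> \<and> W1_norm \<Omega> p (\<lambda>x. v x - \<phi> x) < \<epsilon>}"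

text \<open>The nonlinearity.\<close>

definition caratheodory :: "'a::euclidean_space set \<Rightarrow> ('a \<Rightarrow> real \<Rightarrow> real) \<Rightarrow> bool" where
  "caratheodory \<Omega> f \<longleftrightarrow>
     (\<forall>s. (\<lambda>x. f x s) \<in> borel_measurable (lebesgue_on \<Omega>)) \<and>
     (AE x in lebesgue_on \<Omega>. continuous_on UNIV (f x))"

text \<open>The interval integral is oriented: for \<open>t < 0\<close> it is minus the integral over \<open>(t, 0)\<close>.\<close>

definition primitive :: "('a \<Rightarrow> real \<Rightarrow> real) \<Rightarrow> 'a \<Rightarrow> real \<Rightarrow> real" where
  "primitive f x t = (LBINT s=ereal 0..ereal t. f x s)"

text \<open>On the reals, \<open>at_infinity\<close> is the filter \<open>\<bar>s\<bar> \<rightarrow> \<infinity>\<close>.\<close>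

definition A_inf :: "real \<Rightarrow> ('a \<Rightarrow> real \<Rightarrow> real) \<Rightarrow> 'a \<Rightarrow> ereal" where
  "A_inf \<gamma> f x = Limsup at_infinity (\<lambda>s. ereal (primitive f x s / \<bar>s\<bar> powr \<gamma>))"

text \<open>Integral of an extended-real function, positive part minus negative part (\<open>e2ennreal\<close>
  sends negative numbers to 0). It is only meaningful if one of the parts is finite.\<close>

definition ereal_integral :: "'a measure \<Rightarrow> ('a \<Rightarrow> ereal) \<Rightarrow> ereal" where
  "ereal_integral M g =
     enn2ereal (\<integral>\<^sup>+ x. e2ennreal (g x) \<partial>M) - enn2ereal (\<integral>\<^sup>+ x. e2ennreal (- g x) \<partial>M)"

text \<open>Weak solutions. The integrals in the weak formulation are required to exist, since the
  Bochner integral of a non-integrable function is 0 by convention.\<close>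

definition flux :: "real \<Rightarrow> 'a::euclidean_space \<Rightarrow> 'a" where
  "flux \<gamma> z =
     (\<gamma> * (sqrt (1 + (norm z)\<^sup>2) - 1) powr (\<gamma> - 1) / sqrt (1 + (norm z)\<^sup>2)) *\<^sub>R z"

definition weak_solution ::
    "'a::euclidean_space set \<Rightarrow> real \<Rightarrow> ('a \<Rightarrow> real \<Rightarrow> real) \<Rightarrow> ('a \<Rightarrow> real) \<Rightarrow> ('a \<Rightarrow> real) \<Rightarrow> bool"
  where
  "weak_solution \<Omega> \<gamma> f h u \<longleftrightarrow> u \<in> W1_0 \<Omega> \<gamma> \<and>
     (\<forall>v\<in>W1_0 \<Omega> \<gamma>.
        integrable (lebesgue_on \<Omega>) (\<lambda>x. flux \<gamma> (weak_grad \<Omega> u x) \<bullet> weak_grad \<Omega> v x) \<and>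
        integrable (lebesgue_on \<Omega>) (\<lambda>x. f x (u x) * v x) \<and>
        integrable (lebesgue_on \<Omega>) (\<lambda>x. h x * v x) \<and>
        (LINT x|lebesgue_on \<Omega>. flux \<gamma> (weak_grad \<Omega> u x) \<bullet> weak_grad \<Omega> v x) =
        (LINT x|lebesgue_on \<Omega>. f x (u x) * v x) + (LINT x|lebesgue_on \<Omega>. h x * v x))"

end

theory Submission
  imports Defs "HOL-Library.Diagonal_Subsequence"
begin

text \<open>
  The solution is a global minimizer over \<open>W\<^sub>0\<^sup>1\<^sup>,\<^sup>\<gamma>\<close> of the energy
  \<open>E(u) = \<integral>\<Phi>(\<nabla>u) - \<integral>F(x,u) - \<integral>hu\<close>, where \<open>\<Phi>(z) = (sqrt(1 + |z|\<^sup>2) - 1)\<^sup>\<gamma>\<close> is convex and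
  has gradient \<open>flux \<gamma>\<close>. So the weak equation is the Euler equation of \<open>E\<close>, and everything rests on
  coercivity and lower semicontinuity.

  Coercivity (\<open>recession_contradiction\<close>, \<open>sublevel_p_mass_bounded\<close>). If \<open>E(u\<^sub>n) \<le> C\<close> while
  \<open>t\<^sub>n = |u\<^sub>n|\<close> tends to infinity in \<open>L\<^sup>\<gamma>\<close>, put \<open>v\<^sub>n = u\<^sub>n / t\<^sub>n\<close>. As \<open>\<Phi>(tz) \<ge> t\<^sup>\<gamma> \<Phi>(z)\<close> for \<open>t \<ge> 1\<close>,
  dividing by \<open>t\<^sub>n\<^sup>\<gamma>\<close> gives \<open>\<integral>\<Phi>(\<nabla>v\<^sub>n) \<le> \<integral>F(x,t\<^sub>n v\<^sub>n)/t\<^sub>n\<^sup>\<gamma> + o(1)\<close>. The upper bound on \<open>F\<close>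
  makes the gradients bounded, so a subsequence of \<open>v\<^sub>n\<close> converges to some \<open>v\<close> with \<open>|v| = 1\<close>, strongly in
  \<open>L\<^sup>\<gamma>\<close> and almost everywhere. Where \<open>v \<noteq> 0\<close> the quotients have upper limit at most
  \<open>A\<^sub>\<infinity> |v|\<^sup>\<gamma>\<close>; where \<open>v = 0\<close> their upper limit is at most \<open>0\<close>. Fatou's lemma then yields
  \<open>\<integral>\<Phi>(\<nabla>v) \<le> \<integral>A\<^sub>\<infinity> |v|\<^sup>\<gamma>\<close>, against hypothesis (iii).

  Lower semicontinuity (\<open>energy_lsc\<close>). The bound \<open>F \<le> A|s|\<^sup>\<gamma> + B\<close> controls \<open>-F\<close> from below by something
  continuous in \<open>L\<^sup>\<gamma>\<close>, so Fatou's lemma handles the lower-order part even though the growth in (i) is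
  critical. For the gradient part no weak topology is used: near-minimizers of the \<open>L\<^sup>\<gamma>\<close> norm among iterated
  midpoints of the tails of the sequence of gradients form a Cauchy sequence by uniform convexity
  (\<open>mid_hull_minimizing_limit\<close>). Its limit is the gradient of the limit function, and convexity bounds its
  \<open>\<Phi>\<close>-integral (\<open>W0_compactness\<close>).

  The tools are the Sobolev inequality, which makes the critical integrals finite
  (\<open>sobolev_inequality\<close>, from Gagliardo's estimate \<open>gagliardo\<close>); Rellich's theorem (\<open>rellich_L1\<close>: ball means
  of bounded families are equicontinuous and close in \<open>L\<^sup>1\<close> to the functions themselves), upgraded to \<open>L\<^sup>\<gamma>\<close>
  by interpolation with the critical norm; and uniqueness of weak gradients (\<open>has_weak_grad_unique\<close>, by
  testing with smooth functions that approximate indicators of boxes). With uniqueness the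
  space \<open>W\<^sub>0\<^sup>1\<^sup>,\<^sup>\<gamma>\<close> is described by pairs of a function and its gradient that are limits of pairs
  \<open>(\<phi>, \<nabla>\<phi>)\<close> (\<open>W0\<close>), which avoids the choice made in \<open>weak_grad\<close>.

  The Euler equation (\<open>minimizer_variational_inequality\<close>) needs no derivative of \<open>\<Phi>\<close>: the tangent inequality
  \<open>\<Phi>(z + tk) - \<Phi>(z) \<le> t flux(z + tk) \<bullet> k\<close>, continuity of the flux and dominated convergence give one inequality
  for each direction, and the opposite direction gives the other one.
\<close>

section \<open>Convexity of powers\<close>

text \<open>Young's inequality applied to \<open>r\<close> and \<open>s\<^sup>p\<^sup>-\<^sup>1\<close>; this
  form also covers \<open>r = 0\<close> and \<open>s = 0\<close>, where the power function has no
  convenient derivative. The convexity inequalities below rest on it.\<close>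

lemma powr_tangent:
  fixes r s p :: real
  assumes "p > 1" "r \<ge> 0" "s \<ge> 0"
  shows "s powr p + p * s powr (p - 1) * (r - s) \<le> r powr p"
proof -
  have "1/p + 1/(p/(p-1)) = 1" "p/(p-1) > 1"
    using assms by (auto simp: field_simps)
  from Youngs_inequality[OF assms(1) this(2,1), of r "s powr (p-1)"] assms
  have "r * s powr (p-1) \<le> r powr p / p + s powr p / (p/(p-1))"
    by (simp add: powr_powr)
  then have "p * (r * s powr (p-1)) \<le> p * (r powr p / p + s powr p / (p/(p-1)))"
    using assms by (intro mult_left_mono) auto
  moreover have "p * (r powr p / p + s powr p / (p/(p-1))) = r powr p + (p - 1) * s powr p"
    using assms by (simp add: distrib_left)
  ultimately have 1: "p * (r * s powr (p-1)) \<le> r powr p + (p - 1) * s powr p"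
    by simp
  have 2: "s powr (p-1) * s = s powr p"
    using assms by (cases "s = 0") (auto simp: powr_diff)
  show ?thesis using 1 2 by (simp add: algebra_simps)
qed

lemma powr_mean_le:
  fixes r s p l :: real
  assumes "p > 1" "r \<ge> 0" "s \<ge> 0" "0 \<le> l" "l \<le> 1"
  shows "((1 - l) * r + l * s) powr p \<le> (1 - l) * r powr p + l * s powr p"
proof -
  define m where "m = (1 - l) * r + l * s"
  have m: "m \<ge> 0" using assms unfolding m_def by auto
  have "(1-l) * (m powr p + p * m powr (p-1) * (r - m)) \<le> (1-l) * r powr p"
    using powr_tangent[OF assms(1,2) m] assms by (intro mult_left_mono) auto
  moreover have "l * (m powr p + p * m powr (p-1) * (s - m)) \<le> l * s powr p"
    using powr_tangent[OF assms(1,3) m] assms by (intro mult_left_mono) auto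
  ultimately have "(1-l) * (m powr p + p * m powr (p-1) * (r - m)) + l * (m powr p + p * m powr (p-1) * (s - m))
      \<le> (1-l) * r powr p + l * s powr p" by linarith
  also have "(1-l) * (m powr p + p * m powr (p-1) * (r - m)) + l * (m powr p + p * m powr (p-1) * (s - m))
     = m powr p + p * m powr (p-1) * ((1 - l) * r + l * s - m)" by (simp add: algebra_simps)
  finally show ?thesis by (simp add: m_def)
qed

lemma powr_midpoint_less:
  fixes r s p :: real
  assumes "p > 1" "0 \<le> s" "s < r"
  shows "((r + s) / 2) powr p < (r powr p + s powr p) / 2"
proof -
  define m where "m = (r + s) / 2"
  have m: "0 < m" "m < r" using assms by (auto simp: m_def)
  have "\<exists>z. m < z \<and> z < r \<and> r powr p - m powr p = (r - m) * (p * z powr (p - 1))"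
    using m by (intro MVT2) (auto intro!: derivative_eq_intros)
  then obtain z where z: "m < z" "z < r" "r powr p - m powr p = (r - m) * (p * z powr (p - 1))" by blast
  have "m powr (p-1) < z powr (p-1)" using z m assms by (intro powr_less_mono2) auto
  then have "(r - m) * (p * m powr (p-1)) < (r - m) * (p * z powr (p-1))"
    using m assms by (intro mult_strict_left_mono) auto
  then have "r powr p > m powr p + p * m powr (p-1) * (r - m)"
    using z(3) by (simp add: algebra_simps)
  moreover have "s powr p \<ge> m powr p + p * m powr (p-1) * (s - m)"
    using powr_tangent[of p s m] assms m by auto
  moreover have "p * m powr (p-1) * (r - m) + p * m powr (p-1) * (s - m) = 0"
    by (simp add: m_def field_simps)
  ultimately show ?thesis by (simp add: m_def)
qed

lemma norm_powr_mean_le: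
  fixes a b :: "'b::real_normed_vector"
  assumes "p > 1" "0 \<le> l" "l \<le> 1"
  shows "norm ((1 - l) *\<^sub>R a + l *\<^sub>R b) powr p \<le> (1 - l) * norm a powr p + l * norm b powr p"
proof -
  have "norm ((1 - l) *\<^sub>R a + l *\<^sub>R b) \<le> (1 - l) * norm a + l * norm b"
    using norm_triangle_ineq[of "(1 - l) *\<^sub>R a" "l *\<^sub>R b"] assms by auto
  then have "norm ((1 - l) *\<^sub>R a + l *\<^sub>R b) powr p \<le> ((1 - l) * norm a + l * norm b) powr p"
    using assms by (intro powr_mono2) auto
  also have "\<dots> \<le> (1 - l) * norm a powr p + l * norm b powr p"
    using assms by (intro powr_mean_le) auto
  finally show ?thesis .
qed

text \<open>Write \<open>a + b\<close> as a convex combination of \<open>a/(1 - l)\<close> and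
  \<open>b/l\<close> with small \<open>l\<close>. Having a factor close to \<open>1\<close> in
  front of \<open>|a|\<^sup>p\<close> replaces Minkowski's inequality when norms of convergent
  sequences are compared.\<close>

lemma norm_powr_add_le_weighted:
  fixes \<epsilon> p :: real
  assumes "p > 1" "\<epsilon> > 0"
  obtains C where "C > 0"
    "\<And>a b :: 'b::real_normed_vector. norm (a + b) powr p \<le> (1 + \<epsilon>) * norm a powr p + C * norm b powr p"
proof -
  \<comment> \<open>chosen such that the convex combination with weights \<open>k\<close> and \<open>1 - k\<close> gives exactly the factor \<open>1 + \<epsilon>\<close>\<close>
  define k where "k = (1 + \<epsilon>) powr (- 1 / (p - 1))"
  define l where "l = 1 - k"
  have k: "0 < k" "k < 1" using assms by (auto simp: k_def powr_less_one)
  have kp: "k * (1 / k) powr p = 1 + \<epsilon>"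
  proof -
    have "k * (1/k) powr p = k powr 1 * k powr (- p)"
      using k by (simp add: powr_minus powr_divide divide_simps)
    also have "\<dots> = k powr (1 - p)" by (simp only: powr_add[symmetric]) simp
    also have "\<dots> = (1 + \<epsilon>) powr (- 1 / (p - 1) * (1 - p))"
      by (simp add: k_def powr_powr)
    also have "- 1 / (p - 1) * (1 - p) = 1" using assms by (simp add: field_simps)
    also have "(1 + \<epsilon>) powr 1 = 1 + \<epsilon>" using assms by simp
    finally show ?thesis .
  qed
  have l: "0 < l" "l < 1" using k by (auto simp: l_def)
  show ?thesis
  proof
    show "l * (1 / l) powr p > 0" using l by auto
    fix a b :: 'b
    have "norm (a + b) powr p = norm ((1 - l) *\<^sub>R ((1/k) *\<^sub>R a) + l *\<^sub>R ((1/l) *\<^sub>R b)) powr p"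
      using k l by (simp add: l_def)
    also have "\<dots> \<le> (1 - l) * norm ((1/k) *\<^sub>R a) powr p + l * norm ((1/l) *\<^sub>R b) powr p"
      using assms l by (intro norm_powr_mean_le) auto
    also have "\<dots> = (k * (1/k) powr p) * norm a powr p + l * (1/l) powr p * norm b powr p"
      using k l by (simp add: powr_mult powr_divide l_def)
    also note kp
    finally show "norm (a + b) powr p \<le> (1 + \<epsilon>) * norm a powr p + l * (1 / l) powr p * norm b powr p" .
  qed
qed

lemma norm_powr_add_le:
  fixes a b :: "'b::real_normed_vector"
  assumes "p > 1"
  shows "norm (a + b) powr p \<le> 2 powr p * (norm a powr p + norm b powr p)"
proof -
  have "norm (a+b) powr p = norm ((1 - 1/2) *\<^sub>R (2 *\<^sub>R a) + (1/2) *\<^sub>R (2 *\<^sub>R b)) powr p" by simp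
  also have "\<dots> \<le> (1 - 1/2) * norm (2 *\<^sub>R a) powr p + (1/2) * norm (2 *\<^sub>R b) powr p"
    using assms by (intro norm_powr_mean_le) auto
  also have "\<dots> = (2 powr p / 2) * (norm a powr p + norm b powr p)"
    by (simp add: powr_mult field_simps)
  also have "\<dots> \<le> 2 powr p * (norm a powr p + norm b powr p)"
    by (intro mult_right_mono) auto
  finally show ?thesis .
qed

lemma norm_powr_diff_le:
  fixes a b :: "'b::real_normed_vector"
  assumes "p > 1"
  shows "norm (a - b) powr p \<le> 2 powr p * (norm a powr p + norm b powr p)"
  using norm_powr_add_le[OF assms, of a "- b"] by simp

lemma norm_powr_midpoint_le:
  fixes a b :: "'b::real_normed_vector"
  assumes "p > 1"
  shows "norm ((1/2) *\<^sub>R (a + b)) powr p \<le> (norm a powr p + norm b powr p) / 2"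
  using norm_powr_mean_le[OF assms, of "1/2" a b] by (simp add: scaleR_add_right)

lemma norm_powr_midpoint_less:
  fixes a b :: "'b::real_inner"
  assumes "p > 1" "a \<noteq> b"
  shows "norm ((1/2) *\<^sub>R (a + b)) powr p < (norm a powr p + norm b powr p) / 2"
proof (cases "norm a = norm b")
  case True
  have "norm (a + b) \<noteq> norm a + norm b"
  proof
    assume "norm (a + b) = norm a + norm b"
    then have "norm a *\<^sub>R b = norm b *\<^sub>R a" by (simp add: norm_triangle_eq)
    then show False using True assms by auto
  qed
  then have "norm (a + b) < norm a + norm b" using norm_triangle_ineq[of a b] by simp
  then have "norm ((1/2) *\<^sub>R (a + b)) < norm a" using True by simp
  then have "norm ((1/2) *\<^sub>R (a + b)) powr p < norm a powr p"
    using assms by (intro powr_less_mono2) auto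
  then show ?thesis using True by simp
next
  case False
  have "norm ((1/2) *\<^sub>R (a + b)) \<le> (norm a + norm b) / 2" using norm_triangle_ineq[of a b] by simp
  then have "norm ((1/2) *\<^sub>R (a + b)) powr p \<le> ((norm a + norm b) / 2) powr p"
    using assms by (intro powr_mono2) auto
  also have "\<dots> < (norm a powr p + norm b powr p) / 2"
    using False powr_midpoint_less[OF assms(1), of "norm a" "norm b"] powr_midpoint_less[OF assms(1), of "norm b" "norm a"]
    by (cases "norm a < norm b") (auto simp: add.commute)
  finally show ?thesis .
qed

text \<open>By homogeneity it suffices to treat pairs with \<open>|a|\<^sup>p + |b|\<^sup>p = 1\<close>. Those
  with \<open>|a - b|\<^sup>p \<ge> \<epsilon>\<close> form a compact set, on which the midpoint
  defect has a positive minimum by strict convexity. Being pointwise, the estimate can be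
  integrated and gives uniform convexity of \<open>L\<^sup>p\<close>.\<close>

lemma norm_powr_uniformly_convex:
  fixes p \<epsilon> :: real
  assumes "p > 1" "\<epsilon> > 0"
  obtains c where "c > 0"
    "\<And>a b :: 'b::euclidean_space. norm (a - b) powr p
       \<le> \<epsilon> * (norm a powr p + norm b powr p)
         + c * ((norm a powr p + norm b powr p) / 2 - norm ((1/2) *\<^sub>R (a + b)) powr p)"
proof -
  define S :: "('b \<times> 'b) set" where
    "S = {x. norm (fst x) powr p + norm (snd x) powr p = 1 \<and> norm (fst x - snd x) powr p \<ge> \<epsilon>}"
  define D :: "('b \<times> 'b) \<Rightarrow> real" where
    "D = (\<lambda>x. (norm (fst x) powr p + norm (snd x) powr p) / 2 - norm ((1/2) *\<^sub>R (fst x + snd x)) powr p)"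
  have contD: "continuous_on UNIV D"
    unfolding D_def using assms by (intro continuous_intros continuous_on_powr') auto
  have clS: "closed S"
    unfolding S_def using assms
    by (intro closed_Collect_conj closed_Collect_eq closed_Collect_le continuous_intros continuous_on_powr') auto
  have bS: "bounded S"
  proof -
    have "norm x \<le> 2" if "x \<in> S" for x
    proof -
      have *: "t \<le> 1" if "t \<ge> 0" "t powr p \<le> 1" for t :: real
      proof (rule ccontr)
        assume "\<not> t \<le> 1"
        then have "1 powr p < t powr p" using assms by (intro powr_less_mono2) auto
        then show False using that by simp
      qed
      have "norm (fst x) powr p + norm (snd x) powr p = 1" using that by (simp add: S_def)
      then have "norm (fst x) powr p \<le> 1" "norm (snd x) powr p \<le> 1"
        by (metis add_increasing2 le_add_same_cancel1 powr_ge_zero order_refl, metis le_add_same_cancel2 powr_ge_zero)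
      then have "norm (fst x) \<le> 1" "norm (snd x) \<le> 1" using * by auto
      then show ?thesis using norm_Pair_le[of "fst x" "snd x"] by simp
    qed
    then show ?thesis unfolding bounded_iff by blast
  qed
  have pos: "D x > 0" if "x \<in> S" for x
  proof -
    have "fst x \<noteq> snd x" using that assms by (auto simp: S_def)
    from norm_powr_midpoint_less[OF assms(1) this] show ?thesis by (simp add: D_def)
  qed
  obtain m where m: "m > 0" "\<And>x. x \<in> S \<Longrightarrow> D x \<ge> m"
  proof (cases "S = {}")
    case True
    then show ?thesis using that[of 1] by auto
  next
    case False
    have "compact S" using clS bS by (simp add: compact_eq_bounded_closed)
    from continuous_attains_inf[OF this False continuous_on_subset[OF contD]]
    obtain x0 where "x0 \<in> S" "\<forall>y\<in>S. D x0 \<le> D y" by auto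
    then show ?thesis using that[of "D x0"] pos by auto
  qed
  show ?thesis
  proof
    show "2 powr p / m > 0" using m by simp
    fix a b :: 'b
    define s where "s = norm a powr p + norm b powr p"
    have s0: "s \<ge> 0" by (simp add: s_def)
    have D0: "D (a, b) \<ge> 0"
      using norm_powr_midpoint_le[OF assms(1), of a b] by (simp add: D_def)
    have "norm (a - b) powr p \<le> \<epsilon> * s + 2 powr p / m * D (a, b)"
    proof (cases "norm (a - b) powr p \<le> \<epsilon> * s")
      case True
      then show ?thesis using m D0 by (smt (verit) divide_nonneg_pos mult_nonneg_nonneg powr_ge_zero)
    next
      case False
      have "s \<noteq> 0"
      proof
        assume "s = 0"
        then have "norm a powr p = 0" "norm b powr p = 0" using powr_ge_zero[of "norm a" p] powr_ge_zero[of "norm b" p]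
          unfolding s_def by linarith+
        then show False using False \<open>s = 0\<close> by simp
      qed
      then have s: "s > 0" using s0 by simp
      \<comment> \<open>scales the pair into the compact set \<open>S\<close>\<close>
      define t where "t = s powr (- 1 / p)"
      have "t powr p = s powr (- 1 / p * p)" unfolding t_def powr_powr ..
      also have "- 1 / p * p = - 1" using assms by simp
      also have "s powr (- 1) = 1 / s" using s by (simp add: powr_minus_divide)
      finally have t: "t > 0" "t powr p = 1 / s" using s by (auto simp: t_def)
      have sc: "norm (t *\<^sub>R x) powr p = norm x powr p / s" for x :: 'b
        using t by (simp add: powr_mult)
      have "norm (t *\<^sub>R a) powr p + norm (t *\<^sub>R b) powr p = 1"
        unfolding sc using s by (simp add: s_def flip: add_divide_distrib)
      moreover have "norm (t *\<^sub>R a - t *\<^sub>R b) powr p \<ge> \<epsilon>"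
      proof -
        have "\<epsilon> * s < norm (t *\<^sub>R a - t *\<^sub>R b) powr p * s"
          using False s sc[of "a - b"] by (simp add: scaleR_diff_right)
        then show ?thesis using s by simp
      qed
      ultimately have "(t *\<^sub>R a, t *\<^sub>R b) \<in> S" by (simp add: S_def)
      then have "m \<le> D (t *\<^sub>R a, t *\<^sub>R b)" by (rule m)
      also have "D (t *\<^sub>R a, t *\<^sub>R b) = D (a, b) / s"
        using sc[of a] sc[of b] sc[of "(1/2) *\<^sub>R (a + b)"]
        by (simp add: D_def scaleR_add_right diff_divide_distrib add_divide_distrib mult.commute)
      finally have "m * s \<le> D (a, b)" using s by (simp add: field_simps)
      then have "s \<le> D (a, b) / m" using m by (simp add: field_simps)
      then have "2 powr p * s \<le> 2 powr p / m * D (a, b)"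
        by (metis mult_left_mono powr_ge_zero times_divide_eq_left times_divide_eq_right)
      moreover have "norm (a - b) powr p \<le> 2 powr p * s"
        using norm_powr_diff_le[OF assms(1)] by (simp add: s_def)
      moreover have "0 \<le> \<epsilon> * s" using assms s by simp
      ultimately show ?thesis by linarith
    qed
    then show "norm (a - b) powr p
       \<le> \<epsilon> * (norm a powr p + norm b powr p)
         + 2 powr p / m * ((norm a powr p + norm b powr p) / 2 - norm ((1/2) *\<^sub>R (a + b)) powr p)"
      by (simp add: s_def D_def)
  qed
qed

text \<open>The larger of \<open>a\<close> and \<open>b\<close> bounds both factors.\<close>

lemma powr_mult_le_add:
  fixes a b p :: real
  assumes "p > 1" "a \<ge> 0" "b \<ge> 0"
  shows "a powr (p - 1) * b \<le> a powr p + b powr p"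
proof -
  have 2: "a powr (p-1) * a = a powr p"
    using assms by (cases "a = 0") (auto simp: powr_diff)
  show ?thesis
  proof (cases "b \<le> a")
    case True
    then have "a powr (p - 1) * b \<le> a powr (p - 1) * a" by (intro mult_left_mono) auto
    then show ?thesis using 2 by (smt (verit) powr_ge_zero)
  next
    case False
    then have "a powr (p - 1) * b \<le> b powr (p - 1) * b" using assms
      by (intro mult_right_mono powr_mono2) auto
    also have "\<dots> = b powr p" using assms by (cases "b = 0") (auto simp: powr_diff)
    finally show ?thesis by (smt (verit) powr_ge_zero)
  qed
qed

section \<open>The convex integrand\<close>

definition area_excess :: "'a::euclidean_space \<Rightarrow> real" where
  "area_excess z = sqrt (1 + (norm z)\<^sup>2) - 1"

lemma area_excess_nonneg: "area_excess z \<ge> 0" by (simp add: area_excess_def)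

lemma area_excess_le: "area_excess z \<le> norm z"
proof -
  have "sqrt (1 + (norm z)\<^sup>2) \<le> sqrt ((1 + norm z)\<^sup>2)" 
    by (intro real_sqrt_le_mono) (simp add: power2_eq_square algebra_simps)
  then show ?thesis by (simp add: area_excess_def)
qed

lemma norm_le_area_excess: "norm z \<le> area_excess z + 1"
proof -
  have "sqrt ((norm z)\<^sup>2) \<le> sqrt (1 + (norm z)\<^sup>2)" by (intro real_sqrt_le_mono) simp
  then show ?thesis by (simp add: area_excess_def)
qed

text \<open>Equivalent to \<open>1 + z \<bullet> w \<le> sqrt(1 + |z|\<^sup>2) sqrt(1 + |w|\<^sup>2)\<close>,
  the Cauchy-Schwarz inequality for \<open>(1,z)\<close> and \<open>(1,w)\<close>.\<close>

lemma area_excess_tangent: "area_excess z + z \<bullet> (w - z) / sqrt (1 + (norm z)\<^sup>2) \<le> area_excess w"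
proof -
  define r where "r = sqrt (1 + (norm z)\<^sup>2)"
  define q where "q = sqrt (1 + (norm w)\<^sup>2)"
  have r: "r > 0" "r\<^sup>2 = 1 + (norm z)\<^sup>2" and q: "q > 0" "q\<^sup>2 = 1 + (norm w)\<^sup>2" by (auto simp: r_def q_def add_pos_nonneg)
  have "1 + z \<bullet> w \<le> r * q"
  proof -
    have "1 + z \<bullet> w \<le> 1 + norm z * norm w" using norm_cauchy_schwarz[of z w] by simp
    also have "\<dots> \<le> r * q"
    proof (rule power2_le_imp_le)
      have "0 \<le> (norm z - norm w)\<^sup>2" by simp
      then have "(1 + norm z * norm w)\<^sup>2 \<le> (1 + (norm z)\<^sup>2) * (1 + (norm w)\<^sup>2)"
        by (simp add: power2_eq_square algebra_simps)
      then show "(1 + norm z * norm w)\<^sup>2 \<le> (r * q)\<^sup>2" using r q by (simp add: power_mult_distrib)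
    qed (use r q in auto)
    finally show ?thesis .
  qed
  then have "r\<^sup>2 + z \<bullet> (w - z) \<le> r * q"
    using r by (simp add: inner_diff_right power2_norm_eq_inner)
  then have "r + z \<bullet> (w - z) / r \<le> q" using r by (simp add: field_simps power2_eq_square)
  then show ?thesis by (simp add: area_excess_def r_def q_def)
qed

definition Phi :: "real \<Rightarrow> 'a::euclidean_space \<Rightarrow> real" where
  "Phi p z = area_excess z powr p"

lemma Phi_nonneg: "Phi p z \<ge> 0" by (simp add: Phi_def)

lemma Phi_le: "p > 1 \<Longrightarrow> Phi p z \<le> norm z powr p"
  unfolding Phi_def by (intro powr_mono2) (auto simp: area_excess_nonneg area_excess_le)

lemma norm_powr_le_Phi:
  assumes "p > 1" shows "norm z powr p \<le> 2 powr p * (Phi p z + 1)"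
proof -
  have "norm z powr p \<le> (area_excess z + 1) powr p"
    using assms norm_le_area_excess by (intro powr_mono2) (auto simp: add.commute)
  also have "\<dots> \<le> 2 powr p * (Phi p z + 1)"
    using norm_powr_add_le[OF assms, of "area_excess z" 1] area_excess_nonneg[of z] by (simp add: Phi_def)
  finally show ?thesis .
qed

text \<open>The power tangent inequality composed with the tangent inequality of the area excess. It says that
  the flux is a subgradient, which is the only differential information on \<open>Phi\<close> in
  the whole proof.\<close>

lemma Phi_tangent:
  assumes "p > 1" shows "Phi p z + flux p z \<bullet> (w - z) \<le> Phi p w"
proof -
  have "Phi p z + flux p z \<bullet> (w - z)
      = area_excess z powr p + p * area_excess z powr (p - 1) * (z \<bullet> (w - z) / sqrt (1 + (norm z)\<^sup>2))"
    by (simp add: Phi_def flux_def area_excess_def)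
  also have "\<dots> \<le> area_excess z powr p + p * area_excess z powr (p - 1) * (area_excess w - area_excess z)"
    using area_excess_tangent[of z w] assms by (intro add_left_mono mult_left_mono) auto
  also have "\<dots> \<le> Phi p w"
    unfolding Phi_def using assms by (intro powr_tangent) (auto simp: area_excess_nonneg)
  finally show ?thesis .
qed

lemma Phi_midpoint_le:
  assumes "p > 1" shows "Phi p ((1/2) *\<^sub>R (a + b)) \<le> (Phi p a + Phi p b) / 2"
proof -
  define m where "m = (1/2) *\<^sub>R (a + b)"
  have "Phi p m + flux p m \<bullet> (a - m) \<le> Phi p a" "Phi p m + flux p m \<bullet> (b - m) \<le> Phi p b"
    using Phi_tangent[OF assms] by blast+
  moreover have "flux p m \<bullet> (a - m) + flux p m \<bullet> (b - m) = flux p m \<bullet> (a + b - 2 *\<^sub>R m)"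
    by (simp add: inner_add_right inner_diff_right)
  moreover have "a + b - 2 *\<^sub>R m = 0" by (simp add: m_def)
  ultimately show ?thesis unfolding m_def[symmetric] by (simp del: m_def) 
qed

text \<open>The area excess is convex and vanishes at \<open>0\<close>, hence superhomogeneous for factors at
  least \<open>1\<close>. This is what lets the inhomogeneous functional of the nonresonance
  condition control rescaled sequences.\<close>

lemma Phi_scaleR_ge:
  assumes "p > 1" "t \<ge> 1" shows "t powr p * Phi p z \<le> Phi p (t *\<^sub>R z)"
proof -
  define r where "r = sqrt (1 + (norm z)\<^sup>2)"
  have r: "r \<ge> 1" "r\<^sup>2 = 1 + (norm z)\<^sup>2" by (auto simp: r_def)
  have "t * r - t + 1 \<le> sqrt (1 + (norm (t *\<^sub>R z))\<^sup>2)"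
  proof (rule real_le_rsqrt)
    have "(t - 1) * (2 * t) * (1 - r) \<le> 0"
      using r assms by (intro mult_nonneg_nonpos) auto
    moreover have "(norm (t *\<^sub>R z))\<^sup>2 = t\<^sup>2 * (r\<^sup>2 - 1)" using r by (simp add: power_mult_distrib)
    ultimately show "(t * r - t + 1)\<^sup>2 \<le> 1 + (norm (t *\<^sub>R z))\<^sup>2"
      by (simp add: power2_eq_square algebra_simps)
  qed
  then have "t * area_excess z \<le> area_excess (t *\<^sub>R z)" by (simp add: area_excess_def r_def algebra_simps)
  then have "(t * area_excess z) powr p \<le> Phi p (t *\<^sub>R z)"
    unfolding Phi_def using assms area_excess_nonneg[of z] by (intro powr_mono2) auto
  then show ?thesis using assms area_excess_nonneg[of z] by (simp add: Phi_def powr_mult)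
qed

lemma continuous_on_Phi: "p > 1 \<Longrightarrow> continuous_on UNIV (Phi p)"
  unfolding Phi_def area_excess_def 
  by (intro continuous_intros continuous_on_powr') auto

lemma continuous_on_flux: "p > 1 \<Longrightarrow> continuous_on UNIV (flux p)"
  unfolding flux_def 
  by (intro continuous_intros continuous_on_powr') (auto simp: real_sqrt_eq_zero_cancel_iff add_nonneg_eq_0_iff)

lemma norm_flux_le:
  assumes "p > 1" shows "norm (flux p z) \<le> p * norm z powr (p - 1)"
proof -
  define r where "r = sqrt (1 + (norm z)\<^sup>2)"
  have r: "r > 0" "norm z \<le> r" by (auto simp: r_def add_pos_nonneg real_le_rsqrt)
  have "norm (flux p z) = p * area_excess z powr (p - 1) * (norm z / r)"
    using assms r by (simp add: flux_def area_excess_def r_def abs_mult)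
  also have "\<dots> \<le> p * area_excess z powr (p - 1) * 1"
    using r assms by (intro mult_left_mono) auto
  also have "\<dots> \<le> p * norm z powr (p - 1)"
    using assms by (auto intro!: mult_left_mono powr_mono2 area_excess_le area_excess_nonneg)
  finally show ?thesis .
qed

section \<open>Spaces of p-integrable functions\<close>

text \<open>Fatou's lemma in the form used for all passages to the limit: the bound on the integrals is needed
  only eventually, and integrability of the limit is part of the conclusion.\<close>

lemma fatou_bound:
  fixes k :: "nat \<Rightarrow> 'a \<Rightarrow> real"
  assumes int: "\<And>n. integrable M (k n)" and nonneg: "\<And>n. AE x in M. 0 \<le> k n x"
    and lim: "AE x in M. (\<lambda>n. k n x) \<longlonglongrightarrow> l x" and meas: "l \<in> borel_measurable M"
    and bound: "eventually (\<lambda>n. (LINT x|M. k n x) \<le> c) sequentially"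
  shows "integrable M l" "(LINT x|M. l x) \<le> c"
proof -
  have [measurable]: "k n \<in> borel_measurable M" for n using int by auto
  have nonneg': "AE x in M. \<forall>n. 0 \<le> k n x" using nonneg by (simp add: AE_all_countable)
  have l0: "AE x in M. 0 \<le> l x"
    using lim nonneg' by eventually_elim (auto intro: LIMSEQ_le_const)
  have c0: "0 \<le> c"
  proof -
    obtain n where "(LINT x|M. k n x) \<le> c" using bound by (auto simp: eventually_sequentially)
    moreover have "0 \<le> (LINT x|M. k n x)" using nonneg by (rule integral_nonneg_AE)
    ultimately show ?thesis by simp
  qed
  have "(\<integral>\<^sup>+x. ennreal (l x) \<partial>M) = (\<integral>\<^sup>+x. liminf (\<lambda>n. ennreal (k n x)) \<partial>M)"
    using lim by (intro nn_integral_cong_AE, eventually_elim)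
      (simp add: lim_imp_Liminf[OF trivial_limit_sequentially tendsto_ennrealI])
  also have "\<dots> \<le> liminf (\<lambda>n. \<integral>\<^sup>+x. ennreal (k n x) \<partial>M)"
    by (intro nn_integral_liminf) measurable
  also have "\<dots> = liminf (\<lambda>n. ennreal (LINT x|M. k n x))"
    using int nonneg by (simp add: nn_integral_eq_integral)
  also have "\<dots> \<le> ennreal c"
  proof (rule Liminf_le)
    show "eventually (\<lambda>n. ennreal (LINT x|M. k n x) \<le> ennreal c) sequentially"
      using bound by eventually_elim (rule ennreal_leI)
  qed simp
  finally have le: "(\<integral>\<^sup>+x. ennreal (l x) \<partial>M) \<le> ennreal c" .
  show "integrable M l"
    using meas l0 le by (intro integrableI_nonneg) (auto intro: le_less_trans)
  then have "ennreal (LINT x|M. l x) = (\<integral>\<^sup>+x. ennreal (l x) \<partial>M)"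
    using l0 by (simp add: nn_integral_eq_integral)
  with le c0 show "(LINT x|M. l x) \<le> c" by (metis ennreal_le_iff)
qed

definition p_int :: "'a measure \<Rightarrow> real \<Rightarrow> ('a \<Rightarrow> 'b::euclidean_space) \<Rightarrow> bool" where
  "p_int M p g \<longleftrightarrow> g \<in> borel_measurable M \<and> integrable M (\<lambda>x. norm (g x) powr p)"

text \<open>The \<open>p\<close>-th power of the \<open>L\<^sup>p\<close> norm. Convexity of
  \<open>|\<cdot>|\<^sup>p\<close> makes it more convenient than the norm itself.\<close>

definition p_mass :: "'a measure \<Rightarrow> real \<Rightarrow> ('a \<Rightarrow> 'b::euclidean_space) \<Rightarrow> real" where
  "p_mass M p g = (LINT x|M. norm (g x) powr p)"

lemma p_int_measurable [measurable_dest]: "p_int M p g \<Longrightarrow> g \<in> borel_measurable M"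
  by (simp add: p_int_def)

lemma p_int_integrable: "p_int M p g \<Longrightarrow> integrable M (\<lambda>x. norm (g x) powr p)"
  by (simp add: p_int_def)

lemma p_mass_nonneg: "p_mass M p g \<ge> 0"
  by (simp add: p_mass_def)

lemma p_intI_bound:
  assumes "g \<in> borel_measurable M" "integrable M w" "AE x in M. norm (g x) powr p \<le> w x"
  shows "p_int M p g"
  unfolding p_int_def using assms
  by (auto intro!: Bochner_Integration.integrable_bound[OF assms(2)])

lemma p_int_add:
  assumes "p > 1" "p_int M p f" "p_int M p g"
  shows "p_int M p (\<lambda>x. f x + g x)" "p_mass M p (\<lambda>x. f x + g x) \<le> 2 powr p * (p_mass M p f + p_mass M p g)"
proof -
  have i: "integrable M (\<lambda>x. 2 powr p * (norm (f x) powr p + norm (g x) powr p))"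
    using assms by (auto simp: p_int_def)
  show 1: "p_int M p (\<lambda>x. f x + g x)"
    using assms norm_powr_add_le[OF assms(1)] by (intro p_intI_bound[OF _ i]) (auto simp: p_int_def)
  have "p_mass M p (\<lambda>x. f x + g x) \<le> (LINT x|M. 2 powr p * (norm (f x) powr p + norm (g x) powr p))"
    unfolding p_mass_def using i 1 norm_powr_add_le[OF assms(1)] by (intro integral_mono) (auto simp: p_int_def)
  then show "p_mass M p (\<lambda>x. f x + g x) \<le> 2 powr p * (p_mass M p f + p_mass M p g)"
    using assms by (simp add: p_mass_def p_int_def)
qed

lemma p_int_scaleR:
  assumes "p_int M p f"
  shows "p_int M p (\<lambda>x. c *\<^sub>R f x)" "p_mass M p (\<lambda>x. c *\<^sub>R f x) = \<bar>c\<bar> powr p * p_mass M p f"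
  using assms by (auto simp: p_int_def p_mass_def powr_mult)

lemma p_int_uminus:
  assumes "p_int M p f" shows "p_int M p (\<lambda>x. - f x)" "p_mass M p (\<lambda>x. - f x) = p_mass M p f"
  using assms by (auto simp: p_int_def p_mass_def)

lemma p_int_diff:
  assumes "p > 1" "p_int M p f" "p_int M p g"
  shows "p_int M p (\<lambda>x. f x - g x)" "p_mass M p (\<lambda>x. f x - g x) \<le> 2 powr p * (p_mass M p f + p_mass M p g)"
  using p_int_add[OF assms(1,2) p_int_uminus(1)[OF assms(3)]] p_int_uminus(2)[OF assms(3)] by auto

lemma p_mass_commute: "p_mass M p (\<lambda>x. f x - g x) = p_mass M p (\<lambda>x. g x - f x)"
  by (simp add: p_mass_def norm_minus_commute)

lemma p_mass_triangle:
  assumes "p > 1" "p_int M p f" "p_int M p g" "p_int M p h"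
  shows "p_mass M p (\<lambda>x. f x - h x) \<le> 2 powr p * (p_mass M p (\<lambda>x. f x - g x) + p_mass M p (\<lambda>x. g x - h x))"
  using p_int_add(2)[OF assms(1) p_int_diff(1)[OF assms(1,2,3)] p_int_diff(1)[OF assms(1,3,4)]] by simp

lemma p_int_midpoint:
  assumes "p > 1" "p_int M p f" "p_int M p g"
  shows "p_int M p (\<lambda>x. (1/2) *\<^sub>R (f x + g x))"
    "p_mass M p (\<lambda>x. (1/2) *\<^sub>R (f x + g x)) \<le> (p_mass M p f + p_mass M p g) / 2"
proof -
  show 1: "p_int M p (\<lambda>x. (1/2) *\<^sub>R (f x + g x))"
    using assms by (intro p_int_scaleR p_int_add)
  have "p_mass M p (\<lambda>x. (1/2) *\<^sub>R (f x + g x)) \<le> (LINT x|M. (norm (f x) powr p + norm (g x) powr p) / 2)"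
    unfolding p_mass_def using assms 1 norm_powr_midpoint_le[OF assms(1)]
    by (intro integral_mono) (auto simp: p_int_def)
  then show "p_mass M p (\<lambda>x. (1/2) *\<^sub>R (f x + g x)) \<le> (p_mass M p f + p_mass M p g) / 2"
    using assms by (simp add: p_mass_def p_int_def)
qed

lemma p_mass_cong_AE:
  assumes "AE x in M. f x = g x" "f \<in> borel_measurable M" "g \<in> borel_measurable M"
  shows "p_mass M p f = p_mass M p g"
  unfolding p_mass_def using assms by (intro integral_cong_AE) auto

lemma p_int_cong_AE:
  assumes "AE x in M. f x = g x" "p_int M p f" "g \<in> borel_measurable M"
  shows "p_int M p g"
  using assms unfolding p_int_def
  by (auto intro!: Bochner_Integration.integrable_cong_AE_imp[of M "\<lambda>x. norm (f x) powr p"])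

text \<open>The free parameter \<open>e\<close> turns smallness of \<open>p\<close>-th powers into smallness
  of first powers on a space of finite measure, without Holder's inequality.\<close>

lemma norm_le_powr_eps:
  fixes z :: "'b::real_normed_vector"
  assumes "p > 1" "e > 0"
  shows "norm z \<le> e + e powr (1 - p) * norm z powr p"
proof (cases "norm z \<le> e")
  case False
  then have "e powr (p - 1) \<le> norm z powr (p - 1)" using assms by (intro powr_mono2) auto
  then have "e powr (1 - p) * e powr (p - 1) * norm z \<le> e powr (1 - p) * norm z powr (p - 1) * norm z"
    by (intro mult_right_mono mult_left_mono) auto
  moreover have "e powr (1 - p) * e powr (p - 1) = 1" using assms by (simp flip: powr_add)
  moreover have "norm z powr (p - 1) * norm z = norm z powr p" using False assms by (simp add: powr_diff)
  ultimately show ?thesis using assms by (simp add: mult.assoc)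
qed (use assms in \<open>simp add: add_increasing2\<close>)

lemma (in finite_measure) p_int_imp_integrable:
  assumes "p > 1" "p_int M p g"
  shows "integrable M g"
proof (rule Bochner_Integration.integrable_bound)
  show "integrable M (\<lambda>x. 1 + 1 powr (1 - p) * norm (g x) powr p)"
    using assms by (auto simp: p_int_def)
  show "AE x in M. norm (g x) \<le> norm (1 + 1 powr (1 - p) * norm (g x) powr p)"
  proof (rule AE_I2)
    fix x
    have "norm (g x) \<le> 1 + 1 powr (1 - p) * norm (g x) powr p"
      using norm_le_powr_eps[OF assms(1), of 1 "g x"] by simp
    then show "norm (g x) \<le> norm (1 + 1 powr (1 - p) * norm (g x) powr p)"
      unfolding real_norm_def by linarith
  qed
qed (use assms in \<open>auto simp: p_int_def\<close>)

lemma (in finite_measure) integral_norm_le_p_mass: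
  assumes "p > 1" "p_int M p g" "e > 0"
  shows "(LINT x|M. norm (g x)) \<le> e * measure M (space M) + e powr (1 - p) * p_mass M p g"
proof -
  have "(LINT x|M. norm (g x)) \<le> (LINT x|M. e + e powr (1 - p) * norm (g x) powr p)"
    using assms p_int_imp_integrable[OF assms(1,2)] norm_le_powr_eps[OF assms(1,3)]
    by (intro integral_mono) (auto simp: p_int_def)
  also have "\<dots> = e * measure M (space M) + e powr (1 - p) * p_mass M p g"
    using assms by (simp add: p_int_def p_mass_def mult.commute)
  finally show ?thesis .
qed

lemma (in finite_measure) integral_norm_small:
  assumes "p > 1" "\<epsilon> > 0"
  obtains \<delta> where "\<delta> > 0" "\<And>g :: 'a \<Rightarrow> 'b::euclidean_space. p_int M p g \<Longrightarrow> p_mass M p g < \<delta> \<Longrightarrow> (LINT x|M. norm (g x)) < \<epsilon>"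
proof -
  define m where "m = measure M (space M)"
  define e where "e = \<epsilon> / (2 * (m + 1))"
  have m: "m \<ge> 0" by (simp add: m_def)
  have e: "e > 0" using assms m by (simp add: e_def)
  have em: "e * m \<le> \<epsilon> / 2"
  proof -
    have "e * m \<le> e * (m + 1)" using e by simp
    also have "\<dots> = \<epsilon> / 2" using m by (simp add: e_def divide_simps)
    finally show ?thesis .
  qed
  define \<delta> where "\<delta> = \<epsilon> / 2 / e powr (1 - p)"
  show ?thesis
  proof
    show "\<delta> > 0" using e assms by (simp add: \<delta>_def)
    fix g :: "'a \<Rightarrow> 'b" assume g: "p_int M p g" "p_mass M p g < \<delta>"
    have "e powr (1 - p) * p_mass M p g < e powr (1 - p) * \<delta>"
      using g e by (intro mult_strict_left_mono) auto
    also have "\<dots> = \<epsilon> / 2" using e by (simp add: \<delta>_def)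
    finally show "(LINT x|M. norm (g x)) < \<epsilon>"
      using integral_norm_le_p_mass[OF assms(1) g(1) e] em by (simp add: m_def)
  qed
qed

lemma p_mass_le_weighted:
  fixes f g :: "'a \<Rightarrow> 'b::euclidean_space"
  assumes "p > 1" "\<epsilon> > 0"
  obtains C where "C > 0" "\<And>M (f :: 'a \<Rightarrow> 'b) g. p_int M p f \<Longrightarrow> p_int M p g \<Longrightarrow>
    p_mass M p f \<le> (1 + \<epsilon>) * p_mass M p g + C * p_mass M p (\<lambda>x. f x - g x)"
proof -
  from norm_powr_add_le_weighted[OF assms] obtain C where C: "C > 0"
    "\<And>a b :: 'b. norm (a + b) powr p \<le> (1 + \<epsilon>) * norm a powr p + C * norm b powr p" by metis
  show ?thesis
  proof
    show "C > 0" by fact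
    fix M and f g :: "'a \<Rightarrow> 'b" assume fg: "p_int M p f" "p_int M p g"
    have d: "p_int M p (\<lambda>x. f x - g x)" using p_int_diff[OF assms(1) fg] by simp
    have "norm (f x) powr p \<le> (1 + \<epsilon>) * norm (g x) powr p + C * norm (f x - g x) powr p" for x
      using C(2)[of "g x" "f x - g x"] by simp
    then have "p_mass M p f \<le> (LINT x|M. (1 + \<epsilon>) * norm (g x) powr p + C * norm (f x - g x) powr p)"
      unfolding p_mass_def using fg d by (intro integral_mono) (auto simp: p_int_def)
    then show "p_mass M p f \<le> (1 + \<epsilon>) * p_mass M p g + C * p_mass M p (\<lambda>x. f x - g x)"
      using fg d by (simp add: p_int_def p_mass_def)
  qed
qed

text \<open>The weighted inequality in both directions, with \<open>\<epsilon>\<close> small compared to the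
  mass of the limit.\<close>

lemma tendsto_p_mass:
  fixes g :: "nat \<Rightarrow> 'a \<Rightarrow> 'b::euclidean_space"
  assumes "p > 1" "\<And>n. p_int M p (g n)" "p_int M p l"
    and lim: "(\<lambda>n. p_mass M p (\<lambda>x. g n x - l x)) \<longlonglongrightarrow> 0"
  shows "(\<lambda>n. p_mass M p (g n)) \<longlonglongrightarrow> p_mass M p l"
proof (rule LIMSEQ_I)
  fix r :: real assume r: "r > 0"
  define m where "m = p_mass M p l"
  have m: "m \<ge> 0" by (simp add: m_def p_mass_nonneg)
  define \<epsilon> where "\<epsilon> = min 1 (r / (8 * (m + 1)))"
  have "\<epsilon> * (m + 1) \<le> r / (8 * (m + 1)) * (m + 1)" using m by (intro mult_right_mono) (auto simp: \<epsilon>_def)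
  also have "\<dots> = r / 8" using m by (simp add: divide_simps)
  finally have \<epsilon>: "\<epsilon> > 0" "\<epsilon> \<le> 1" "\<epsilon> * (m + 1) \<le> r / 8" using r m by (auto simp: \<epsilon>_def)
  obtain C where C: "C > 0" "\<And>M (f :: 'a \<Rightarrow> 'b) g. p_int M p f \<Longrightarrow> p_int M p g \<Longrightarrow>
    p_mass M p f \<le> (1 + \<epsilon>) * p_mass M p g + C * p_mass M p (\<lambda>x. f x - g x)"
    using p_mass_le_weighted[OF assms(1) \<epsilon>(1)] by metis
  \<comment> \<open>the minimum with \<open>1\<close> keeps the masses of \<open>g n\<close> bounded by \<open>2m + 1\<close>\<close>
  have "eventually (\<lambda>n. p_mass M p (\<lambda>x. g n x - l x) < min 1 r / (8 * C)) sequentially"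
    using order_tendstoD(2)[OF lim, of "min 1 r / (8 * C)"] C r by simp
  then have "eventually (\<lambda>n. norm (p_mass M p (g n) - p_mass M p l) < r) sequentially"
  proof eventually_elim
    case (elim n)
    define a where "a = p_mass M p (g n)"
    define d where "d = C * p_mass M p (\<lambda>x. g n x - l x)"
    have d: "d < min 1 r / 8" using elim C by (simp add: d_def field_simps)
    have 1: "a \<le> (1 + \<epsilon>) * m + d" unfolding a_def m_def d_def by (rule C(2)[OF assms(2,3)])
    have 2: "m \<le> (1 + \<epsilon>) * a + d" unfolding a_def m_def d_def
      using C(2)[OF assms(3,2), of n] by (simp add: p_mass_commute)
    have em: "\<epsilon> * m \<le> r / 8" "\<epsilon> * m \<ge> 0" using \<epsilon> m by (auto simp: algebra_simps)
    have "\<epsilon> * a \<le> \<epsilon> * ((1 + \<epsilon>) * m + d)" using 1 \<epsilon> by (intro mult_left_mono) auto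
    also have "\<dots> \<le> \<epsilon> * (2 * m + 2)"
    proof (intro mult_left_mono add_mono)
      show "(1 + \<epsilon>) * m \<le> 2 * m" using \<epsilon> m by (intro mult_right_mono) auto
    qed (use d \<epsilon> in auto)
    also have "\<dots> \<le> r / 4" using \<epsilon>(3) by (simp add: algebra_simps)
    finally have ea: "\<epsilon> * a \<le> r / 4" .
    have "\<bar>a - m\<bar> < r" using 1 2 d em ea r by (simp add: algebra_simps abs_if)
    then show ?case by (simp add: a_def m_def)
  qed
  then show "\<exists>no. \<forall>n\<ge>no. norm (p_mass M p (g n) - p_mass M p l) < r" by (simp add: eventually_sequentially)
qed

lemma p_mass_AE_subseq:
  fixes g :: "nat \<Rightarrow> 'a \<Rightarrow> 'b::euclidean_space"
  assumes "p > 1" "\<And>n. p_int M p (g n)" "p_int M p l"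
    and lim: "(\<lambda>n. p_mass M p (\<lambda>x. g n x - l x)) \<longlonglongrightarrow> 0"
  obtains r :: "nat \<Rightarrow> nat" where "strict_mono r" "AE x in M. (\<lambda>n. g (r n) x) \<longlonglongrightarrow> l x"
proof -
  have "\<exists>r::nat\<Rightarrow>nat. strict_mono r \<and> (AE x in M. (\<lambda>n. norm (g (r n) x - l x) powr p) \<longlonglongrightarrow> 0)"
    using lim p_int_diff(1)[OF assms(1) assms(2,3)]
    by (intro tendsto_L1_AE_subseq) (auto simp: p_int_def p_mass_def)
  then obtain r :: "nat \<Rightarrow> nat" where r: "strict_mono r" "AE x in M. (\<lambda>n. norm (g (r n) x - l x) powr p) \<longlonglongrightarrow> 0"
    by blast
  have "(\<lambda>n. g (r n) x) \<longlonglongrightarrow> l x" if "(\<lambda>n. norm (g (r n) x - l x) powr p) \<longlonglongrightarrow> 0" for x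
  proof -
    have "(\<lambda>n. (norm (g (r n) x - l x) powr p) powr (1/p)) \<longlonglongrightarrow> 0 powr (1/p)"
      using that assms(1) by (intro tendsto_powr') auto
    then have "(\<lambda>n. norm (g (r n) x - l x)) \<longlonglongrightarrow> 0" using assms(1) by (simp add: powr_powr)
    then show ?thesis by (simp add: LIM_zero_iff tendsto_norm_zero_iff)
  qed
  then show ?thesis using r that by (metis (mono_tags, lifting) eventually_mono)
qed

text \<open>The sequence is Cauchy in \<open>L\<^sup>1\<close>, so a subsequence converges almost everywhere;
  Fatou's lemma applied to the differences shows that the pointwise limit is the limit in
  \<open>L\<^sup>p\<close>.\<close>

lemma (in finite_measure) p_mass_complete:
  fixes g :: "nat \<Rightarrow> 'a \<Rightarrow> 'b::euclidean_space"
  assumes p: "p > 1" and g: "\<And>n. p_int M p (g n)"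
    and Cauchy: "\<And>e. e > 0 \<Longrightarrow> \<exists>N. \<forall>i\<ge>N. \<forall>j\<ge>N. p_mass M p (\<lambda>x. g i x - g j x) < e"
  obtains l where "p_int M p l" "(\<lambda>n. p_mass M p (\<lambda>x. g n x - l x)) \<longlonglongrightarrow> 0"
proof -
  have dint: "p_int M p (\<lambda>x. g i x - g j x)" for i j by (rule p_int_diff(1)[OF p g g])
  have "\<exists>N. \<forall>i\<ge>N. \<forall>j\<ge>N. (LINT x|M. norm (g i x - g j x)) < e" if e: "e > 0" for e
  proof -
    obtain \<delta> where \<delta>: "\<delta> > 0" "\<And>g :: 'a \<Rightarrow> 'b. p_int M p g \<Longrightarrow> p_mass M p g < \<delta> \<Longrightarrow> (LINT x|M. norm (g x)) < e"
      using integral_norm_small[OF p e] by metis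
    show ?thesis using Cauchy[OF \<delta>(1)] \<delta>(2)[OF dint] by meson
  qed
  from cauchy_L1_AE_cauchy_subseq[OF p_int_imp_integrable[OF p g] this]
  obtain r where r: "strict_mono r" "AE x in M. Cauchy (\<lambda>i. g (r i) x)" by metis
  define l where "l x = (if Cauchy (\<lambda>i. g (r i) x) then lim (\<lambda>i. g (r i) x) else 0)" for x
  have [measurable]: "g n \<in> borel_measurable M" for n using g by (simp add: p_int_def)
  have lmeas [measurable]: "l \<in> borel_measurable M" unfolding l_def
    by (intro measurable_If borel_measurable_lim_metric) measurable
  have AE: "AE x in M. (\<lambda>i. g (r i) x) \<longlonglongrightarrow> l x"
    using r(2) by eventually_elim (simp add: l_def Cauchy_convergent_iff convergent_LIMSEQ_iff)
  have key: "integrable M (\<lambda>x. norm (g n x - l x) powr p) \<and> p_mass M p (\<lambda>x. g n x - l x) \<le> e"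
    if N: "\<forall>i\<ge>N. \<forall>j\<ge>N. p_mass M p (\<lambda>x. g i x - g j x) < e" "n \<ge> N" for n N e
  proof -
    have "AE x in M. (\<lambda>i. norm (g n x - g (r i) x) powr p) \<longlonglongrightarrow> norm (g n x - l x) powr p"
      using AE by eventually_elim (use p in \<open>auto intro!: tendsto_powr' tendsto_intros\<close>)
    moreover have "eventually (\<lambda>i. (LINT x|M. norm (g n x - g (r i) x) powr p) \<le> e) sequentially"
      unfolding eventually_sequentially
    proof (intro exI allI impI)
      fix i assume "i \<ge> N"
      then have "r i \<ge> N" using seq_suble[OF r(1), of i] by simp
      then have "p_mass M p (\<lambda>x. g n x - g (r i) x) < e" using N by simp
      then show "(LINT x|M. norm (g n x - g (r i) x) powr p) \<le> e" by (simp add: p_mass_def)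
    qed
    ultimately show ?thesis
      using fatou_bound[of M "\<lambda>i x. norm (g n x - g (r i) x) powr p" "\<lambda>x. norm (g n x - l x) powr p" e] dint
      by (auto simp: p_int_def p_mass_def)
  qed
  obtain N1 where N1: "\<forall>i\<ge>N1. \<forall>j\<ge>N1. p_mass M p (\<lambda>x. g i x - g j x) < 1" using Cauchy[of 1] by auto
  have "p_int M p (\<lambda>x. g N1 x - l x)" using key[OF N1 order_refl] by (simp add: p_int_def)
  from p_int_diff(1)[OF p g[of N1] this] have "p_int M p l" by simp
  moreover have "(\<lambda>n. p_mass M p (\<lambda>x. g n x - l x)) \<longlonglongrightarrow> 0"
  proof (rule LIMSEQ_I)
    fix e :: real assume e: "e > 0"
    obtain N where "\<forall>i\<ge>N. \<forall>j\<ge>N. p_mass M p (\<lambda>x. g i x - g j x) < e / 2" using Cauchy[of "e/2"] e by auto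
    from key[OF this] have "\<forall>n\<ge>N. norm (p_mass M p (\<lambda>x. g n x - l x) - 0) < e"
      using e by (force simp: p_mass_nonneg)
    then show "\<exists>N. \<forall>n\<ge>N. norm (p_mass M p (\<lambda>x. g n x - l x) - 0) < e" by blast
  qed
  ultimately show ?thesis by (rule that)
qed

text \<open>Young's inequality after scaling one factor by \<open>k\<close> and the other by
  \<open>1/k\<close>.\<close>

lemma mult_le_eps_powr:
  fixes a b :: real
  assumes "p > 1" "e > 0"
  obtains C where "C > 0" "\<And>a b :: real. \<bar>a * b\<bar> \<le> e * \<bar>a\<bar> powr (p / (p - 1)) + C * \<bar>b\<bar> powr p"
proof -
  define q where "q = p / (p - 1)"
  have q: "q > 1" "1/p + 1/q = 1" "1/q+1/p=1" using assms by (auto simp: q_def field_simps)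
  define k where "k = e powr (1/q)"
  have k: "k > 0" "k powr q = e" using assms q by (auto simp: k_def powr_powr)
  show ?thesis
  proof
    show "(1/k) powr p > 0" using k by simp
    fix a b :: real
    have "\<bar>a * b\<bar> = (k * \<bar>a\<bar>) * (1/k * \<bar>b\<bar>)" using k by (simp add: abs_mult)
    also have "\<dots> \<le> (k * \<bar>a\<bar>) powr q / q + (1/k * \<bar>b\<bar>) powr p / p"
      using q assms k by (intro Youngs_inequality) auto
    also have "\<dots> \<le> (k * \<bar>a\<bar>) powr q + (1/k * \<bar>b\<bar>) powr p"
      using q assms by (intro add_mono) (auto simp: divide_le_eq intro!: mult_left_le mult_right_mono order_trans[OF _ mult_right_mono[of 1]]  simp: mult_le_cancel_left1)
    also have "\<dots> = e * \<bar>a\<bar> powr q + (1/k) powr p * \<bar>b\<bar> powr p"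
      using k by (simp add: powr_mult powr_divide)
    finally show "\<bar>a * b\<bar> \<le> e * \<bar>a\<bar> powr (p / (p - 1)) + (1/k) powr p * \<bar>b\<bar> powr p" by (simp add: q_def)
  qed
qed

lemma dual_pairing_integrable:
  fixes h v :: "'a \<Rightarrow> real"
  assumes "p > 1" "p_int M (p / (p - 1)) h" "p_int M p v"
  shows "integrable M (\<lambda>x. h x * v x)"
proof -
  obtain C where "C > 0" and C: "\<And>a b :: real. \<bar>a * b\<bar> \<le> 1 * \<bar>a\<bar> powr (p / (p - 1)) + C * \<bar>b\<bar> powr p"
    using mult_le_eps_powr[OF assms(1), of 1] zero_less_one by metis
  show ?thesis
  proof (rule Bochner_Integration.integrable_bound)
    show "integrable M (\<lambda>x. 1 * norm (h x) powr (p / (p - 1)) + C * norm (v x) powr p)"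
      using assms by (auto simp: p_int_def)
    show "AE x in M. norm (h x * v x) \<le> norm (1 * norm (h x) powr (p / (p - 1)) + C * norm (v x) powr p)"
      using C by (intro AE_I2) (metis abs_ge_self order_trans real_norm_def)
  qed (use assms in \<open>auto simp: p_int_def\<close>)
qed

lemma dual_pairing_le:
  fixes h :: "'a \<Rightarrow> real"
  assumes "p > 1" "p_int M (p / (p - 1)) h" "e > 0"
  obtains C where "C > 0" "\<And>v :: 'a \<Rightarrow> real. p_int M p v \<Longrightarrow>
      \<bar>LINT x|M. h x * v x\<bar> \<le> e * p_mass M (p / (p - 1)) h + C * p_mass M p v"
proof -
  obtain C where C: "C > 0" "\<And>a b :: real. \<bar>a * b\<bar> \<le> e * \<bar>a\<bar> powr (p / (p - 1)) + C * \<bar>b\<bar> powr p"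
    using mult_le_eps_powr[OF assms(1,3)] by metis
  show ?thesis
  proof
    show "C > 0" by fact
    fix v :: "'a \<Rightarrow> real" assume v: "p_int M p v"
    have "\<bar>LINT x|M. h x * v x\<bar> \<le> (LINT x|M. \<bar>h x * v x\<bar>)" by (rule integral_abs_bound)
    also have "\<dots> \<le> (LINT x|M. e * norm (h x) powr (p / (p - 1)) + C * norm (v x) powr p)"
      using assms v C dual_pairing_integrable[OF assms(1,2) v] by (intro integral_mono) (auto simp: p_int_def)
    also have "\<dots> = e * p_mass M (p / (p - 1)) h + C * p_mass M p v"
      using assms v by (simp add: p_int_def p_mass_def)
    finally show "\<bar>LINT x|M. h x * v x\<bar> \<le> e * p_mass M (p / (p - 1)) h + C * p_mass M p v" .
  qed
qed

lemma dual_pairing_tendsto: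
  fixes h :: "'a \<Rightarrow> real"
  assumes p: "p > 1" and h: "p_int M (p / (p - 1)) h" and v: "\<And>n. p_int M p (v n)" "p_int M p l"
    and lim: "(\<lambda>n. p_mass M p (\<lambda>x. v n x - l x)) \<longlonglongrightarrow> 0"
  shows "(\<lambda>n. LINT x|M. h x * v n x) \<longlonglongrightarrow> (LINT x|M. h x * l x)"
proof (rule LIMSEQ_I)
  fix r :: real assume r: "r > 0"
  define m where "m = p_mass M (p / (p - 1)) h"
  have m: "m \<ge> 0" by (simp add: m_def p_mass_nonneg)
  define e where "e = r / (2 * (m + 1))"
  have e: "e > 0" "e * m \<le> r / 2" using r m by (auto simp: e_def field_simps)
  obtain C where C: "C > 0" "\<And>v :: 'a \<Rightarrow> real. p_int M p v \<Longrightarrow>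
      \<bar>LINT x|M. h x * v x\<bar> \<le> e * p_mass M (p / (p - 1)) h + C * p_mass M p v"
    using dual_pairing_le[OF p h e(1)] by metis
  have "eventually (\<lambda>n. p_mass M p (\<lambda>x. v n x - l x) < r / (2 * C)) sequentially"
    using order_tendstoD(2)[OF lim, of "r / (2 * C)"] C r by simp
  then have "eventually (\<lambda>n. norm ((LINT x|M. h x * v n x) - (LINT x|M. h x * l x)) < r) sequentially"
  proof eventually_elim
    case (elim n)
    have "(LINT x|M. h x * v n x) - (LINT x|M. h x * l x) = (LINT x|M. h x * (v n x - l x))"
      using dual_pairing_integrable[OF p h v(1)] dual_pairing_integrable[OF p h v(2)]
      by (simp add: right_diff_distrib)
    moreover have "C * p_mass M p (\<lambda>x. v n x - l x) < r / 2" using elim C by (simp add: field_simps)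
    ultimately show ?case using C(2)[OF p_int_diff(1)[OF p v(1)[of n] v(2)]] e(2) by (simp add: m_def)
  qed
  then show "\<exists>no. \<forall>n\<ge>no. norm ((LINT x|M. h x * v n x) - (LINT x|M. h x * l x)) < r" by (simp add: eventually_sequentially)
qed

section \<open>Gradients of compactly supported functions\<close>

definition grad :: "('a::euclidean_space \<Rightarrow> real) \<Rightarrow> 'a \<Rightarrow> 'a" where
  "grad \<phi> x = (\<Sum>i\<in>Basis. frechet_derivative \<phi> (at x) i *\<^sub>R i)"

lemma has_derivative_grad:
  assumes "\<phi> differentiable (at x)"
  shows "(\<phi> has_derivative (\<lambda>v. grad \<phi> x \<bullet> v)) (at x)"
proof -
  have D: "(\<phi> has_derivative frechet_derivative \<phi> (at x)) (at x)"
    using assms by (simp add: frechet_derivative_works)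
  then interpret linear "frechet_derivative \<phi> (at x)" by (rule has_derivative_linear)
  have "frechet_derivative \<phi> (at x) v = grad \<phi> x \<bullet> v" for v
  proof -
    have "frechet_derivative \<phi> (at x) v = frechet_derivative \<phi> (at x) (\<Sum>i\<in>Basis. (v \<bullet> i) *\<^sub>R i)"
      by (simp add: euclidean_representation)
    also have "\<dots> = grad \<phi> x \<bullet> v"
      unfolding sum scale grad_def inner_sum_left
      by (intro sum.cong refl) (simp add: inner_commute)
    finally show ?thesis .
  qed
  then have "frechet_derivative \<phi> (at x) = (\<lambda>v. grad \<phi> x \<bullet> v)" by blast
  with D show ?thesis by simp
qed

lemma grad_eqI:
  assumes "(\<phi> has_derivative (\<lambda>v. G \<bullet> v)) (at x)"
  shows "grad \<phi> x = G"
proof -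
  have "frechet_derivative \<phi> (at x) = (\<lambda>v. G \<bullet> v)" using frechet_derivative_at[OF assms] by simp
  then show ?thesis by (simp add: grad_def euclidean_representation)
qed

lemma frechet_derivative_eq_grad:
  "\<phi> differentiable (at x) \<Longrightarrow> frechet_derivative \<phi> (at x) v = grad \<phi> x \<bullet> v"
  using frechet_derivative_at[OF has_derivative_grad] by metis

text \<open>A radius instead of the topological support: together with continuity it gives boundedness and
  integrability directly, and it is stable under products.\<close>

definition C1_compact :: "('a::euclidean_space \<Rightarrow> real) \<Rightarrow> bool" where
  "C1_compact \<phi> \<longleftrightarrow> (\<forall>x. \<phi> differentiable (at x)) \<and> continuous_on UNIV (grad \<phi>) \<and>
     (\<exists>R. \<forall>x. norm x \<ge> R \<longrightarrow> \<phi> x = 0 \<and> grad \<phi> x = 0)"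

lemma C1_compactD:
  assumes "C1_compact \<phi>"
  shows "\<phi> differentiable (at x)" "(\<phi> has_derivative (\<lambda>v. grad \<phi> x \<bullet> v)) (at x)"
    "continuous_on UNIV \<phi>" "continuous_on UNIV (grad \<phi>)"
    "\<phi> \<in> borel_measurable borel" "grad \<phi> \<in> borel_measurable borel"
proof -
  show d: "\<phi> differentiable (at x)" for x using assms by (simp add: C1_compact_def)
  show "(\<phi> has_derivative (\<lambda>v. grad \<phi> x \<bullet> v)) (at x)" by (rule has_derivative_grad[OF d])
  show c: "continuous_on UNIV \<phi>"
    by (simp add: continuous_on_eq_continuous_at differentiable_imp_continuous_within[OF d])
  show c': "continuous_on UNIV (grad \<phi>)" using assms by (simp add: C1_compact_def)
  show "\<phi> \<in> borel_measurable borel" "grad \<phi> \<in> borel_measurable borel"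
    using c c' by (auto intro: borel_measurable_continuous_onI)
qed

lemma C1_compact_radius:
  assumes "C1_compact \<phi>"
  obtains R where "R > 0" "\<And>x. norm x \<ge> R \<Longrightarrow> \<phi> x = 0" "\<And>x. norm x \<ge> R \<Longrightarrow> grad \<phi> x = 0"
proof -
  obtain R where "\<forall>x. norm x \<ge> R \<longrightarrow> \<phi> x = 0 \<and> grad \<phi> x = 0"
    using assms by (auto simp: C1_compact_def)
  then show ?thesis by (intro that[of "max R 1"]) auto
qed

lemma test_function_zero_outside:
  assumes "test_function \<Omega> \<phi>" "x \<notin> closure {x. \<phi> x \<noteq> 0}"
  shows "\<phi> x = 0" "grad \<phi> x = 0"
proof -
  let ?S = "closure {x. \<phi> x \<noteq> 0}"
  have z: "\<phi> y = 0" if "y \<in> - ?S" for y using that closure_subset[of "{x. \<phi> x \<noteq> 0}"] by blast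
  show "\<phi> x = 0" by (rule z) (use assms(2) in blast)
  have "((\<lambda>_. 0) has_derivative (\<lambda>v. 0 \<bullet> v)) (at x)" by simp
  then have "(\<phi> has_derivative (\<lambda>v. 0 \<bullet> v)) (at x)"
  proof (rule has_derivative_transform_within_open)
    show "open (- ?S)" by (rule open_Compl[OF closed_closure])
    show "x \<in> - ?S" using assms(2) by blast
    show "0 = \<phi> y" if "y \<in> - ?S" for y using z[OF that] by (rule sym)
  qed
  then show "grad \<phi> x = 0" by (rule grad_eqI)
qed

lemma smooth_differentiable: "smooth \<phi> \<Longrightarrow> \<phi> differentiable (at x)"
  unfolding smooth_def using k_smooth.simps(2)[of 0 \<phi>] by blast

lemma smooth_continuous_grad: "smooth \<phi> \<Longrightarrow> continuous_on UNIV (grad \<phi>)"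
  unfolding grad_def smooth_def using k_smooth.simps(2)[of 0 \<phi>]
  by (intro continuous_intros) (metis k_smooth.simps(1))

lemma test_function_C1_compact:
  assumes "test_function \<Omega> \<phi>"
  shows "C1_compact \<phi>"
proof -
  let ?S = "closure {x. \<phi> x \<noteq> 0}"
  have "bounded ?S" using assms by (auto simp: test_function_def compact_imp_bounded)
  then obtain R where "\<forall>x\<in>?S. norm x \<le> R" by (auto simp: bounded_iff)
  then have "\<forall>x. norm x \<ge> R + 1 \<longrightarrow> \<phi> x = 0 \<and> grad \<phi> x = 0"
  proof (intro allI impI)
    fix x :: 'a assume "norm x \<ge> R + 1"
    then have "x \<notin> ?S" using \<open>\<forall>x\<in>?S. norm x \<le> R\<close> by fastforce
    then show "\<phi> x = 0 \<and> grad \<phi> x = 0" using test_function_zero_outside[OF assms] by blast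
  qed
  then show ?thesis
    using assms smooth_differentiable smooth_continuous_grad
    by (auto simp: C1_compact_def test_function_def)
qed

lemma test_function_outside:
  assumes "test_function \<Omega> \<phi>" "x \<notin> \<Omega>"
  shows "\<phi> x = 0" "grad \<phi> x = 0"
proof -
  have "x \<notin> closure {x. \<phi> x \<noteq> 0}" using assms unfolding test_function_def by blast
  then show "\<phi> x = 0" "grad \<phi> x = 0" by (rule test_function_zero_outside[OF assms(1)])+
qed

lemma integrable_continuous_compact:
  fixes g :: "'a::euclidean_space \<Rightarrow> 'b::euclidean_space"
  assumes "continuous_on UNIV g" "\<And>x. norm x \<ge> R \<Longrightarrow> g x = 0"
  shows "integrable lborel g"
proof -
  have "integrable lborel (\<lambda>x. indicator (cball 0 R) x *\<^sub>R g x)"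
    using assms by (intro borel_integrable_compact) (auto intro: continuous_on_subset)
  also have "(\<lambda>x. indicator (cball 0 R) x *\<^sub>R g x) = g"
    using assms(2) by (auto simp: indicator_def not_le[symmetric] dist_norm)
  finally show ?thesis .
qed

lemma bounded_continuous_compact:
  fixes g :: "'a::euclidean_space \<Rightarrow> 'b::euclidean_space"
  assumes "continuous_on UNIV g" "\<And>x. norm x \<ge> R \<Longrightarrow> g x = 0"
  obtains K where "K > 0" "\<And>x. norm (g x) \<le> K"
proof -
  have "compact (g ` cball 0 R)"
    using assms by (intro compact_continuous_image) (auto intro: continuous_on_subset)
  then have "bounded (g ` cball 0 R)" by (rule compact_imp_bounded)
  then obtain K where K: "K > 0" "\<forall>y\<in>g ` cball 0 R. norm y \<le> K" by (auto simp: bounded_pos)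
  have "norm (g x) \<le> K" for x
    using K assms(2)[of x] by (cases "norm x \<le> R") (auto simp: dist_norm)
  then show ?thesis using K(1) that by blast
qed

text \<open>Functions that vanish outside \<open>\<Omega>\<close> can be integrated over the whole space with
  the Borel version of Lebesgue measure, where translations and products are available.\<close>

lemma lebesgue_on_lborel:
  fixes g :: "'a::euclidean_space \<Rightarrow> 'b::euclidean_space"
  assumes "g \<in> borel_measurable borel" "\<And>x. x \<notin> \<Omega> \<Longrightarrow> g x = 0" and \<Omega>: "\<Omega> \<in> sets lebesgue"
  shows "(LINT x|lebesgue_on \<Omega>. g x) = (LINT x|lborel. g x)"
    "integrable (lebesgue_on \<Omega>) g \<longleftrightarrow> integrable lborel g"
    "g \<in> borel_measurable (lebesgue_on \<Omega>)"
proof -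
  have e: "(\<lambda>x. indicator \<Omega> x *\<^sub>R g x) = g" using assms(2) by (auto simp: indicator_def)
  show "(LINT x|lebesgue_on \<Omega>. g x) = (LINT x|lborel. g x)"
    using \<Omega> assms(1) by (subst integral_restrict_space) (auto simp: e integral_completion)
  show "integrable (lebesgue_on \<Omega>) g \<longleftrightarrow> integrable lborel g"
    using \<Omega> assms(1) by (subst integrable_restrict_space) (auto simp: e integrable_completion)
  have "g \<in> borel_measurable lebesgue" using assms(1) by (simp add: measurable_completion)
  then show "g \<in> borel_measurable (lebesgue_on \<Omega>)" by (rule measurable_restrict_space1)
qed

section \<open>Holder inequality for several functions\<close>

text \<open>Real powers of extended nonnegative numbers, so that Holder's inequality and iterated integrals
  need no finiteness side conditions.\<close>

definition ennpowr :: "ennreal \<Rightarrow> real \<Rightarrow> ennreal" where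
  "ennpowr x \<theta> = (if x = top then top else ennreal (enn2real x powr \<theta>))"

lemma ennpowr_ennreal [simp]: "r \<ge> 0 \<Longrightarrow> ennpowr (ennreal r) \<theta> = ennreal (r powr \<theta>)"
  by (simp add: ennpowr_def)

lemma ennpowr_top [simp]: "ennpowr top \<theta> = top"
  by (simp add: ennpowr_def)

lemma ennpowr_0 [simp]: "ennpowr 0 \<theta> = 0"
  by (simp add: ennpowr_def)

lemma ennpowr_eq_0_iff: "ennpowr x \<theta> = 0 \<longleftrightarrow> x = 0"
  by (cases x) auto

lemma ennpowr_mono: "\<theta> \<ge> 0 \<Longrightarrow> x \<le> y \<Longrightarrow> ennpowr x \<theta> \<le> ennpowr y \<theta>"
  by (cases x; cases y) (auto intro!: ennreal_leI powr_mono2 simp: top_unique)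

lemma measurable_ennpowr [measurable]:
  "f \<in> borel_measurable M \<Longrightarrow> (\<lambda>x. ennpowr (f x) \<theta>) \<in> borel_measurable M"
proof -
  assume [measurable]: "f \<in> borel_measurable M"
  have "f -` {top} \<inter> space M \<in> sets M" by measurable
  also have "f -` {top} \<inter> space M = {x \<in> space M. f x = top}" by auto
  finally have [measurable]: "{x \<in> space M. f x = top} \<in> sets M" .
  have "(\<lambda>x. ennreal (enn2real (f x) powr \<theta>)) \<in> borel_measurable M" by measurable
  then show ?thesis unfolding ennpowr_def by (intro measurable_If) auto
qed

lemma ennpowr_mult: "\<theta> > 0 \<Longrightarrow> ennpowr (x * y) \<theta> = ennpowr x \<theta> * ennpowr y \<theta>"
proof (cases x; cases y)
  fix r s assume "x = ennreal r" "0 \<le> r" "y = ennreal s" "0 \<le> s"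
  then show ?thesis by (simp flip: ennreal_mult add: powr_mult)
qed (auto simp: ennreal_mult_top ennreal_top_mult ennreal_mult_eq_top_iff)

lemma ennpowr_power: "n > 0 \<Longrightarrow> ennpowr x \<theta> ^ n = ennpowr x (\<theta> * real n)"
proof (cases x)
  case (real r)
  then show "n > 0 \<Longrightarrow> ?thesis"
    by (cases "r = 0") (auto simp: ennreal_power powr_power mult.commute)
qed (auto simp: power_eq_top_ennreal)

lemma weighted_am_gm:
  fixes x w :: "'i \<Rightarrow> real"
  assumes "finite S" "S \<noteq> {}" "\<And>i. i \<in> S \<Longrightarrow> x i \<ge> 0" "\<And>i. i \<in> S \<Longrightarrow> w i > 0" "sum w S = 1"
  shows "(\<Prod>i\<in>S. x i powr w i) \<le> (\<Sum>i\<in>S. w i * x i)"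
proof (cases "\<exists>i\<in>S. x i = 0")
  case True
  then have "(\<Prod>i\<in>S. x i powr w i) = 0" using assms by auto
  also have "\<dots> \<le> (\<Sum>i\<in>S. w i * x i)" using assms by (intro sum_nonneg mult_nonneg_nonneg) (auto intro: less_imp_le)
  finally show ?thesis .
next
  case False
  then have x: "\<And>i. i \<in> S \<Longrightarrow> x i > 0" using assms(3) by force
  have "(\<Sum>i\<in>S. w i * ln (x i)) \<le> ln (\<Sum>i\<in>S. w i *\<^sub>R x i)"
    using assms x by (intro concave_on_sum[OF _ _ ln_concave]) (auto intro: less_imp_le)
  moreover have pos: "(\<Sum>i\<in>S. w i *\<^sub>R x i) > 0" using assms x by (intro sum_pos) auto
  ultimately have "exp (\<Sum>i\<in>S. w i * ln (x i)) \<le> (\<Sum>i\<in>S. w i *\<^sub>R x i)"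
    by (subst ln_ge_iff[symmetric]) auto
  moreover have "(\<Prod>i\<in>S. x i powr w i) = exp (\<Sum>i\<in>S. w i * ln (x i))"
    using x assms(1) by (simp add: exp_sum powr_def less_imp_neq[THEN not_sym] cong: prod.cong)
  ultimately show ?thesis by simp
qed

lemma weighted_am_gm_ennreal:
  fixes x :: "'i \<Rightarrow> ennreal" and w :: "'i \<Rightarrow> real"
  assumes "finite S" "S \<noteq> {}" "\<And>i. i \<in> S \<Longrightarrow> w i > 0" "sum w S = 1"
  shows "(\<Prod>i\<in>S. ennpowr (x i) (w i)) \<le> (\<Sum>i\<in>S. ennreal (w i) * x i)"
proof (cases "\<exists>i\<in>S. x i = top")
  case True
  then obtain i where i: "i \<in> S" "x i = top" by auto
  then have "top = ennreal (w i) * x i" using assms(3)[of i] by (simp add: ennreal_mult_top)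
  also have "\<dots> \<le> (\<Sum>i\<in>S. ennreal (w i) * x i)"
    using i assms by (intro member_le_sum) auto
  finally show ?thesis by (simp add: top_unique)
next
  case False
  define r where "r i = enn2real (x i)" for i
  have r: "x i = ennreal (r i)" "r i \<ge> 0" if "i \<in> S" for i
    using False that by (auto simp: r_def less_top[symmetric])
  have "(\<Prod>i\<in>S. ennpowr (x i) (w i)) = (\<Prod>i\<in>S. ennreal (r i powr w i))"
    using r by (intro prod.cong) auto
  also have "\<dots> = ennreal (\<Prod>i\<in>S. r i powr w i)" by (simp add: prod_ennreal)
  also have "\<dots> \<le> ennreal (\<Sum>i\<in>S. w i * r i)"
    using assms r by (intro ennreal_leI weighted_am_gm) auto
  also have "\<dots> = (\<Sum>i\<in>S. ennreal (w i * r i))"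
    using assms r by (intro sum_ennreal[symmetric] mult_nonneg_nonneg) (auto simp: less_imp_le)
  also have "\<dots> = (\<Sum>i\<in>S. ennreal (w i) * x i)"
    using r assms by (intro sum.cong) (auto simp: ennreal_mult less_imp_le)
  finally show ?thesis .
qed

text \<open>After dividing each \<open>f\<^sub>i\<close> by its integral, integrate the weighted inequality of
  arithmetic and geometric means. A factor with zero integral kills both sides; otherwise an
  infinite integral makes the right-hand side infinite.\<close>

lemma Holder_nn_integral:
  fixes f :: "'i \<Rightarrow> 'a \<Rightarrow> ennreal" and w :: "'i \<Rightarrow> real"
  assumes "finite S" "S \<noteq> {}" "\<And>i. i \<in> S \<Longrightarrow> w i > 0" "sum w S = 1"
    and meas [measurable]: "\<And>i. i \<in> S \<Longrightarrow> f i \<in> borel_measurable M"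
  shows "(\<integral>\<^sup>+x. (\<Prod>i\<in>S. ennpowr (f i x) (w i)) \<partial>M) \<le> (\<Prod>i\<in>S. ennpowr (\<integral>\<^sup>+x. f i x \<partial>M) (w i))"
proof -
  define c where "c i = (\<integral>\<^sup>+x. f i x \<partial>M)" for i
  consider (zero) "\<exists>i\<in>S. c i = 0" | (top) "\<forall>i\<in>S. c i \<noteq> 0" "\<exists>i\<in>S. c i = top"
    | (fin) "\<forall>i\<in>S. c i \<noteq> 0 \<and> c i \<noteq> top"
    by (cases "\<exists>i\<in>S. c i = 0"; cases "\<exists>i\<in>S. c i = top") simp_all
  then show ?thesis
  proof cases
    case zero
    then obtain i where i: "i \<in> S" "c i = 0" by auto
    then have "AE x in M. f i x = 0" using nn_integral_0_iff_AE[OF meas[OF i(1)]] by (simp add: c_def)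
    then have "AE x in M. (\<Prod>i\<in>S. ennpowr (f i x) (w i)) = 0"
    proof eventually_elim
      case (elim x)
      then show ?case using i(1) assms(1) by (intro prod_zero bexI[of _ i]) simp_all
    qed
    then have "(\<integral>\<^sup>+x. (\<Prod>i\<in>S. ennpowr (f i x) (w i)) \<partial>M) = (\<integral>\<^sup>+x. 0 \<partial>M)"
      by (intro nn_integral_cong_AE)
    then show ?thesis by simp
  next
    case top
    then obtain i where i: "i \<in> S" "c i = top" by auto
    have "(\<Prod>i\<in>S. ennpowr (c i) (w i)) = ennpowr (c i) (w i) * (\<Prod>i\<in>S - {i}. ennpowr (c i) (w i))"
      using i assms(1) by (simp add: prod.remove)
    also have "(\<Prod>i\<in>S - {i}. ennpowr (c i) (w i)) \<noteq> 0"
      using top assms(1) by (auto simp: ennpowr_eq_0_iff prod_zero_iff)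
    then have "ennpowr (c i) (w i) * (\<Prod>i\<in>S - {i}. ennpowr (c i) (w i)) = top"
      using i by (simp add: ennreal_top_mult)
    finally show ?thesis unfolding c_def[symmetric] by simp
  next
    case fin
    have pt: "(\<Prod>i\<in>S. ennpowr (f i x) (w i)) \<le> (\<Prod>i\<in>S. ennpowr (c i) (w i)) * (\<Sum>i\<in>S. ennreal (w i) * (f i x / c i))" for x
    proof -
      have "ennpowr (f i x) (w i) = ennpowr (c i) (w i) * ennpowr (f i x / c i) (w i)" if "i \<in> S" for i
      proof -
        have "c i * (f i x / c i) = f i x * c i / c i"
          by (simp only: ennreal_times_divide mult.commute)
        also have "\<dots> = f i x"
          using fin that by (intro ennreal_mult_divide_eq) auto
        finally have "f i x = c i * (f i x / c i)" ..
        then have "ennpowr (f i x) (w i) = ennpowr (c i * (f i x / c i)) (w i)" by (rule arg_cong)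
        also have "\<dots> = ennpowr (c i) (w i) * ennpowr (f i x / c i) (w i)"
          using assms(3)[OF that] by (rule ennpowr_mult)
        finally show ?thesis .
      qed
      then have "(\<Prod>i\<in>S. ennpowr (f i x) (w i)) = (\<Prod>i\<in>S. ennpowr (c i) (w i) * ennpowr (f i x / c i) (w i))"
        by (intro prod.cong refl)
      also have "\<dots> = (\<Prod>i\<in>S. ennpowr (c i) (w i)) * (\<Prod>i\<in>S. ennpowr (f i x / c i) (w i))"
        by (simp add: prod.distrib)
      also have "\<dots> \<le> (\<Prod>i\<in>S. ennpowr (c i) (w i)) * (\<Sum>i\<in>S. ennreal (w i) * (f i x / c i))"
        using assms by (intro mult_left_mono weighted_am_gm_ennreal) auto
      finally show ?thesis .
    qed
    have "(\<integral>\<^sup>+x. (\<Prod>i\<in>S. ennpowr (f i x) (w i)) \<partial>M)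
        \<le> (\<integral>\<^sup>+x. (\<Prod>i\<in>S. ennpowr (c i) (w i)) * (\<Sum>i\<in>S. ennreal (w i) * (f i x / c i)) \<partial>M)"
      by (intro nn_integral_mono pt)
    also have "\<dots> = (\<Prod>i\<in>S. ennpowr (c i) (w i)) * (\<Sum>i\<in>S. ennreal (w i) * (c i / c i))"
      by (simp add: nn_integral_cmult nn_integral_sum nn_integral_divide c_def)
    also have "(\<Sum>i\<in>S. ennreal (w i) * (c i / c i)) = (\<Sum>i\<in>S. ennreal (w i))"
      using fin by (intro sum.cong refl) (simp add: ennreal_divide_self less_top)
    also have "\<dots> = 1" using assms by (simp add: less_imp_le)
    finally show ?thesis unfolding c_def mult_1_right .
  qed
qed

section \<open>Integration along coordinates\<close>

interpretation coord: product_sigma_finite "\<lambda>_::'a::euclidean_space. lborel :: real measure"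
  by standard

text \<open>Integration over the coordinates in \<open>J\<close> with the others kept from \<open>x\<close>.
  The result is a function on the whole space that is constant in the directions of
  \<open>J\<close>; this avoids splitting the space into factors.\<close>

definition partial_int :: "'a::euclidean_space set \<Rightarrow> ('a \<Rightarrow> ennreal) \<Rightarrow> 'a \<Rightarrow> ennreal" where
  "partial_int J g x = (\<integral>\<^sup>+y. g (x + (\<Sum>b\<in>J. (y b - x \<bullet> b) *\<^sub>R b)) \<partial>(\<Pi>\<^sub>M b\<in>J. lborel))"

lemma measurable_partial_int [measurable]:
  assumes [measurable]: "g \<in> borel_measurable borel" and "finite J"
  shows "partial_int J g \<in> borel_measurable borel"
proof -
  interpret finite_product_sigma_finite "\<lambda>_::'a. lborel :: real measure" J
    by standard fact
  have "sigma_finite_measure (\<Pi>\<^sub>M b\<in>J. (lborel::real measure))"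
    using sigma_finite_measure_axioms .
  moreover have "(\<lambda>(x, y). g (x + (\<Sum>b\<in>J. (y b - x \<bullet> b) *\<^sub>R b))) \<in> borel_measurable (borel \<Otimes>\<^sub>M (\<Pi>\<^sub>M b\<in>J. lborel))"
    by measurable
  ultimately show ?thesis unfolding partial_int_def
    by (intro sigma_finite_measure.borel_measurable_nn_integral) (auto simp: split_def)
qed

lemma partial_int_singleton:
  assumes [measurable]: "g \<in> borel_measurable borel"
  shows "partial_int {k} g x = (\<integral>\<^sup>+t. g (x + (t - x \<bullet> k) *\<^sub>R k) \<partial>lborel)"
  unfolding partial_int_def
  by (subst coord.product_nn_integral_singleton[where f = "\<lambda>t. g (x + (t - x \<bullet> k) *\<^sub>R k)", symmetric]) auto

lemma inner_sum_Basis_notin: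
  assumes "J \<subseteq> Basis" "k \<in> Basis" "k \<notin> J"
  shows "(\<Sum>b\<in>J. c b *\<^sub>R b) \<bullet> (k::'a::euclidean_space) = 0"
  unfolding inner_sum_left
  using assms by (intro sum.neutral) (auto simp: inner_Basis subset_iff)

text \<open>Tonelli's theorem in both orders, which also shows that integrations along different coordinates
  commute.\<close>

lemma partial_int_insert:
  fixes k :: "'a::euclidean_space"
  assumes [measurable]: "g \<in> borel_measurable borel" and J: "J \<subseteq> Basis" "k \<in> Basis" "k \<notin> J"
  shows "partial_int (insert k J) g x = partial_int J (partial_int {k} g) x"
    and "partial_int (insert k J) g x = partial_int {k} (partial_int J g) x"
proof -
  have fin: "finite J" using J finite_Basis finite_subset by blast
  let ?P = "\<lambda>y. g (x + (\<Sum>b\<in>insert k J. (y b - x \<bullet> b) *\<^sub>R b))"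
  have m: "?P \<in> borel_measurable (\<Pi>\<^sub>M b\<in>insert k J. lborel)"
    using fin by measurable
  have pt: "?P (y(k := t)) = g (x + ((t - x \<bullet> k) *\<^sub>R k + (\<Sum>b\<in>J. (y b - x \<bullet> b) *\<^sub>R b)))" for y t
  proof -
    have "(\<Sum>b\<in>J. ((y(k:=t)) b - x \<bullet> b) *\<^sub>R b) = (\<Sum>b\<in>J. (y b - x \<bullet> b) *\<^sub>R b)"
      using J by (intro sum.cong) auto
    then show ?thesis using fin J by simp
  qed
  have "partial_int (insert k J) g x = (\<integral>\<^sup>+y. (\<integral>\<^sup>+t. ?P (y(k := t)) \<partial>lborel) \<partial>(\<Pi>\<^sub>M b\<in>J. lborel))"
    unfolding partial_int_def by (rule coord.product_nn_integral_insert[OF fin J(3) m])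
  also have "\<dots> = partial_int J (partial_int {k} g) x"
    unfolding partial_int_singleton[OF assms(1)] unfolding partial_int_def pt
    using J by (intro nn_integral_cong arg_cong[where f=g])
       (simp add: inner_add_left inner_sum_Basis_notin add_ac)
  finally show "partial_int (insert k J) g x = partial_int J (partial_int {k} g) x" .
  have "partial_int (insert k J) g x = (\<integral>\<^sup>+t. (\<integral>\<^sup>+y. ?P (y(k := t)) \<partial>(\<Pi>\<^sub>M b\<in>J. lborel)) \<partial>lborel)"
    unfolding partial_int_def by (rule coord.product_nn_integral_insert_rev[OF fin J(3) m])
  also have "\<dots> = partial_int {k} (partial_int J g) x"
    unfolding partial_int_singleton[OF measurable_partial_int[OF assms(1) fin]] unfolding partial_int_def pt
  proof (intro nn_integral_cong arg_cong[where f=g])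
    fix t y
    have "(\<Sum>b\<in>J. (y b - (x + (t - x \<bullet> k) *\<^sub>R k) \<bullet> b) *\<^sub>R b) = (\<Sum>b\<in>J. (y b - x \<bullet> b) *\<^sub>R b)"
      using J by (intro sum.cong refl) (auto simp: inner_add_left inner_Basis)
    then show "x + ((t - x \<bullet> k) *\<^sub>R k + (\<Sum>b\<in>J. (y b - x \<bullet> b) *\<^sub>R b)) =
       x + (t - x \<bullet> k) *\<^sub>R k + (\<Sum>b\<in>J. (y b - (x + (t - x \<bullet> k) *\<^sub>R k) \<bullet> b) *\<^sub>R b)" by simp
  qed
  finally show "partial_int (insert k J) g x = partial_int {k} (partial_int J g) x" .
qed

lemma partial_int_empty: "partial_int {} g x = g x"
  unfolding partial_int_def by (simp add: PiM_empty nn_integral_count_space_finite)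

lemma partial_int_Basis:
  assumes [measurable]: "g \<in> borel_measurable borel"
  shows "partial_int Basis g x = (\<integral>\<^sup>+z. g z \<partial>lborel)"
proof -
  have "x + (\<Sum>b\<in>Basis. (y b - x \<bullet> b) *\<^sub>R b) = (\<Sum>b\<in>Basis. y b *\<^sub>R b)" for y
    using euclidean_representation[of x] by (simp add: scaleR_diff_left sum_subtractf)
  then have "partial_int Basis g x = (\<integral>\<^sup>+y. g (\<Sum>b\<in>Basis. y b *\<^sub>R b) \<partial>(\<Pi>\<^sub>M b\<in>Basis. lborel))"
    unfolding partial_int_def by simp
  also have "\<dots> = (\<integral>\<^sup>+z. g z \<partial>lborel)"
    unfolding lborel_eq[where 'a='a] by (subst nn_integral_distr) measurable
  finally show ?thesis .
qed

lemma partial_int_shift: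
  assumes "k \<in> K" "K \<subseteq> Basis"
  shows "partial_int K g (x + t *\<^sub>R k) = partial_int K g x"
proof -
  have fin: "finite K" using assms finite_Basis finite_subset by blast
  have "(\<Sum>b\<in>K. (y b - (x + t *\<^sub>R k) \<bullet> b) *\<^sub>R b) = (\<Sum>b\<in>K. (y b - x \<bullet> b) *\<^sub>R b) - t *\<^sub>R k" for y
  proof -
    have "(\<Sum>b\<in>K. (y b - (x + t *\<^sub>R k) \<bullet> b) *\<^sub>R b) = (\<Sum>b\<in>K. (y b - x \<bullet> b) *\<^sub>R b - (if b = k then t *\<^sub>R k else 0))"
      using assms by (intro sum.cong refl) (auto simp: inner_add_left inner_Basis scaleR_diff_left scaleR_add_left subset_iff)
    also have "\<dots> = (\<Sum>b\<in>K. (y b - x \<bullet> b) *\<^sub>R b) - t *\<^sub>R k"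
      using assms fin by (simp add: sum_subtractf)
    finally show ?thesis .
  qed
  then show ?thesis unfolding partial_int_def by simp
qed

text \<open>Induction on the set of coordinates already integrated. When coordinate \<open>k\<close> is added,
  the factor indexed by \<open>k\<close> does not depend on it and can be pulled out; the other
  \<open>N - 1\<close> factors carry the exponent \<open>1/(N - 1)\<close>, so Holder's inequality
  applies to them.\<close>

lemma gagliardo_partial:
  fixes g w :: "'a::euclidean_space \<Rightarrow> ennreal"
  assumes [measurable]: "g \<in> borel_measurable borel" "w \<in> borel_measurable borel"
    and N: "DIM('a) \<ge> 2"
    and le: "\<And>i x. i \<in> Basis \<Longrightarrow> w x \<le> partial_int {i} g x"
    and J: "J \<subseteq> Basis"
  defines "\<theta> \<equiv> 1 / (real DIM('a) - 1)"
  shows "partial_int J (\<lambda>z. ennpowr (w z) (real DIM('a) * \<theta>)) x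
     \<le> (\<Prod>i\<in>J. ennpowr (partial_int J g x) \<theta>) * (\<Prod>i\<in>Basis - J. ennpowr (partial_int (insert i J) g x) \<theta>)"
proof -
  have "finite J" using J finite_Basis finite_subset by blast
  have \<theta>: "\<theta> > 0" using N by (simp add: \<theta>_def)
  from \<open>finite J\<close> J show ?thesis
  proof (induction J arbitrary: x rule: finite_induct)
    case empty
    have "ennpowr (w x) (real DIM('a) * \<theta>) = ennpowr (w x) \<theta> ^ DIM('a)"
      by (simp add: ennpowr_power mult.commute)
    also have "\<dots> = (\<Prod>i\<in>(Basis::'a set). ennpowr (w x) \<theta>)" by simp
    also have "\<dots> \<le> (\<Prod>i\<in>(Basis::'a set). ennpowr (partial_int {i} g x) \<theta>)"
      using le \<theta> by (intro prod_mono_ennreal ennpowr_mono) auto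
    finally show ?case by (simp add: partial_int_empty)
  next
    case (insert k J)
    have k: "J \<subseteq> Basis" "k \<in> Basis" "k \<notin> J" using insert by auto
    define W where "W = (\<lambda>z. ennpowr (w z) (real DIM('a) * \<theta>))"
    have [measurable]: "W \<in> borel_measurable borel" by (simp add: W_def)
    define f where "f i = (if i \<in> J then partial_int J g else partial_int (insert i J) g)" for i
    have [measurable]: "f i \<in> borel_measurable borel" for i
      using insert.hyps by (simp add: f_def)
    define y where "y t = x + (t - x \<bullet> k) *\<^sub>R k" for t
    have [measurable]: "y \<in> borel_measurable borel" unfolding y_def by measurable
    define K where "K = ennpowr (partial_int (insert k J) g x) \<theta>"
    let ?S = "Basis - {k} :: 'a set"
    have S: "?S = J \<union> (Basis - insert k J)" "J \<inter> (Basis - insert k J) = {}" using k by auto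
    have cS: "card ?S = DIM('a) - 1" using k by simp
    have Sne: "?S \<noteq> {}" 
    proof
      assume "?S = {}"
      then have "card ?S = 0" by (simp only: card.empty)
      then show False using cS N by simp
    qed
    have step: "partial_int J W (y t) \<le> K * (\<Prod>i\<in>?S. ennpowr (f i (y t)) \<theta>)" for t
    proof -
      have "partial_int J W (y t) \<le> (\<Prod>i\<in>J. ennpowr (partial_int J g (y t)) \<theta>) * (\<Prod>i\<in>Basis - J. ennpowr (partial_int (insert i J) g (y t)) \<theta>)"
        unfolding W_def using insert.IH k by blast
      also have "(\<Prod>i\<in>Basis - J. ennpowr (partial_int (insert i J) g (y t)) \<theta>)
         = ennpowr (partial_int (insert k J) g (y t)) \<theta> * (\<Prod>i\<in>Basis - J - {k}. ennpowr (partial_int (insert i J) g (y t)) \<theta>)"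
        using k by (subst prod.remove[of _ k]) auto
      also have "partial_int (insert k J) g (y t) = partial_int (insert k J) g x"
        unfolding y_def using k by (intro partial_int_shift) auto
      also have "Basis - J - {k} = Basis - insert k J" by auto
      also have "(\<Prod>i\<in>Basis - insert k J. ennpowr (partial_int (insert i J) g (y t)) \<theta>) = (\<Prod>i\<in>Basis - insert k J. ennpowr (f i (y t)) \<theta>)"
        by (intro prod.cong) (auto simp: f_def)
      also have "(\<Prod>i\<in>J. ennpowr (partial_int J g (y t)) \<theta>) = (\<Prod>i\<in>J. ennpowr (f i (y t)) \<theta>)"
        by (intro prod.cong) (auto simp: f_def)
      finally show ?thesis unfolding S(1) K_def[symmetric]
        using S(2) insert.hyps by (subst prod.union_disjoint) (auto simp: mult_ac)
    qed
    have "partial_int (insert k J) W x = partial_int {k} (partial_int J W) x"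
      using k by (intro partial_int_insert) auto
    also have "\<dots> = (\<integral>\<^sup>+t. partial_int J W (y t) \<partial>lborel)"
      using insert.hyps by (simp add: partial_int_singleton y_def)
    also have "\<dots> \<le> (\<integral>\<^sup>+t. K * (\<Prod>i\<in>?S. ennpowr (f i (y t)) \<theta>) \<partial>lborel)"
      by (intro nn_integral_mono step)
    also have "\<dots> = K * (\<integral>\<^sup>+t. (\<Prod>i\<in>?S. ennpowr (f i (y t)) \<theta>) \<partial>lborel)"
      by (intro nn_integral_cmult) measurable
    also have "\<dots> \<le> K * (\<Prod>i\<in>?S. ennpowr (\<integral>\<^sup>+t. f i (y t) \<partial>lborel) \<theta>)"
      using \<theta> Sne cS N
      by (intro mult_left_mono Holder_nn_integral) (auto simp: \<theta>_def of_nat_diff)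
    also have "(\<Prod>i\<in>?S. ennpowr (\<integral>\<^sup>+t. f i (y t) \<partial>lborel) \<theta>)
        = (\<Prod>i\<in>?S. ennpowr (if i \<in> J then partial_int (insert k J) g x else partial_int (insert i (insert k J)) g x) \<theta>)"
    proof (intro prod.cong refl arg_cong[where f="\<lambda>z. ennpowr z \<theta>"])
      fix i assume i: "i \<in> ?S"
      have "(\<integral>\<^sup>+t. f i (y t) \<partial>lborel) = partial_int {k} (f i) x"
        by (simp add: partial_int_singleton y_def)
      also have "\<dots> = (if i \<in> J then partial_int (insert k J) g x else partial_int (insert i (insert k J)) g x)"
      proof (cases "i \<in> J")
        case True
        then show ?thesis using k by (simp add: f_def partial_int_insert(2))
      next
        case False
        then have "partial_int (insert k (insert i J)) g x = partial_int {k} (partial_int (insert i J) g) x"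
          using k i by (intro partial_int_insert(2)) auto
        then show ?thesis using False by (simp add: f_def insert_commute)
      qed
      finally show "(\<integral>\<^sup>+t. f i (y t) \<partial>lborel) = (if i \<in> J then partial_int (insert k J) g x else partial_int (insert i (insert k J)) g x)" .
    qed
    also have "\<dots> = (\<Prod>i\<in>J. ennpowr (partial_int (insert k J) g x) \<theta>) * (\<Prod>i\<in>Basis - insert k J. ennpowr (partial_int (insert i (insert k J)) g x) \<theta>)"
      unfolding S(1) using S(2) insert.hyps by (subst prod.union_disjoint) (auto intro!: arg_cong2[where f="(*)"] prod.cong)
    also have "K * \<dots> = (\<Prod>i\<in>insert k J. ennpowr (partial_int (insert k J) g x) \<theta>) * (\<Prod>i\<in>Basis - insert k J. ennpowr (partial_int (insert i (insert k J)) g x) \<theta>)"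
      using insert.hyps by (simp add: K_def mult_ac)
    finally show ?case by (simp add: W_def)
  qed
qed

text \<open>All coordinates integrated: the Gagliardo-Nirenberg estimate behind the embedding of
  \<open>W\<^sup>1\<^sup>,\<^sup>1\<close>.\<close>

lemma gagliardo:
  fixes g w :: "'a::euclidean_space \<Rightarrow> ennreal"
  assumes [measurable]: "g \<in> borel_measurable borel" "w \<in> borel_measurable borel"
    and N: "DIM('a) \<ge> 2"
    and le: "\<And>i x. i \<in> Basis \<Longrightarrow> w x \<le> (\<integral>\<^sup>+t. g (x + (t - x \<bullet> i) *\<^sub>R i) \<partial>lborel)"
  shows "(\<integral>\<^sup>+z. ennpowr (w z) (real DIM('a) / (real DIM('a) - 1)) \<partial>lborel)
     \<le> ennpowr (\<integral>\<^sup>+z. g z \<partial>lborel) (real DIM('a) / (real DIM('a) - 1))"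
proof -
  have "partial_int Basis (\<lambda>z. ennpowr (w z) (real DIM('a) * (1 / (real DIM('a) - 1)))) 0
     \<le> (\<Prod>i\<in>(Basis::'a set). ennpowr (partial_int Basis g 0) (1 / (real DIM('a) - 1)))"
    using gagliardo_partial[of g w Basis 0] le N by (simp add: partial_int_singleton)
  then show ?thesis
    by (simp add: partial_int_Basis ennpowr_power)
qed

section \<open>The Sobolev inequality\<close>

text \<open>Needed also at \<open>0\<close>, where the difference quotient is bounded by
  \<open>|h|\<^sup>q\<^sup>-\<^sup>1\<close>.\<close>

lemma DERIV_pos_part_powr:
  fixes q s :: real
  assumes q: "q > 1"
  shows "((\<lambda>s. max s 0 powr q) has_real_derivative q * max s 0 powr (q - 1)) (at s)"
proof -
  consider "s > 0" | "s < 0" | "s = 0" by linarith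
  then show ?thesis
  proof cases
    case 1
    have "((\<lambda>s. s powr q) has_real_derivative q * s powr (q - 1)) (at s)"
      using 1 by (auto intro!: derivative_eq_intros)
    then have "((\<lambda>s. max s 0 powr q) has_real_derivative q * s powr (q - 1)) (at s)"
      by (rule DERIV_cong_ev[OF refl _ refl, THEN iffD1, rotated])
         (use 1 in \<open>auto simp: eventually_nhds intro!: exI[of _ "{0<..}"]\<close>)
    then show ?thesis using 1 by simp
  next
    case 2
    have "((\<lambda>s. 0) has_real_derivative 0) (at s)" by simp
    then have "((\<lambda>s. max s 0 powr q) has_real_derivative 0) (at s)"
      by (rule DERIV_cong_ev[OF refl _ refl, THEN iffD1, rotated])
         (use 2 q in \<open>auto simp: eventually_nhds intro!: exI[of _ "{..<0}"]\<close>)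
    then show ?thesis using 2 q by simp
  next
    case 3
    have "((\<lambda>h. (max h 0 powr q) / h) \<longlongrightarrow> 0) (at 0)"
    proof (rule Lim_null_comparison)
      show "eventually (\<lambda>h::real. norm ((max h 0 powr q) / h) \<le> \<bar>h\<bar> powr (q - 1)) (at 0)"
      proof -
        have "norm ((max h 0 powr q) / h) \<le> \<bar>h\<bar> powr (q - 1)" if "h \<noteq> 0" for h :: real
        proof (cases "h > 0")
          case True
          then show ?thesis using q by (simp add: powr_diff)
        next
          case False
          then have "max h 0 powr q = 0" by simp
          then show ?thesis by simp
        qed
        then show ?thesis by (simp add: eventually_at_filter)
      qed
      have "((\<lambda>h::real. \<bar>h\<bar> powr (q - 1)) \<longlongrightarrow> \<bar>0\<bar> powr (q - 1)) (at 0)"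
        using q by (intro tendsto_powr' tendsto_intros) auto
      then show "((\<lambda>h::real. \<bar>h\<bar> powr (q - 1)) \<longlongrightarrow> 0) (at 0)" using q by simp
    qed
    then show ?thesis using 3 q by (simp add: DERIV_def)
  qed
qed

lemma DERIV_abs_powr:
  fixes q s :: real
  assumes q: "q > 1"
  shows "((\<lambda>s. \<bar>s\<bar> powr q) has_real_derivative q * (max s 0 powr (q - 1) - max (- s) 0 powr (q - 1))) (at s)"
proof -
  have "((\<lambda>s. max (- s) 0 powr q) has_real_derivative q * max (- s) 0 powr (q - 1) * (- 1)) (at s)"
    by (rule DERIV_chain2[OF DERIV_pos_part_powr[OF q]]) (auto intro!: derivative_eq_intros)
  from DERIV_add[OF DERIV_pos_part_powr[OF q, of s] this]
  have "((\<lambda>s. max s 0 powr q + max (- s) 0 powr q) has_real_derivative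
      q * (max s 0 powr (q - 1) - max (- s) 0 powr (q - 1))) (at s)" by (simp add: algebra_simps)
  also have "(\<lambda>s. max s 0 powr q + max (- s) 0 powr q) = (\<lambda>s. \<bar>s\<bar> powr q)"
    using q by (auto simp: fun_eq_iff max_def abs_if)
  finally show ?thesis .
qed

text \<open>The fundamental theorem of calculus along the line through \<open>x\<close> in direction
  \<open>i\<close>, started at a point outside the support.\<close>

lemma abs_powr_le_line_integral:
  fixes \<phi> :: "'a::euclidean_space \<Rightarrow> real"
  assumes \<phi>: "C1_compact \<phi>" and q: "q > 1" and i: "i \<in> Basis"
  shows "ennreal (\<bar>\<phi> x\<bar> powr q) \<le>
    (\<integral>\<^sup>+t. ennreal (q * \<bar>\<phi> (x + (t - x \<bullet> i) *\<^sub>R i)\<bar> powr (q - 1) * norm (grad \<phi> (x + (t - x \<bullet> i) *\<^sub>R i))) \<partial>lborel)"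
proof -
  define y where "y t = x + (t - x \<bullet> i) *\<^sub>R i" for t
  have yc: "continuous_on UNIV y" unfolding y_def by (intro continuous_intros)
  obtain R where R: "R > 0" "\<And>x. norm x \<ge> R \<Longrightarrow> \<phi> x = 0" using C1_compact_radius[OF \<phi>] by metis
  define \<psi> where "\<psi> s = q * (max s 0 powr (q - 1) - max (- s) 0 powr (q - 1))" for s :: real
  define f where "f t = \<psi> (\<phi> (y t)) * (grad \<phi> (y t) \<bullet> i)" for t
  define F where "F t = \<bar>\<phi> (y t)\<bar> powr q" for t
  have \<psi>c: "continuous_on UNIV \<psi>"
    unfolding \<psi>_def using q by (intro continuous_intros continuous_on_powr') auto
  have \<psi>b: "\<bar>\<psi> s\<bar> \<le> q * \<bar>s\<bar> powr (q - 1)" for s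
    using q by (auto simp: \<psi>_def max_def abs_mult)
  have \<phi>y: "continuous_on UNIV (\<lambda>t. \<phi> (y t))" and gy: "continuous_on UNIV (\<lambda>t. grad \<phi> (y t))"
    using C1_compactD(3,4)[OF \<phi>] yc by (auto intro: continuous_on_compose2)
  have fc: "continuous_on UNIV f"
    unfolding f_def using continuous_on_compose2[OF \<psi>c \<phi>y] gy by (intro continuous_intros) auto
  have "DERIV F t :> f t" for t
  proof -
    have "(y has_derivative (\<lambda>h. h *\<^sub>R i)) (at t)"
      unfolding y_def by (auto intro!: derivative_eq_intros)
    from has_derivative_compose[OF this C1_compactD(2)[OF \<phi>]]
    have "((\<lambda>t. \<phi> (y t)) has_real_derivative grad \<phi> (y t) \<bullet> i) (at t)"
      unfolding has_field_derivative_def by (simp add: mult_commute_abs)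
    from DERIV_chain2[OF DERIV_abs_powr[OF q] this] show ?thesis
      unfolding F_def f_def \<psi>_def .
  qed
  \<comment> \<open>beyond the support and to the left of \<open>x\<close>\<close>
  moreover define a where "a = - (\<bar>x \<bullet> i\<bar> + R)"
  have ab: "a \<le> x \<bullet> i" using R by (simp add: a_def)
  ultimately have int: "has_bochner_integral lborel (\<lambda>t. f t * indicator {a .. x \<bullet> i} t) (F (x \<bullet> i) - F a)"
    using fc ab by (intro has_bochner_integral_FTC_Icc_real) (auto simp: continuous_on_eq_continuous_at)
  have "\<bar>a\<bar> \<le> norm (y a)"
  proof -
    have "y a \<bullet> i = a" using i by (simp add: y_def inner_add_left inner_Basis)
    then show ?thesis using Basis_le_norm[OF i, of "y a"] by simp
  qed
  then have "norm (y a) \<ge> R" using R by (simp add: a_def)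
  then have "F a = 0" using R by (simp add: F_def)
  moreover have "F (x \<bullet> i) = \<bar>\<phi> x\<bar> powr q" by (simp add: F_def y_def)
  ultimately have "ennreal (\<bar>\<phi> x\<bar> powr q) = ennreal (norm (LINT t|lborel. f t * indicator {a .. x \<bullet> i} t))"
    using has_bochner_integral_integral_eq[OF int] by simp
  also have "\<dots> \<le> (\<integral>\<^sup>+t. norm (f t * indicator {a .. x \<bullet> i} t) \<partial>lborel)"
    using int by (intro integral_norm_bound_ennreal) (auto simp: has_bochner_integral_iff)
  also have "\<dots> \<le> (\<integral>\<^sup>+t. ennreal (q * \<bar>\<phi> (y t)\<bar> powr (q - 1) * norm (grad \<phi> (y t))) \<partial>lborel)"
  proof (intro nn_integral_mono ennreal_leI)
    fix t
    have "norm (f t * indicator {a .. x \<bullet> i} t) \<le> \<bar>f t\<bar>" by (auto simp: indicator_def)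
    also have "\<dots> \<le> (q * \<bar>\<phi> (y t)\<bar> powr (q - 1)) * norm (grad \<phi> (y t))"
      unfolding f_def abs_mult using \<psi>b Basis_le_norm[OF i] q by (intro mult_mono) auto
    finally show "norm (f t * indicator {a .. x \<bullet> i} t) \<le> q * \<bar>\<phi> (y t)\<bar> powr (q - 1) * norm (grad \<phi> (y t))" .
  qed
  finally show ?thesis by (simp add: y_def)
qed

text \<open>The exponents are those for which the power of \<open>X\<close> on the right-hand side is smaller
  than \<open>1\<close>; it is absorbed on the left.\<close>

lemma sobolev_absorb:
  fixes X Y q p N ps :: real
  assumes "X \<ge> 0" "Y \<ge> 0" "q > 0" "1 < p" "p < N" "ps = N * p / (N - p)"
    and le: "X \<le> (q * (X powr (1 - 1/p) * Y powr (1/p))) powr (N / (N - 1))"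
  shows "X \<le> (q * Y powr (1/p)) powr ps"
proof (cases "X = 0")
  case False
  then have X: "X > 0" using assms by simp
  define e where "e = N / (N - 1)"
  define d where "d = (1 - 1/p) * e"
  have e: "e > 0" using assms by (simp add: e_def)
  have d1: "1 - d = (N - p) / ((N - 1) * p)" using assms by (simp add: d_def e_def field_simps)
  have d: "1 - d > 0" unfolding d1 using assms by simp
  have ne: "N - 1 \<noteq> 0" "N - p \<noteq> 0" "p \<noteq> 0" using assms by auto
  have "e / (1 - d) = ps" unfolding d1 e_def assms(6) using ne by simp
  have "X \<le> (X powr (1 - 1/p) * (q * Y powr (1/p))) powr e" using le by (simp add: e_def mult_ac)
  also have "\<dots> = X powr d * (q * Y powr (1/p)) powr e"
    using assms by (simp add: powr_mult powr_powr d_def)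
  finally have "X / X powr d \<le> (q * Y powr (1/p)) powr e" using X by (simp add: field_simps)
  moreover have "X / X powr d = X powr (1 - d)" using X by (simp add: powr_diff)
  ultimately have "(X powr (1 - d)) powr (1 / (1 - d)) \<le> ((q * Y powr (1/p)) powr e) powr (1 / (1 - d))"
    using d by (intro powr_mono2) auto
  then show ?thesis using d X \<open>e / (1 - d) = ps\<close> by (simp add: powr_powr)
qed simp

text \<open>Gagliardo's estimate for \<open>|\<phi>|\<^sup>q\<close>, whose gradient is at most \<open>q
  |\<phi>|\<^sup>q\<^sup>-\<^sup>1 |\<nabla>\<phi>|\<close>. The exponent \<open>q\<close> is
  chosen such that after Holder's inequality the factor
  \<open>|\<phi>|\<^sup>q\<^sup>-\<^sup>1\<close> appears in the same critical norm as the
  left-hand side; that norm is finite for compact support, so it can be absorbed.\<close>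

lemma sobolev_inequality:
  fixes \<phi> :: "'a::euclidean_space \<Rightarrow> real"
  assumes \<phi>: "C1_compact \<phi>" and p: "1 < p" "p < real DIM('a)"
    and ps: "ps = real DIM('a) * p / (real DIM('a) - p)"
  defines "q \<equiv> p * (real DIM('a) - 1) / (real DIM('a) - p)"
  shows "(LINT x|lborel. \<bar>\<phi> x\<bar> powr ps) \<le> (q * (LINT x|lborel. norm (grad \<phi> x) powr p) powr (1/p)) powr ps"
proof -
  define N where "N = real DIM('a)"
  have N: "DIM('a) \<ge> 2" "p < N" "1 < N" using p by (auto simp: N_def)
  have q: "q > 1" "q > 0" unfolding q_def N_def[symmetric] using N p by (auto simp: field_simps)
  have ps0: "ps > 0" using ps p N by (simp add: N_def)
  have [measurable]: "\<phi> \<in> borel_measurable borel" "grad \<phi> \<in> borel_measurable borel"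
    using C1_compactD[OF \<phi>] by auto
  obtain R where R: "R > 0" "\<And>x. norm x \<ge> R \<Longrightarrow> \<phi> x = 0" "\<And>x. norm x \<ge> R \<Longrightarrow> grad \<phi> x = 0"
    using C1_compact_radius[OF \<phi>] by metis
  define X where "X = (LINT x|lborel. \<bar>\<phi> x\<bar> powr ps)"
  define Y where "Y = (LINT x|lborel. norm (grad \<phi> x) powr p)"
  have XY: "X \<ge> 0" "Y \<ge> 0" by (auto simp: X_def Y_def)
  have iX: "integrable lborel (\<lambda>x. \<bar>\<phi> x\<bar> powr ps)" and iY: "integrable lborel (\<lambda>x. norm (grad \<phi> x) powr p)"
    using C1_compactD(3,4)[OF \<phi>] R ps0 p
    by (intro integrable_continuous_compact[where R=R] continuous_intros continuous_on_powr'; simp)+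
  define w g where "w = (\<lambda>x. ennreal (\<bar>\<phi> x\<bar> powr q))"
    and "g = (\<lambda>x. ennreal (q * \<bar>\<phi> x\<bar> powr (q - 1) * norm (grad \<phi> x)))"
  have "(\<integral>\<^sup>+z. ennpowr (w z) (N / (N - 1)) \<partial>lborel) \<le> ennpowr (\<integral>\<^sup>+z. g z \<partial>lborel) (N / (N - 1))"
    unfolding N_def
  proof (rule gagliardo)
    show "w x \<le> (\<integral>\<^sup>+ t. g (x + (t - x \<bullet> i) *\<^sub>R i) \<partial>lborel)" if "i \<in> Basis" for i x
      unfolding w_def g_def using abs_powr_le_line_integral[OF \<phi> q(1) that] by simp
  qed (use N in \<open>auto simp: w_def g_def\<close>)
  also have "(\<integral>\<^sup>+z. ennpowr (w z) (N / (N - 1)) \<partial>lborel) = (\<integral>\<^sup>+z. ennreal (\<bar>\<phi> z\<bar> powr ps) \<partial>lborel)"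
  proof -
    have "q * (N / (N - 1)) = ps" using N p by (simp add: q_def ps N_def[symmetric])
    then show ?thesis by (simp add: w_def powr_powr)
  qed
  also have "\<dots> = ennreal X" using iX by (simp add: nn_integral_eq_integral X_def)
  also have "ennpowr (\<integral>\<^sup>+z. g z \<partial>lborel) (N / (N - 1)) \<le> ennpowr (ennreal q * (ennpowr (ennreal X) (1 - 1/p) * ennpowr (ennreal Y) (1/p))) (N / (N - 1))"
  proof (intro ennpowr_mono)
    \<comment> \<open>the two truth values index the two factors of the Holder inequality\<close>
    define f where "f = (\<lambda>b::bool. \<lambda>x. if b then ennreal (\<bar>\<phi> x\<bar> powr ps) else ennreal (norm (grad \<phi> x) powr p))"
    define v where "v b = (if b then 1 - 1/p else 1/p)" for b :: bool
    have pt: "g x = ennreal q * (\<Prod>b\<in>UNIV. ennpowr (f b x) (v b))" for x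
    proof -
      have "ps * (1 - 1/p) = q - 1"
        using N p unfolding ps q_def N_def[symmetric] by (simp add: field_simps)
      then show ?thesis using p q
        by (simp add: g_def f_def v_def UNIV_bool powr_powr ennreal_mult'' mult_ac)
    qed
    have "(\<integral>\<^sup>+z. g z \<partial>lborel) = ennreal q * (\<integral>\<^sup>+z. (\<Prod>b\<in>UNIV. ennpowr (f b z) (v b)) \<partial>lborel)"
      unfolding pt by (rule nn_integral_cmult) (auto simp: f_def)
    also have "\<dots> \<le> ennreal q * (\<Prod>b\<in>UNIV. ennpowr (\<integral>\<^sup>+z. f b z \<partial>lborel) (v b))"
      using p by (intro mult_left_mono Holder_nn_integral) (auto simp: f_def v_def UNIV_bool)
    also have "\<dots> = ennreal q * (ennpowr (ennreal X) (1 - 1/p) * ennpowr (ennreal Y) (1/p))"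
      using iX iY by (simp add: UNIV_bool f_def v_def nn_integral_eq_integral X_def Y_def mult.commute)
    finally show "(\<integral>\<^sup>+z. g z \<partial>lborel) \<le> ennreal q * (ennpowr (ennreal X) (1 - 1/p) * ennpowr (ennreal Y) (1/p))" .
  qed (use N in auto)
  also have "\<dots> = ennreal ((q * (X powr (1 - 1/p) * Y powr (1/p))) powr (N / (N - 1)))"
    using XY q by (simp add: ennreal_mult[symmetric])
  finally have "X \<le> (q * (X powr (1 - 1/p) * Y powr (1/p))) powr (N / (N - 1))" by (simp add: ennreal_le_iff)
  from sobolev_absorb[OF XY q(2) p(1) N(2) _ this] show ?thesis
    unfolding X_def Y_def using ps by (simp add: N_def)
qed

section \<open>Smooth bump functions\<close>

lemma k_smooth_Suc_imp: "k_smooth (Suc k) \<phi> \<Longrightarrow> k_smooth k \<phi>"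
proof (induction k arbitrary: \<phi>)
  case 0
  then have "\<phi> differentiable (at x)" for x by simp
  then show ?case
    by (simp add: continuous_on_eq_continuous_at differentiable_imp_continuous_within)
next
  case (Suc k)
  then have "\<forall>x. \<phi> differentiable (at x)"
    and "\<forall>i\<in>Basis. k_smooth (Suc k) (\<lambda>x. frechet_derivative \<phi> (at x) i)"
    using k_smooth.simps(2)[of "Suc k" \<phi>] by auto
  then show ?case using Suc.IH unfolding k_smooth.simps(2)[of k \<phi>] by blast
qed

lemma k_smooth_const: "k_smooth k (\<lambda>x. c)"
  by (induction k arbitrary: c) auto

lemma k_smooth_add: "k_smooth k f \<Longrightarrow> k_smooth k g \<Longrightarrow> k_smooth k (\<lambda>x. f x + g x)"
proof (induction k arbitrary: f g)
  case 0 then show ?case by (auto intro: continuous_intros)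
next
  case (Suc k)
  have d: "f differentiable (at x)" "g differentiable (at x)" for x using Suc.prems by auto
  have "frechet_derivative (\<lambda>x. f x + g x) (at x) i = frechet_derivative f (at x) i + frechet_derivative g (at x) i" for x i
    using frechet_derivative_at[OF has_derivative_add[OF d[THEN frechet_derivative_works[THEN iffD1]]]]
    by metis
  then show ?case using Suc d by simp
qed

lemma k_smooth_mult: "k_smooth k f \<Longrightarrow> k_smooth k g \<Longrightarrow> k_smooth k (\<lambda>x. f x * g x)"
proof (induction k arbitrary: f g)
  case 0 then show ?case by (auto intro: continuous_intros)
next
  case (Suc k)
  have d: "f differentiable (at x)" "g differentiable (at x)" for x using Suc.prems by auto
  have "frechet_derivative (\<lambda>x. f x * g x) (at x) i = f x * frechet_derivative g (at x) i + frechet_derivative f (at x) i * g x" for x i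
    using frechet_derivative_at[OF has_derivative_mult[OF d[THEN frechet_derivative_works[THEN iffD1]]]]
    by metis
  moreover have "k_smooth k f" "k_smooth k g" using Suc.prems k_smooth_Suc_imp by blast+
  ultimately show ?case using Suc d by (simp add: k_smooth_add)
qed

lemma k_smooth_prod: "finite S \<Longrightarrow> (\<And>i. i \<in> S \<Longrightarrow> k_smooth k (f i)) \<Longrightarrow> k_smooth k (\<lambda>x. \<Prod>i\<in>S. f i x)"
  by (induction S rule: finite_induct) (auto intro: k_smooth_const k_smooth_mult)

text \<open>The family is closed under differentiation up to linear combinations, which makes smoothness a
  simple induction.\<close>

definition flat_exp :: "nat \<Rightarrow> real \<Rightarrow> real" where
  "flat_exp m t = (if t > 0 then exp (- 1 / t) / t ^ m else 0)"

text \<open>From \<open>(1 + y/n)\<^sup>n \<le> exp y\<close> with \<open>y = 1/t\<close> and \<open>n = m +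
  1\<close>. The linear bound gives continuity at \<open>0\<close>, and the derivative there since
  \<open>flat_exp m t / t = flat_exp (m + 1) t\<close>.\<close>

lemma flat_exp_bound: "\<bar>flat_exp m t\<bar> \<le> real (Suc m) ^ Suc m * \<bar>t\<bar>"
proof (cases "t > 0")
  case True
  define n where "n = Suc m"
  have "(1 / (t * real n)) ^ n \<le> (1 + (1 / t) / real n) ^ n"
    using True by (intro power_mono) (auto simp: n_def)
  also have "\<dots> \<le> exp (1 / t)"
    using True by (intro exp_ge_one_plus_x_over_n_power_n) (auto simp: n_def order_trans[of _ 0])
  finally have "1 / (t * real n) ^ n \<le> exp (1 / t)" by (simp add: power_divide)
  moreover have "(t * real n) ^ n > 0" using True by (simp add: n_def)
  ultimately have "1 / exp (1 / t) \<le> (t * real n) ^ n"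
    by (simp add: pos_divide_le_eq mult.commute)
  then have "exp (- 1 / t) \<le> (t * real n) ^ n" by (simp add: exp_minus inverse_eq_divide)
  also have "\<dots> = real n ^ n * t * t ^ m" by (simp add: power_mult_distrib n_def)
  finally have "exp (- 1 / t) / t ^ m \<le> real n ^ n * t"
    using True by (simp add: pos_divide_le_eq)
  then show ?thesis using True by (simp add: flat_exp_def n_def)
next
  case False
  then have "flat_exp m t = 0" by (simp add: flat_exp_def)
  moreover have "0 \<le> real (Suc m) ^ Suc m * \<bar>t\<bar>" by (intro mult_nonneg_nonneg) simp_all
  ultimately show ?thesis by simp
qed

lemma DERIV_flat_exp:
  "(flat_exp m has_real_derivative flat_exp (m + 2) t - real m * flat_exp (m + 1) t) (at t)"
proof -
  consider "t > 0" | "t < 0" | "t = 0" by linarith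
  then show ?thesis
  proof cases
    case 1
    have "((\<lambda>t. exp (- 1 / t) / t ^ m) has_real_derivative
       (exp (- 1 / t) * (1 / t\<^sup>2)) / t ^ m - exp (- 1 / t) * (real m * t ^ (m - 1)) / (t ^ m * t ^ m)) (at t)"
      using 1 by (auto intro!: derivative_eq_intros simp: power2_eq_square diff_divide_distrib)
    also have "(exp (- 1 / t) * (1 / t\<^sup>2)) / t ^ m - exp (- 1 / t) * (real m * t ^ (m - 1)) / (t ^ m * t ^ m)
       = flat_exp (m + 2) t - real m * flat_exp (m + 1) t"
    proof -
      have "(exp (- 1 / t) * (1 / t\<^sup>2)) / t ^ m = flat_exp (m + 2) t"
        using 1 by (simp add: flat_exp_def power_add mult.commute power2_eq_square)
      moreover have "exp (- 1 / t) * (real m * t ^ (m - 1)) / (t ^ m * t ^ m) = real m * flat_exp (m + 1) t"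
        using 1 by (cases m) (auto simp: flat_exp_def)
      ultimately show ?thesis by simp
    qed
    finally show ?thesis
      by (rule DERIV_cong_ev[OF refl _ refl, THEN iffD1, rotated])
         (use 1 in \<open>auto simp: flat_exp_def eventually_nhds intro!: exI[of _ "{0<..}"]\<close>)
  next
    case 2
    have "((\<lambda>s. 0) has_real_derivative 0) (at t)" by simp
    then have "(flat_exp m has_real_derivative 0) (at t)"
      by (rule DERIV_cong_ev[OF refl _ refl, THEN iffD1, rotated])
         (use 2 in \<open>auto simp: flat_exp_def eventually_nhds intro!: exI[of _ "{..<0}"]\<close>)
    then show ?thesis using 2 by (simp add: flat_exp_def)
  next
    case 3
    have q: "flat_exp m h / h = flat_exp (m + 1) h" if "h \<noteq> 0" for h
      using that by (simp add: flat_exp_def)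
    have "(flat_exp (m + 1) \<longlongrightarrow> 0) (at 0)"
    proof (rule Lim_null_comparison)
      show "eventually (\<lambda>h. norm (flat_exp (m + 1) h) \<le> real (Suc (m + 1)) ^ Suc (m + 1) * \<bar>h\<bar>) (at 0)"
        unfolding real_norm_def by (intro always_eventually allI flat_exp_bound)
      have "((\<lambda>h::real. real (Suc (m + 1)) ^ Suc (m + 1) * \<bar>h\<bar>) \<longlongrightarrow> real (Suc (m + 1)) ^ Suc (m + 1) * \<bar>0\<bar>) (at 0)"
        by (intro tendsto_intros)
      then show "((\<lambda>h::real. real (Suc (m + 1)) ^ Suc (m + 1) * \<bar>h\<bar>) \<longlongrightarrow> 0) (at 0)" by simp
    qed
    moreover have "eventually (\<lambda>h. flat_exp (m + 1) h = flat_exp m h / h) (at 0)"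
      using q by (simp add: eventually_at_filter)
    ultimately have "((\<lambda>h. flat_exp m h / h) \<longlongrightarrow> 0) (at 0)"
      by (rule Lim_transform_eventually)
    moreover have "flat_exp k 0 = 0" for k by (simp add: flat_exp_def)
    ultimately show ?thesis using 3 by (simp add: DERIV_def)
  qed
qed

lemma k_smooth_flat_exp: "k_smooth k (\<lambda>x::'a::euclidean_space. flat_exp m (\<sigma> * (x \<bullet> b) + \<tau>))"
proof (induction k arbitrary: m)
  case 0
  have "continuous_on UNIV (flat_exp m)"
    using DERIV_isCont[OF DERIV_flat_exp] by (simp add: continuous_on_eq_continuous_at)
  then show ?case by (auto intro!: continuous_on_compose2[of UNIV "flat_exp m"] continuous_intros)
next
  case (Suc k)
  let ?f = "\<lambda>x::'a. flat_exp m (\<sigma> * (x \<bullet> b) + \<tau>)"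
  have d: "(?f has_derivative (\<lambda>v. (flat_exp (m + 2) (\<sigma> * (x \<bullet> b) + \<tau>) - real m * flat_exp (m + 1) (\<sigma> * (x \<bullet> b) + \<tau>)) * (\<sigma> * (v \<bullet> b)))) (at x)" for x
  proof -
    have "((\<lambda>x::'a. \<sigma> * (x \<bullet> b) + \<tau>) has_derivative (\<lambda>v. \<sigma> * (v \<bullet> b))) (at x)"
      by (auto intro!: derivative_eq_intros)
    from has_derivative_compose[OF this DERIV_flat_exp[unfolded has_field_derivative_def]]
    show ?thesis by simp
  qed
  have e: "frechet_derivative ?f (at x) i = (\<sigma> * (i \<bullet> b)) * flat_exp (m + 2) (\<sigma> * (x \<bullet> b) + \<tau>)
      + (- (real m * \<sigma> * (i \<bullet> b))) * flat_exp (m + 1) (\<sigma> * (x \<bullet> b) + \<tau>)" for x i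
    using fun_cong[OF frechet_derivative_at[OF d], of x i] by (simp add: algebra_simps)
  have "k_smooth k (\<lambda>x. frechet_derivative ?f (at x) i)" for i
    unfolding e by (intro k_smooth_add k_smooth_mult k_smooth_const Suc.IH)
  moreover have "?f differentiable (at x)" for x using d by (rule differentiableI)
  ultimately show ?case by simp
qed

text \<open>The scaling by \<open>n + 1\<close> inside the exponentials makes the bumps increase to the
  indicator of the open box while their support stays in the closed box.\<close>

definition box_bump :: "'a::euclidean_space \<Rightarrow> 'a \<Rightarrow> nat \<Rightarrow> 'a \<Rightarrow> real" where
  "box_bump a c n x = (\<Prod>b\<in>Basis. flat_exp 0 (real (Suc n) * (x \<bullet> b - a \<bullet> b)) * flat_exp 0 (real (Suc n) * (c \<bullet> b - x \<bullet> b)))"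

lemma smooth_box_bump: "smooth (box_bump a c n)"
proof -
  have e: "box_bump a c n = (\<lambda>x. \<Prod>b\<in>Basis. flat_exp 0 (real (Suc n) * (x \<bullet> b) + (- real (Suc n) * (a \<bullet> b)))
     * flat_exp 0 ((- real (Suc n)) * (x \<bullet> b) + real (Suc n) * (c \<bullet> b)))"
    by (simp add: box_bump_def fun_eq_iff algebra_simps)
  show ?thesis unfolding smooth_def e
    by (intro allI k_smooth_prod k_smooth_mult k_smooth_flat_exp) auto
qed

lemma box_bump_outside: "x \<notin> box a c \<Longrightarrow> box_bump a c n x = 0"
proof -
  assume "x \<notin> box a c"
  then obtain b where b: "b \<in> Basis" "\<not> (a \<bullet> b < x \<bullet> b \<and> x \<bullet> b < c \<bullet> b)" by (auto simp: mem_box)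
  then have "flat_exp 0 (real (Suc n) * (x \<bullet> b - a \<bullet> b)) * flat_exp 0 (real (Suc n) * (c \<bullet> b - x \<bullet> b)) = 0"
    by (auto simp: flat_exp_def zero_less_mult_iff)
  then show ?thesis unfolding box_bump_def using b(1) by (intro prod_zero) auto
qed

lemma test_function_box_bump:
  assumes "cbox a c \<subseteq> \<Omega>"
  shows "test_function \<Omega> (box_bump a c n)"
proof -
  have "{x. box_bump a c n x \<noteq> 0} \<subseteq> cbox a c" using box_bump_outside box_subset_cbox by blast
  then have c: "closure {x. box_bump a c n x \<noteq> 0} \<subseteq> cbox a c" by (intro closure_minimal closed_cbox)
  then have "bounded (closure {x. box_bump a c n x \<noteq> 0})" using bounded_cbox bounded_subset by blast
  then show ?thesis using assms c smooth_box_bump by (auto simp: test_function_def compact_eq_bounded_closed)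
qed

lemma box_bump_le_1: "\<bar>box_bump a c n x\<bar> \<le> 1"
proof -
  have f: "0 \<le> flat_exp 0 t" "flat_exp 0 t \<le> 1" for t by (auto simp: flat_exp_def)
  have "0 \<le> box_bump a c n x" unfolding box_bump_def by (intro prod_nonneg) (simp add: f)
  moreover have "box_bump a c n x \<le> 1" unfolding box_bump_def
    by (intro prod_le_1) (auto simp: f intro: mult_le_one)
  ultimately show ?thesis by simp
qed

lemma box_bump_tendsto: "(\<lambda>n. box_bump a c n x) \<longlonglongrightarrow> indicator (box a c) x"
proof (cases "x \<in> box a c")
  case True
  have l: "(\<lambda>n. flat_exp 0 (real (Suc n) * t)) \<longlonglongrightarrow> 1" if "t > 0" for t
  proof -
    have "(\<lambda>n. exp (- (inverse (real (Suc n)) * (1 / t)))) \<longlonglongrightarrow> exp (- (0 * (1 / t)))"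
      by (intro tendsto_intros LIMSEQ_inverse_real_of_nat)
    moreover have "flat_exp 0 (real (Suc n) * t) = exp (- (inverse (real (Suc n)) * (1 / t)))" for n
      using that by (simp add: flat_exp_def divide_simps)
    ultimately show ?thesis by simp
  qed
  have "(\<lambda>n. box_bump a c n x) \<longlonglongrightarrow> (\<Prod>b\<in>(Basis::'a set). 1 * 1)"
    unfolding box_bump_def using True by (intro tendsto_prod tendsto_mult l) (auto simp: mem_box)
  then show ?thesis using True by simp
next
  case False
  then show ?thesis by (simp add: box_bump_outside)
qed

section \<open>The fundamental lemma of the calculus of variations\<close>

lemma integrable_lebesgue_on_subset:
  fixes g :: "'a::euclidean_space \<Rightarrow> 'b::euclidean_space"
  assumes "integrable lborel g" "K \<in> sets lebesgue"
  shows "integrable (lebesgue_on K) g"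
proof -
  have "integrable lebesgue g" using assms(1) by (simp add: integrable_completion)
  then show ?thesis using assms(2) by (simp add: integrable_restrict_space integrable_mult_indicator)
qed

lemma locally_integrable_mult:
  fixes g :: "'a::euclidean_space \<Rightarrow> 'b::euclidean_space" and \<psi> :: "'a \<Rightarrow> real"
  assumes g: "locally_integrable \<Omega> g" and \<psi>: "\<psi> \<in> borel_measurable borel" "\<And>x. \<bar>\<psi> x\<bar> \<le> C"
    and K: "compact K" "K \<subseteq> \<Omega>" "\<And>x. x \<notin> K \<Longrightarrow> \<psi> x = 0" and \<Omega>: "\<Omega> \<in> sets lebesgue"
  shows "integrable (lebesgue_on \<Omega>) (\<lambda>x. \<psi> x *\<^sub>R g x)"
proof -
  have Km: "K \<in> sets lebesgue" using K(1) by (simp add: compact_imp_closed)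
  have "integrable (lebesgue_on K) g" using g K by (auto simp: locally_integrable_def)
  then have 1: "integrable lebesgue (\<lambda>x. indicator K x *\<^sub>R g x)"
    using Km by (simp add: integrable_restrict_space)
  have m: "\<psi> \<in> borel_measurable lebesgue" using \<psi>(1) by (simp add: measurable_completion)
  have "integrable lebesgue (\<lambda>x. \<psi> x *\<^sub>R (indicator K x *\<^sub>R g x))"
  proof (rule Bochner_Integration.integrable_bound[OF integrable_scaleR_right[OF 1, of C]])
    show "AE x in lebesgue. norm (\<psi> x *\<^sub>R (indicator K x *\<^sub>R g x)) \<le> norm (C *\<^sub>R (indicator K x *\<^sub>R g x))"
      unfolding norm_scaleR using \<psi>(2) by (intro AE_I2 mult_right_mono) (auto intro: order_trans[OF _ abs_ge_self])
  qed (intro borel_measurable_scaleR m borel_measurable_integrable[OF 1])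
  also have "(\<lambda>x. \<psi> x *\<^sub>R (indicator K x *\<^sub>R g x)) = (\<lambda>x. indicator \<Omega> x *\<^sub>R (\<psi> x *\<^sub>R g x))"
    using K by (auto simp: fun_eq_iff indicator_def)
  finally show ?thesis using \<Omega> by (simp add: integrable_restrict_space)
qed

text \<open>Open boxes are stable under intersection and generate the Borel sets, and the sets on which the
  integral vanishes form a Dynkin system.\<close>

lemma integral_borel_sets_zero_if_boxes:
  fixes g :: "'a::euclidean_space \<Rightarrow> real"
  assumes g: "integrable lebesgue g" and UN: "(LINT x|lebesgue. g x) = 0"
    and box: "\<And>a c. (LINT x|lebesgue. indicator (box a c) x *\<^sub>R g x) = 0"
    and A: "A \<in> sets borel"
  shows "(LINT x|lebesgue. indicator A x *\<^sub>R g x) = 0"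
proof -
  let ?G = "range (\<lambda>(a, c). box a c :: 'a set)"
  have sb: "sets borel = sigma_sets UNIV ?G" by (simp add: borel_eq_box)
  have "Int_stable ?G"
  proof (rule Int_stableI)
    fix X Y assume "X \<in> ?G" "Y \<in> ?G"
    then obtain a c a' c' where "X = box a c" "Y = box a' c'" by auto
    then obtain p q where "X \<inter> Y = box p q" using box_Int_box[of a c a' c'] by simp
    then show "X \<inter> Y \<in> ?G" by (intro image_eqI[of _ _ "(p, q)"]) auto
  qed
  moreover have "?G \<subseteq> Pow UNIV" by simp
  moreover have "A \<in> sigma_sets UNIV ?G" using A sb by simp
  ultimately show ?thesis
  proof (induction rule: sigma_sets_induct_disjoint)
    case (basic A)
    then show ?case using box by auto
  next
    case empty
    then show ?case by simp
  next
    case (compl A)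
    then have "A \<in> sets lebesgue" using sb by auto
    then have i: "integrable lebesgue (\<lambda>x. indicator A x *\<^sub>R g x)" using g by (intro integrable_mult_indicator)
    have "(LINT x|lebesgue. indicator (UNIV - A) x *\<^sub>R g x) = (LINT x|lebesgue. g x - indicator A x *\<^sub>R g x)"
      by (intro Bochner_Integration.integral_cong) (auto simp: indicator_def)
    also have "\<dots> = 0" using compl i g UN by simp
    finally show ?case .
  next
    case (union A)
    have m: "A i \<in> sets lebesgue" for i using union sb by (auto simp: subset_iff)
    then have "(\<Union>i. A i) \<in> sets lebesgue" by auto
    then have "set_integrable lebesgue (\<Union>i. A i) g"
      unfolding set_integrable_def using g by (intro integrable_mult_indicator)
    with m have "(LINT x:(\<Union>i. A i)|lebesgue. g x) = (\<Sum>i. (LINT x:(A i)|lebesgue. g x))"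
      using union(1) by (intro lebesgue_integral_countable_add) (auto simp: disjoint_family_on_def)
    also have "\<dots> = 0" using union(3) by (simp add: set_lebesgue_integral_def)
    finally show ?case by (simp add: set_lebesgue_integral_def)
  qed
qed

lemma AE_zero_if_boxes:
  fixes g :: "'a::euclidean_space \<Rightarrow> real"
  assumes g: "integrable lebesgue g" and UN: "(LINT x|lebesgue. g x) = 0"
    and box: "\<And>a c. (LINT x|lebesgue. indicator (box a c) x *\<^sub>R g x) = 0"
  shows "AE x in lebesgue. g x = 0"
proof (rule density_unique_real[OF g, of "\<lambda>_. 0"])
  fix A :: "'a set" assume "A \<in> sets lebesgue"
  then obtain S N N' where A: "A = S \<union> N" "N \<subseteq> N'" "N' \<in> null_sets lborel" "S \<in> sets lborel"
    by (rule sets_completionE)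
  have "AE x in lborel. x \<notin> N'" using A(3) by (rule AE_not_in)
  then have "AE x in lebesgue. x \<notin> N'" by (rule AE_completion)
  then have "AE x in lebesgue. indicator A x *\<^sub>R g x = indicator S x *\<^sub>R g x"
    by eventually_elim (use A in \<open>auto simp: indicator_def\<close>)
  then have "(LINT x|lebesgue. indicator A x *\<^sub>R g x) = (LINT x|lebesgue. indicator S x *\<^sub>R g x)"
    using \<open>A \<in> sets lebesgue\<close> A(4)
    by (intro integral_cong_AE borel_measurable_scaleR borel_measurable_indicator borel_measurable_integrable[OF g]) auto
  also have "\<dots> = 0" using A(4) by (intro integral_borel_sets_zero_if_boxes[OF g UN box]) simp
  finally show "(LINT x:A|lebesgue. g x) = (LINT x:A|lebesgue. 0)" by (simp add: set_lebesgue_integral_def)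
qed simp

text \<open>The fundamental lemma of the calculus of variations. Box bumps give vanishing integrals over all
  boxes with closure in \<open>\<Omega>\<close>, hence \<open>g = 0\<close> on each such box;
  countably many of them cover \<open>\<Omega>\<close>.\<close>

lemma AE_zero_if_test_functions:
  fixes g :: "'a::euclidean_space \<Rightarrow> real"
  assumes \<Omega>: "open \<Omega>" and g: "locally_integrable \<Omega> g"
    and z: "\<And>\<phi>. test_function \<Omega> \<phi> \<Longrightarrow> (LINT x|lebesgue_on \<Omega>. g x * \<phi> x) = 0"
  shows "AE x in lebesgue_on \<Omega>. g x = 0"
proof -
  have \<Omega>m: "\<Omega> \<in> sets lebesgue" using \<Omega> by simp
  have box0: "(LINT x|lebesgue. indicator (box a c) x *\<^sub>R g x) = 0" if ac: "cbox a c \<subseteq> \<Omega>" for a c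
  proof -
    have "integrable (lebesgue_on (cbox a c)) g" using g ac by (auto simp: locally_integrable_def)
    then have ic: "integrable lebesgue (\<lambda>x. indicator (cbox a c) x *\<^sub>R g x)" by (simp add: integrable_restrict_space)
    have e: "indicator (cbox a c) x *\<^sub>R g x * box_bump a c n x = indicator \<Omega> x *\<^sub>R (g x * box_bump a c n x)" for x n
      using ac box_bump_outside[of x a c n] box_subset_cbox[of a c] by (auto simp: indicator_def)
    have "(\<lambda>n. LINT x|lebesgue. indicator (cbox a c) x *\<^sub>R g x * box_bump a c n x) \<longlonglongrightarrow>
        (LINT x|lebesgue. indicator (cbox a c) x *\<^sub>R g x * indicator (box a c) x)"
    proof (rule integral_dominated_convergence)
      show "integrable lebesgue (\<lambda>x. norm (indicator (cbox a c) x *\<^sub>R g x))" using ic by (rule integrable_norm)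
      show "AE x in lebesgue. (\<lambda>n. indicator (cbox a c) x *\<^sub>R g x * box_bump a c n x) \<longlonglongrightarrow> indicator (cbox a c) x *\<^sub>R g x * indicator (box a c) x"
        by (intro AE_I2 tendsto_mult tendsto_const box_bump_tendsto)
      show "AE x in lebesgue. norm (indicator (cbox a c) x *\<^sub>R g x * box_bump a c n x) \<le> norm (indicator (cbox a c) x *\<^sub>R g x)" for n
        unfolding norm_mult using box_bump_le_1 by (intro AE_I2 mult_left_le) auto
      show "(\<lambda>x. indicator (cbox a c) x *\<^sub>R g x * box_bump a c n x) \<in> borel_measurable lebesgue" for n
      proof -
        have "box_bump a c n \<in> borel_measurable borel"
          using C1_compactD(5)[OF test_function_C1_compact[OF test_function_box_bump[OF ac]]] .
        then have "box_bump a c n \<in> borel_measurable lebesgue" by (simp add: measurable_completion)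
        then show ?thesis by (intro borel_measurable_times borel_measurable_integrable[OF ic])
      qed
      show "(\<lambda>x. indicator (cbox a c) x *\<^sub>R g x * indicator (box a c) x) \<in> borel_measurable lebesgue"
        by (intro borel_measurable_times borel_measurable_integrable[OF ic] borel_measurable_indicator) auto
    qed
    moreover have "(LINT x|lebesgue. indicator (cbox a c) x *\<^sub>R g x * box_bump a c n x) = 0" for n
      unfolding e using z[OF test_function_box_bump[OF ac]] \<Omega>m by (simp add: integral_restrict_space)
    ultimately have "(LINT x|lebesgue. indicator (cbox a c) x *\<^sub>R g x * indicator (box a c) x) = 0"
      by (simp add: LIMSEQ_const_iff)
    moreover have "(\<lambda>x. indicator (cbox a c) x *\<^sub>R g x * indicator (box a c) x) = (\<lambda>x. indicator (box a c) x *\<^sub>R g x)"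
      using box_subset_cbox[of a c] by (auto simp: indicator_def fun_eq_iff)
    ultimately show ?thesis by (simp only:)
  qed
  have loc: "AE x in lebesgue. x \<in> box a c \<longrightarrow> g x = 0" if ac: "cbox a c \<subseteq> \<Omega>" for a c
  proof -
    have "integrable (lebesgue_on (cbox a c)) g" using g ac by (auto simp: locally_integrable_def)
    then have ic: "integrable lebesgue (\<lambda>x. indicator (cbox a c) x *\<^sub>R g x)" by (simp add: integrable_restrict_space)
    have "integrable lebesgue (\<lambda>x. indicator (box a c) x *\<^sub>R (indicator (cbox a c) x *\<^sub>R g x))"
      by (rule integrable_mult_indicator[OF _ ic]) simp
    moreover have e: "indicator (box a c) x *\<^sub>R (indicator (cbox a c) x *\<^sub>R g x) = indicator (box a c) x *\<^sub>R g x" for x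
      using box_subset_cbox[of a c] by (auto simp: indicator_def)
    ultimately have ib: "integrable lebesgue (\<lambda>x. indicator (box a c) x *\<^sub>R g x)" by (simp only: e)
    have "AE x in lebesgue. indicator (box a c) x *\<^sub>R g x = 0"
    proof (rule AE_zero_if_boxes[OF ib box0[OF ac]])
      fix a' c' :: 'a
      obtain p q where pq: "box a' c' \<inter> box a c = box p q" using box_Int_box by blast
      have "(LINT x|lebesgue. indicator (box a' c') x *\<^sub>R (indicator (box a c) x *\<^sub>R g x)) = (LINT x|lebesgue. indicator (box p q) x *\<^sub>R g x)"
        unfolding pq[symmetric] by (intro Bochner_Integration.integral_cong) (auto simp: indicator_def)
      also have "\<dots> = 0"
      proof (cases "box p q = {}")
        case False
        have "cbox p q = closure (box p q)" using closure_box[OF False] by simp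
        also have "\<dots> \<subseteq> cbox a c" using pq box_subset_cbox[of a c] by (intro closure_minimal closed_cbox) blast
        finally show ?thesis using ac by (intro box0) blast
      qed simp
      finally show "(LINT x|lebesgue. indicator (box a' c') x *\<^sub>R (indicator (box a c) x *\<^sub>R g x)) = 0" .
    qed
    then show ?thesis by eventually_elim (auto simp: indicator_def)
  qed
  \<comment> \<open>Lindelof: the vanishing holds outside a null set that depends on the box\<close>
  define F where "F = {X. \<exists>a c. X = box a c \<and> cbox a c \<subseteq> \<Omega>}"
  obtain F' where F': "F' \<subseteq> F" "countable F'" "\<Union>F' = \<Union>F"
    by (rule Lindelof[of F]) (auto simp: F_def)
  have "\<Omega> \<subseteq> \<Union>F"
  proof
    fix x assume "x \<in> \<Omega>"
    with \<Omega> obtain a c where "cbox a c \<subseteq> \<Omega>" "x \<in> box a c" by (rule open_contains_cbox)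
    then show "x \<in> \<Union>F" by (auto simp: F_def)
  qed
  then have cover: "\<Omega> \<subseteq> \<Union>F'" using F' by simp
  have "AE x in lebesgue. \<forall>X\<in>F'. x \<in> X \<longrightarrow> g x = 0"
    using F'(2)
  proof (rule AE_ball_countable[THEN iffD2], intro ballI)
    fix X assume "X \<in> F'"
    then obtain a c where "X = box a c" "cbox a c \<subseteq> \<Omega>" using F'(1) by (auto simp: F_def)
    then show "AE x in lebesgue. x \<in> X \<longrightarrow> g x = 0" using loc by simp
  qed
  then have "AE x in lebesgue. x \<in> \<Omega> \<longrightarrow> g x = 0"
    by eventually_elim (use cover in blast)
  then show ?thesis using \<Omega>m by (simp add: AE_restrict_space_iff)
qed

section \<open>Weak gradients\<close>

lemma test_function_support:
  assumes "test_function \<Omega> \<phi>"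
  obtains K where "compact K" "K \<subseteq> \<Omega>" "\<And>x. x \<notin> K \<Longrightarrow> \<phi> x = 0" "\<And>x. x \<notin> K \<Longrightarrow> grad \<phi> x = 0"
  using assms test_function_zero_outside[OF assms] that[of "closure {x. \<phi> x \<noteq> 0}"]
  unfolding test_function_def by blast

lemma C1_compact_bounded:
  assumes "C1_compact \<phi>"
  obtains C where "C > 0" "\<And>x. \<bar>\<phi> x\<bar> \<le> C" "\<And>x. norm (grad \<phi> x) \<le> C"
proof -
  obtain R where R: "\<And>x. norm x \<ge> R \<Longrightarrow> \<phi> x = 0" "\<And>x. norm x \<ge> R \<Longrightarrow> grad \<phi> x = 0"
    using C1_compact_radius[OF assms] by metis
  obtain K1 where K1: "K1 > 0" "\<And>x. norm (\<phi> x) \<le> K1"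
    using bounded_continuous_compact[OF C1_compactD(3)[OF assms] R(1)] by metis
  obtain K2 where K2: "K2 > 0" "\<And>x. norm (grad \<phi> x) \<le> K2"
    using bounded_continuous_compact[OF C1_compactD(4)[OF assms] R(2)] by metis
  show ?thesis
  proof (rule that[of "max K1 K2"])
    show "\<bar>\<phi> x\<bar> \<le> max K1 K2" for x using K1(2)[of x] by simp
    show "norm (grad \<phi> x) \<le> max K1 K2" for x using K2(2)[of x] by simp
  qed (use K1 in simp)
qed

lemma integrable_test_mult:
  fixes v :: "'a::euclidean_space \<Rightarrow> real" and G :: "'a \<Rightarrow> 'a"
  assumes \<Omega>: "\<Omega> \<in> sets lebesgue" and t: "test_function \<Omega> \<phi>"
  shows "locally_integrable \<Omega> v \<Longrightarrow> integrable (lebesgue_on \<Omega>) (\<lambda>x. v x * \<phi> x)"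
    "locally_integrable \<Omega> v \<Longrightarrow> i \<in> Basis \<Longrightarrow> integrable (lebesgue_on \<Omega>) (\<lambda>x. v x * (grad \<phi> x \<bullet> i))"
    "locally_integrable \<Omega> G \<Longrightarrow> integrable (lebesgue_on \<Omega>) (\<lambda>x. (G x \<bullet> i) * \<phi> x)"
proof -
  obtain K where K: "compact K" "K \<subseteq> \<Omega>" "\<And>x. x \<notin> K \<Longrightarrow> \<phi> x = 0" "\<And>x. x \<notin> K \<Longrightarrow> grad \<phi> x = 0"
    using test_function_support[OF t] by metis
  note C1 = test_function_C1_compact[OF t]
  obtain C where C: "C > 0" "\<And>x. \<bar>\<phi> x\<bar> \<le> C" "\<And>x. norm (grad \<phi> x) \<le> C"
    using C1_compact_bounded[OF C1] by metis
  have [measurable]: "\<phi> \<in> borel_measurable borel" "grad \<phi> \<in> borel_measurable borel"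
    using C1_compactD[OF C1] by auto
  show "integrable (lebesgue_on \<Omega>) (\<lambda>x. v x * \<phi> x)" if "locally_integrable \<Omega> v"
    using locally_integrable_mult[where \<psi>=\<phi>, OF that _ C(2) K(1-3) \<Omega>] by (simp add: mult.commute)
  show "integrable (lebesgue_on \<Omega>) (\<lambda>x. v x * (grad \<phi> x \<bullet> i))" if "locally_integrable \<Omega> v" "i \<in> Basis"
  proof -
    have "\<bar>grad \<phi> x \<bullet> i\<bar> \<le> C" for x using C(3)[of x] Basis_le_norm[OF that(2), of "grad \<phi> x"] by linarith
    from locally_integrable_mult[where \<psi>="\<lambda>x. grad \<phi> x \<bullet> i", OF that(1) _ this K(1,2) _ \<Omega>] K(4) show ?thesis
      by (simp add: mult.commute)
  qed
  show "integrable (lebesgue_on \<Omega>) (\<lambda>x. (G x \<bullet> i) * \<phi> x)" if "locally_integrable \<Omega> G"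
    using integrable_inner_left[OF locally_integrable_mult[where \<psi>=\<phi>, OF that _ C(2) K(1-3) \<Omega>], of i] by (simp add: mult.commute)
qed

lemma has_weak_grad_iff:
  "has_weak_grad \<Omega> v G \<longleftrightarrow> locally_integrable \<Omega> v \<and> locally_integrable \<Omega> G \<and>
     (\<forall>\<phi>. test_function \<Omega> \<phi> \<longrightarrow> (\<forall>i\<in>Basis.
        (LINT x|lebesgue_on \<Omega>. v x * (grad \<phi> x \<bullet> i)) =
        - (LINT x|lebesgue_on \<Omega>. (G x \<bullet> i) * \<phi> x)))"
proof -
  have "frechet_derivative \<phi> (at x) i = grad \<phi> x \<bullet> i" if "test_function \<Omega> \<phi>" for \<phi> :: "'a \<Rightarrow> real" and x i
    by (rule frechet_derivative_eq_grad[OF C1_compactD(1)[OF test_function_C1_compact[OF that]]])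
  then show ?thesis unfolding has_weak_grad_def by (metis (mono_tags, lifting) Bochner_Integration.integral_cong)
qed

lemma locally_integrable_diff:
  "locally_integrable \<Omega> f \<Longrightarrow> locally_integrable \<Omega> g \<Longrightarrow> locally_integrable \<Omega> (\<lambda>x. f x - g x)"
  by (simp add: locally_integrable_def)

lemma has_weak_grad_diff:
  assumes "open \<Omega>" "has_weak_grad \<Omega> v G" "has_weak_grad \<Omega> w H"
  shows "has_weak_grad \<Omega> (\<lambda>x. v x - w x) (\<lambda>x. G x - H x)"
proof -
  have \<Omega>: "\<Omega> \<in> sets lebesgue" using assms(1) by simp
  note vw = assms(2,3)[unfolded has_weak_grad_iff]
  have "(LINT x|lebesgue_on \<Omega>. (v x - w x) * (grad \<phi> x \<bullet> i)) = - (LINT x|lebesgue_on \<Omega>. ((G x - H x) \<bullet> i) * \<phi> x)"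
    if t: "test_function \<Omega> \<phi>" and i: "i \<in> Basis" for \<phi> i
  proof -
    note v = integrable_test_mult(2)[OF \<Omega> t _ i] and H = integrable_test_mult(3)[OF \<Omega> t]
    have "(LINT x|lebesgue_on \<Omega>. v x * (grad \<phi> x \<bullet> i)) = - (LINT x|lebesgue_on \<Omega>. (G x \<bullet> i) * \<phi> x)"
      "(LINT x|lebesgue_on \<Omega>. w x * (grad \<phi> x \<bullet> i)) = - (LINT x|lebesgue_on \<Omega>. (H x \<bullet> i) * \<phi> x)"
      using vw t i by blast+
    then show ?thesis
      unfolding left_diff_distrib inner_diff_left using vw
      by (simp add: v H Bochner_Integration.integral_diff)
  qed
  then show ?thesis using vw unfolding has_weak_grad_iff by (intro conjI locally_integrable_diff) blast+
qed

text \<open>The difference of two weak gradients is a weak gradient of \<open>0\<close>.\<close>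

lemma has_weak_grad_unique:
  assumes \<Omega>: "open \<Omega>" and G: "has_weak_grad \<Omega> v G" and H: "has_weak_grad \<Omega> v H"
  shows "AE x in lebesgue_on \<Omega>. G x = H x"
proof -
  have d: "has_weak_grad \<Omega> (\<lambda>x. v x - v x) (\<lambda>x. G x - H x)" by (rule has_weak_grad_diff[OF \<Omega> G H])
  have "AE x in lebesgue_on \<Omega>. (G x - H x) \<bullet> i = 0" if i: "i \<in> Basis" for i
  proof (rule AE_zero_if_test_functions[OF \<Omega>])
    show "locally_integrable \<Omega> (\<lambda>x. (G x - H x) \<bullet> i)"
      using d by (auto simp: has_weak_grad_def locally_integrable_def)
    show "(LINT x|lebesgue_on \<Omega>. (G x - H x) \<bullet> i * \<phi> x) = 0" if "test_function \<Omega> \<phi>" for \<phi>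
      using d that i by (simp add: has_weak_grad_iff)
  qed
  then have "AE x in lebesgue_on \<Omega>. \<forall>i\<in>Basis. (G x - H x) \<bullet> i = 0" by (simp add: AE_finite_all)
  then show ?thesis by eventually_elim (auto simp: euclidean_eq_iff[of "G _"] inner_diff_left)
qed

section \<open>Integration by parts\<close>

lemma C1_compact_lipschitz:
  fixes w :: "'a::euclidean_space \<Rightarrow> real"
  assumes w: "C1_compact w" and C: "\<And>x. norm (grad w x) \<le> C"
  shows "\<bar>w x - w y\<bar> \<le> C * norm (x - y)"
proof -
  have "norm (w x - w y) \<le> C * norm (x - y)"
  proof (rule differentiable_bound[of UNIV w "\<lambda>x v. grad w x \<bullet> v"])
    show "onorm (\<lambda>v. grad w x \<bullet> v) \<le> C" for x
    proof (rule onorm_le)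
      fix v
      have "norm (grad w x \<bullet> v) \<le> norm (grad w x) * norm v" by (simp add: Cauchy_Schwarz_ineq2)
      also have "\<dots> \<le> C * norm v" using C[of x] by (rule mult_right_mono) simp
      finally show "norm (grad w x \<bullet> v) \<le> C * norm v" .
    qed
  qed (use C1_compactD(2)[OF w] in \<open>auto intro: has_derivative_at_withinI\<close>)
  then show ?thesis by simp
qed

text \<open>A common integrable majorant and the pointwise limit; both integration by parts and the
  translation estimate are limits of statements about difference quotients.\<close>

lemma difference_quotient:
  fixes w :: "'a::euclidean_space \<Rightarrow> real" and v :: 'a
  assumes w: "C1_compact w"
  defines "q \<equiv> (\<lambda>n x. real (Suc n) * (w (x + (1 / real (Suc n)) *\<^sub>R v) - w x))"
  obtains C R where "\<And>n x. \<bar>q n x\<bar> \<le> C * indicator (cball 0 R) x" "\<And>x. (\<lambda>n. q n x) \<longlonglongrightarrow> grad w x \<bullet> v"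
    "\<And>n. q n \<in> borel_measurable borel"
proof -
  obtain R where R: "R > 0" "\<And>x. norm x \<ge> R \<Longrightarrow> w x = 0" using C1_compact_radius[OF w] by metis
  obtain C where C: "C > 0" "\<And>x. norm (grad w x) \<le> C" using C1_compact_bounded[OF w] by metis
  have [measurable]: "w \<in> borel_measurable borel" using C1_compactD[OF w] by auto
  show ?thesis
  proof
    show "q n \<in> borel_measurable borel" for n unfolding q_def by measurable
    show "\<bar>q n x\<bar> \<le> (C * norm v) * indicator (cball 0 (R + norm v)) x" for n x
    proof (cases "norm x \<le> R + norm v")
      case True
      have "\<bar>q n x\<bar> = real (Suc n) * \<bar>w (x + (1 / real (Suc n)) *\<^sub>R v) - w x\<bar>" by (simp add: q_def abs_mult)
      also have "\<dots> \<le> real (Suc n) * (C * norm ((1 / real (Suc n)) *\<^sub>R v))"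
        using C1_compact_lipschitz[OF w C(2), of "x + (1 / real (Suc n)) *\<^sub>R v" x] by (intro mult_left_mono) auto
      also have "\<dots> = C * norm v" by simp
      finally show ?thesis using True by (simp add: indicator_def)
    next
      case False
      have "norm ((1 / real (Suc n)) *\<^sub>R v) \<le> norm v" by (simp add: divide_le_eq mult_left_le_one_le field_simps)
      then have "norm (x + (1 / real (Suc n)) *\<^sub>R v) \<ge> R"
        using False norm_triangle_ineq4[of "x + (1 / real (Suc n)) *\<^sub>R v" "(1 / real (Suc n)) *\<^sub>R v"] by simp
      then show ?thesis using False R(2)[of x] R(2)[of "x + (1 / real (Suc n)) *\<^sub>R v"] norm_ge_zero[of v]
        unfolding q_def by (simp add: indicator_def)
    qed
    show "(\<lambda>n. q n x) \<longlonglongrightarrow> grad w x \<bullet> v" for x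
    proof -
      have "((\<lambda>t::real. x + t *\<^sub>R v) has_derivative (\<lambda>t. t *\<^sub>R v)) (at 0)" by (auto intro!: derivative_eq_intros)
      moreover have "(w has_derivative (\<lambda>u. grad w x \<bullet> u)) (at (x + 0 *\<^sub>R v))" using C1_compactD(2)[OF w] by simp
      ultimately have "((\<lambda>t. w (x + t *\<^sub>R v)) has_derivative (\<lambda>t. grad w x \<bullet> (t *\<^sub>R v))) (at 0)"
        by (rule has_derivative_compose)
      then have "((\<lambda>t. w (x + t *\<^sub>R v)) has_real_derivative (grad w x \<bullet> v)) (at 0)"
        by (simp add: has_field_derivative_def mult_commute_abs)
      then have "((\<lambda>h. (w (x + h *\<^sub>R v) - w x) / h) \<longlongrightarrow> grad w x \<bullet> v) (at 0)" by (simp add: DERIV_def)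
      moreover have "filterlim (\<lambda>n. 1 / real (Suc n)) (at 0) sequentially"
        unfolding filterlim_at using LIMSEQ_inverse_real_of_nat by (auto simp: always_eventually inverse_eq_divide)
      ultimately have "(\<lambda>n. (w (x + (1 / real (Suc n)) *\<^sub>R v) - w x) / (1 / real (Suc n))) \<longlonglongrightarrow> grad w x \<bullet> v"
        by (rule filterlim_compose)
      then show ?thesis by (simp add: q_def mult.commute)
    qed
  qed
qed

lemma integral_lborel_shift:
  fixes g :: "'a::euclidean_space \<Rightarrow> 'b::euclidean_space"
  assumes [measurable]: "g \<in> borel_measurable borel"
  shows "(LINT x|lborel. g (x + v)) = (LINT x|lborel. g x)"
proof -
  have "(LINT x|lborel. g x) = (LINT x|distr lborel borel ((+) v). g x)" by (simp add: lborel_distr_plus)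
  also have "\<dots> = (LINT x|lborel. g (v + x))" by (subst integral_distr) auto
  finally show ?thesis by (simp add: add.commute)
qed

lemma integrable_lborel_shift:
  fixes g :: "'a::euclidean_space \<Rightarrow> 'b::euclidean_space"
  assumes [measurable]: "g \<in> borel_measurable borel" and "integrable lborel g"
  shows "integrable lborel (\<lambda>x. g (x + v))"
proof -
  have "integrable (distr lborel borel ((+) v)) g" using assms by (simp add: lborel_distr_plus)
  then have "integrable lborel (\<lambda>x. g (v + x))" by (subst (asm) integrable_distr_eq) auto
  then show ?thesis by (simp add: add.commute)
qed

lemma C1_compact_integrable:
  assumes "C1_compact w" shows "integrable lborel w" "integrable lborel (grad w)"
proof -
  obtain R where R: "\<And>x. norm x \<ge> R \<Longrightarrow> w x = 0" "\<And>x. norm x \<ge> R \<Longrightarrow> grad w x = 0"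
    using C1_compact_radius[OF assms] by metis
  show "integrable lborel w" "integrable lborel (grad w)"
    using C1_compactD(3,4)[OF assms] R by (auto intro: integrable_continuous_compact)
qed

text \<open>By translation invariance every difference quotient has integral zero; let the step tend to zero.\<close>

lemma integral_grad_eq_0:
  fixes w :: "'a::euclidean_space \<Rightarrow> real"
  assumes w: "C1_compact w"
  shows "(LINT x|lborel. grad w x \<bullet> v) = 0"
proof -
  let ?q = "\<lambda>n x. real (Suc n) * (w (x + (1 / real (Suc n)) *\<^sub>R v) - w x)"
  obtain C R where q: "\<And>n x. \<bar>?q n x\<bar> \<le> C * indicator (cball 0 R) x" "\<And>x. (\<lambda>n. ?q n x) \<longlonglongrightarrow> grad w x \<bullet> v"
    "\<And>n. ?q n \<in> borel_measurable borel" using difference_quotient[OF w, of v] by blast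
  have [measurable]: "w \<in> borel_measurable borel" "grad w \<in> borel_measurable borel" using C1_compactD[OF w] by auto
  have "(\<lambda>n. LINT x|lborel. ?q n x) \<longlonglongrightarrow> (LINT x|lborel. grad w x \<bullet> v)"
  proof (rule integral_dominated_convergence)
    show "integrable lborel (\<lambda>x. C * indicator (cball 0 R) x)"
      by (intro integrable_mult_right integrable_real_indicator) (auto simp: emeasure_bounded_finite[unfolded infinity_ennreal_def])
  qed (use q in auto)
  moreover have "(LINT x|lborel. ?q n x) = 0" for n
    using C1_compact_integrable(1)[OF w] integral_lborel_shift[of w] integrable_lborel_shift[of w]
    by simp
  ultimately show ?thesis by (simp add: LIMSEQ_const_iff)
qed

lemma C1_compact_mult:
  assumes "C1_compact f" "C1_compact g"
  shows "C1_compact (\<lambda>x. f x * g x)" "grad (\<lambda>x. f x * g x) x = f x *\<^sub>R grad g x + g x *\<^sub>R grad f x"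
proof -
  have d: "((\<lambda>x. f x * g x) has_derivative (\<lambda>v. (f x *\<^sub>R grad g x + g x *\<^sub>R grad f x) \<bullet> v)) (at x)" for x
    using has_derivative_mult[OF C1_compactD(2)[OF assms(1), of x] C1_compactD(2)[OF assms(2), of x]]
    by (simp add: inner_add_left mult.commute)
  show g: "grad (\<lambda>x. f x * g x) x = f x *\<^sub>R grad g x + g x *\<^sub>R grad f x" for x by (rule grad_eqI[OF d])
  obtain R where R: "\<And>x. norm x \<ge> R \<Longrightarrow> f x = 0" "\<And>x. norm x \<ge> R \<Longrightarrow> grad f x = 0"
    using C1_compact_radius[OF assms(1)] by metis
  show "C1_compact (\<lambda>x. f x * g x)" unfolding C1_compact_def
  proof (intro conjI allI exI[of _ R] impI)
    show "(\<lambda>x. f x * g x) differentiable (at x)" for x using d by (rule differentiableI)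
    have "continuous_on UNIV (\<lambda>x. f x *\<^sub>R grad g x + g x *\<^sub>R grad f x)"
      using C1_compactD(3,4)[OF assms(1)] C1_compactD(3,4)[OF assms(2)] by (intro continuous_intros)
    also have "(\<lambda>x. f x *\<^sub>R grad g x + g x *\<^sub>R grad f x) = grad (\<lambda>x. f x * g x)" by (simp add: g fun_eq_iff)
    finally show "continuous_on UNIV (grad (\<lambda>x. f x * g x))" .
    show "f x * g x = 0" "grad (\<lambda>x. f x * g x) x = 0" if "R \<le> norm x" for x
      using R that by (auto simp: g)
  qed
qed

text \<open>Integration by parts: the gradient of the product of two test functions has integral zero.\<close>

lemma has_weak_grad_test_function:
  assumes \<Omega>: "open \<Omega>" and t: "test_function \<Omega> \<psi>"
  shows "has_weak_grad \<Omega> \<psi> (grad \<psi>)"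
  unfolding has_weak_grad_iff
proof (intro conjI allI impI ballI)
  have \<Omega>m: "\<Omega> \<in> sets lebesgue" using \<Omega> by simp
  note C1 = test_function_C1_compact[OF t]
  show "locally_integrable \<Omega> \<psi>" "locally_integrable \<Omega> (grad \<psi>)"
    unfolding locally_integrable_def
    by (intro allI impI integrable_lebesgue_on_subset C1_compact_integrable[OF C1]; simp add: compact_imp_closed)+
  fix \<phi> and i :: 'a assume \<phi>: "test_function \<Omega> \<phi>" and i: "i \<in> Basis"
  note C1' = test_function_C1_compact[OF \<phi>]
  note w = C1_compact_mult[OF C1 C1']
  have [measurable]: "\<phi> \<in> borel_measurable borel" "grad \<phi> \<in> borel_measurable borel"
    "\<psi> \<in> borel_measurable borel" "grad \<psi> \<in> borel_measurable borel"
    using C1_compactD[OF C1] C1_compactD[OF C1'] by auto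
  obtain R where R: "\<And>x. norm x \<ge> R \<Longrightarrow> \<phi> x = 0" "\<And>x. norm x \<ge> R \<Longrightarrow> grad \<phi> x = 0"
    using C1_compact_radius[OF C1'] by metis
  have i1: "integrable lborel (\<lambda>x. \<psi> x * (grad \<phi> x \<bullet> i))" and i2: "integrable lborel (\<lambda>x. (grad \<psi> x \<bullet> i) * \<phi> x)"
    using C1_compactD(3,4)[OF C1] C1_compactD(3,4)[OF C1'] R
    by (auto intro!: integrable_continuous_compact[where R=R] continuous_intros)
  have "(LINT x|lborel. \<psi> x * (grad \<phi> x \<bullet> i) + (grad \<psi> x \<bullet> i) * \<phi> x) = 0"
  proof -
    have "grad (\<lambda>x. \<psi> x * \<phi> x) x \<bullet> i = \<psi> x * (grad \<phi> x \<bullet> i) + (grad \<psi> x \<bullet> i) * \<phi> x" for x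
      unfolding w(2) by (simp add: inner_add_left)
    then show ?thesis using integral_grad_eq_0[OF w(1), of i] by (simp only:)
  qed
  then have "(LINT x|lborel. \<psi> x * (grad \<phi> x \<bullet> i)) = - (LINT x|lborel. (grad \<psi> x \<bullet> i) * \<phi> x)"
    using i1 i2 by simp
  then show "(LINT x|lebesgue_on \<Omega>. \<psi> x * (grad \<phi> x \<bullet> i)) = - (LINT x|lebesgue_on \<Omega>. (grad \<psi> x \<bullet> i) * \<phi> x)"
    using test_function_outside[OF \<phi>] \<Omega>m by (simp add: lebesgue_on_lborel(1))
qed

section \<open>Rellich compactness\<close>

lemma ennreal_le_add: "a \<le> b + c \<Longrightarrow> 0 \<le> b \<Longrightarrow> 0 \<le> c \<Longrightarrow> ennreal a \<le> ennreal b + ennreal c"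
  by (metis ennreal_leI ennreal_plus)

text \<open>The translation by \<open>v\<close> is split into \<open>n\<close> translations by
  \<open>v/n\<close>, which contribute equally by translation invariance. So the left-hand side is
  at most the \<open>L\<^sup>1\<close> norm of the difference quotient with step
  \<open>1/n\<close>, for every \<open>n\<close>.\<close>

lemma translation_estimate:
  fixes w :: "'a::euclidean_space \<Rightarrow> real" and v :: 'a
  assumes w: "C1_compact w"
  shows "(LINT x|lborel. \<bar>w (x + v) - w x\<bar>) \<le> norm v * (LINT x|lborel. norm (grad w x))"
proof -
  let ?q = "\<lambda>n x. real (Suc n) * (w (x + (1 / real (Suc n)) *\<^sub>R v) - w x)"
  obtain C R where q: "\<And>n x. \<bar>?q n x\<bar> \<le> C * indicator (cball 0 R) x" "\<And>x. (\<lambda>n. ?q n x) \<longlonglongrightarrow> grad w x \<bullet> v"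
    "\<And>n. ?q n \<in> borel_measurable borel" using difference_quotient[OF w, of v] by blast
  have [measurable]: "w \<in> borel_measurable borel" "grad w \<in> borel_measurable borel" using C1_compactD[OF w] by auto
  have wi: "integrable lborel w" "integrable lborel (grad w)" using C1_compact_integrable[OF w] by auto
  have sh: "integrable lborel (\<lambda>x. w (x + a))" for a using integrable_lborel_shift[OF _ wi(1)] by simp
  have "(\<lambda>n. LINT x|lborel. \<bar>?q n x\<bar>) \<longlonglongrightarrow> (LINT x|lborel. \<bar>grad w x \<bullet> v\<bar>)"
  proof (rule integral_dominated_convergence)
    show "integrable lborel (\<lambda>x. C * indicator (cball 0 R) x)"
      by (intro integrable_mult_right integrable_real_indicator) (auto simp: emeasure_bounded_finite[unfolded infinity_ennreal_def])
    show "AE x in lborel. (\<lambda>n. \<bar>?q n x\<bar>) \<longlonglongrightarrow> \<bar>grad w x \<bullet> v\<bar>" using q(2) by (intro AE_I2 tendsto_rabs)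
    show "AE x in lborel. norm \<bar>?q n x\<bar> \<le> C * indicator (cball 0 R) x" for n using q(1) by (intro AE_I2) simp
    show "(\<lambda>x. \<bar>?q n x\<bar>) \<in> borel_measurable lborel" for n using q(3)[of n] by simp
  qed simp
  moreover have "(LINT x|lborel. \<bar>w (x + v) - w x\<bar>) \<le> (LINT x|lborel. \<bar>?q n x\<bar>)" for n
  proof -
    define h where "h = (1 / real (Suc n)) *\<^sub>R v"
    have v: "v = real (Suc n) *\<^sub>R h" by (simp add: h_def)
    have "\<bar>w (x + real k *\<^sub>R h) - w x\<bar> \<le> (\<Sum>j<k. \<bar>w (x + real j *\<^sub>R h + h) - w (x + real j *\<^sub>R h)\<bar>)" for x k
    proof (induction k)
      case (Suc k)
      have e: "x + real (Suc k) *\<^sub>R h = x + real k *\<^sub>R h + h" by (simp add: algebra_simps)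
      show ?case unfolding e sum.lessThan_Suc using Suc by linarith
    qed simp
    then have "(LINT x|lborel. \<bar>w (x + v) - w x\<bar>) \<le> (LINT x|lborel. (\<Sum>j<Suc n. \<bar>w (x + real j *\<^sub>R h + h) - w (x + real j *\<^sub>R h)\<bar>))"
      unfolding v by (intro integral_mono Bochner_Integration.integrable_sum integrable_abs Bochner_Integration.integrable_diff wi sh)
         (simp_all only: add.assoc sh)
    also have "\<dots> = (\<Sum>j<Suc n. LINT x|lborel. \<bar>w (x + real j *\<^sub>R h + h) - w (x + real j *\<^sub>R h)\<bar>)"
      by (intro Bochner_Integration.integral_sum integrable_abs Bochner_Integration.integrable_diff sh)
         (simp only: add.assoc sh)
    also have "\<dots> = (\<Sum>j<Suc n. LINT x|lborel. \<bar>w (x + h) - w x\<bar>)"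
      by (intro sum.cong refl integral_lborel_shift[of "\<lambda>x. \<bar>w (x + h) - w x\<bar>"]) simp
    also have "\<dots> = (LINT x|lborel. \<bar>?q n x\<bar>)"
      by (simp add: abs_mult h_def)
    finally show ?thesis .
  qed
  ultimately have "(LINT x|lborel. \<bar>w (x + v) - w x\<bar>) \<le> (LINT x|lborel. \<bar>grad w x \<bullet> v\<bar>)"
    by (intro LIMSEQ_le_const) auto
  also have "\<dots> \<le> (LINT x|lborel. norm (grad w x) * norm v)"
    using wi Cauchy_Schwarz_ineq2 by (intro integral_mono) auto
  also have "\<dots> = norm v * (LINT x|lborel. norm (grad w x))" by simp
  finally show ?thesis .
qed

definition ball_mean :: "real \<Rightarrow> ('a::euclidean_space \<Rightarrow> real) \<Rightarrow> 'a \<Rightarrow> real" where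
  "ball_mean \<delta> w x = (LINT y|lborel. indicator (cball 0 \<delta>) y * w (x + y)) / measure lborel (cball (0::'a) \<delta>)"

context
  fixes w :: "'a::euclidean_space \<Rightarrow> real" and \<delta> :: real
  assumes w: "C1_compact w" and \<delta>: "\<delta> > 0"
begin

lemma ball_mean_pos: "measure lborel (cball (0::'a) \<delta>) > 0"
  using content_cball_pos[OF \<delta>] .

lemma shift_integrable: "integrable lborel (\<lambda>y. w (x + y))"
  using integrable_lborel_shift[OF C1_compactD(5)[OF w] C1_compact_integrable(1)[OF w], of x]
  by (simp add: add.commute)

lemma shift_integrable_on_cball: "integrable lborel (\<lambda>y. indicator (cball 0 \<delta>) y * w (x + y))"
  using integrable_mult_indicator[OF _ shift_integrable, of "cball 0 \<delta>" x] by simp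

text \<open>The ball means of \<open>w\<close> at two points differ by the mean of a translation difference,
  which the translation estimate controls.\<close>

lemma ball_mean_lipschitz:
  "\<bar>ball_mean \<delta> w x - ball_mean \<delta> w x'\<bar> \<le> norm (x - x') * ((LINT x|lborel. norm (grad w x)) / measure lborel (cball (0::'a) \<delta>))"
proof -
  have [measurable]: "w \<in> borel_measurable borel" using C1_compactD[OF w] by auto
  let ?m = "measure lborel (cball (0::'a) \<delta>)"
  have "\<bar>(LINT y|lborel. indicator (cball 0 \<delta>) y * w (x + y)) - (LINT y|lborel. indicator (cball 0 \<delta>) y * w (x' + y))\<bar>
     = \<bar>LINT y|lborel. indicator (cball 0 \<delta>) y * w (x + y) - indicator (cball 0 \<delta>) y * w (x' + y)\<bar>"
    using shift_integrable_on_cball by simp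
  also have "\<dots> \<le> (LINT y|lborel. \<bar>indicator (cball 0 \<delta>) y * w (x + y) - indicator (cball 0 \<delta>) y * w (x' + y)\<bar>)"
    by (rule integral_abs_bound)
  also have "\<dots> \<le> (LINT y|lborel. \<bar>w (x + y) - w (x' + y)\<bar>)"
    using shift_integrable_on_cball shift_integrable
    by (intro integral_mono) (auto simp: indicator_def)
  also have "\<dots> = (LINT y|lborel. \<bar>w ((y + x') + (x - x')) - w (y + x')\<bar>)" by (simp add: algebra_simps)
  also have "\<dots> = (LINT y|lborel. \<bar>w (y + (x - x')) - w y\<bar>)"
    by (rule integral_lborel_shift[of "\<lambda>y. \<bar>w (y + (x - x')) - w y\<bar>" x']) simp
  also have "\<dots> \<le> norm (x - x') * (LINT x|lborel. norm (grad w x))" by (rule translation_estimate[OF w])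
  finally show ?thesis
    using ball_mean_pos by (simp add: ball_mean_def diff_divide_distrib[symmetric] divide_right_mono)
qed

lemma ball_mean_bounded:
  "\<bar>ball_mean \<delta> w x\<bar> \<le> (LINT x|lborel. \<bar>w x\<bar>) / measure lborel (cball (0::'a) \<delta>)"
proof -
  have [measurable]: "w \<in> borel_measurable borel" using C1_compactD[OF w] by auto
  have "\<bar>LINT y|lborel. indicator (cball 0 \<delta>) y * w (x + y)\<bar> \<le> (LINT y|lborel. \<bar>indicator (cball 0 \<delta>) y * w (x + y)\<bar>)"
    by (rule integral_abs_bound)
  also have "\<dots> \<le> (LINT y|lborel. \<bar>w (x + y)\<bar>)"
    using shift_integrable_on_cball shift_integrable
    by (intro integral_mono) (auto simp: indicator_def)
  also have "\<dots> = (LINT y|lborel. \<bar>w y\<bar>)"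
    using integral_lborel_shift[of "\<lambda>y. \<bar>w y\<bar>" x] by (simp add: add.commute)
  finally show ?thesis using ball_mean_pos by (simp add: ball_mean_def divide_right_mono)
qed

lemma ball_mean_outside:
  assumes "\<And>x. norm x \<ge> R \<Longrightarrow> w x = 0" "norm x \<ge> R + \<delta>"
  shows "ball_mean \<delta> w x = 0"
proof -
  have "indicator (cball 0 \<delta>) y * w (x + y) = 0" for y :: 'a
  proof (cases "norm y \<le> \<delta>")
    case True
    then have "norm (x + y) \<ge> R" using norm_triangle_ineq4[of "x + y" y] assms(2) by simp
    then show ?thesis using assms(1) by simp
  qed simp
  then show ?thesis unfolding ball_mean_def by (simp only:) simp
qed

lemma ball_mean_continuous: "continuous_on UNIV (ball_mean \<delta> w)"
proof -
  define L where "L = (LINT x|lborel. norm (grad w x)) / measure lborel (cball (0::'a) \<delta>)"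
  have "L \<ge> 0" by (simp add: L_def)
  then have "L-lipschitz_on UNIV (ball_mean \<delta> w)"
    using ball_mean_lipschitz by (intro lipschitz_onI) (auto simp: dist_norm L_def mult.commute)
  then show ?thesis by (rule lipschitz_on_continuous_on)
qed

text \<open>The difference is the average of \<open>w(x) - w(x + y)\<close> over \<open>|y| \<le>
  \<delta>\<close>; integrate in \<open>x\<close> first and use the translation estimate for each
  \<open>y\<close>.\<close>

lemma ball_mean_close:
  "(\<integral>\<^sup>+x. ennreal \<bar>w x - ball_mean \<delta> w x\<bar> \<partial>lborel) \<le> ennreal (\<delta> * (LINT x|lborel. norm (grad w x)))"
proof -
  have [measurable]: "w \<in> borel_measurable borel" using C1_compactD[OF w] by auto
  let ?B = "cball (0::'a) \<delta>"
  define m where "m = measure lborel ?B"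
  have m: "m > 0" using ball_mean_pos by (simp add: m_def)
  have em: "emeasure lborel ?B = ennreal m"
    unfolding m_def by (intro emeasure_eq_ennreal_measure) (auto simp: emeasure_bounded_finite[THEN less_imp_neq, unfolded infinity_ennreal_def])
  define M where "M = (LINT x|lborel. norm (grad w x))"
  have M: "M \<ge> 0" by (simp add: M_def)
  have iB: "integrable lborel (\<lambda>y. indicator ?B y * c)" for c :: real
    by (intro integrable_mult_left integrable_real_indicator) (auto simp: em)
  have pt: "ennreal \<bar>w x - ball_mean \<delta> w x\<bar> \<le> ennreal (1 / m) * (\<integral>\<^sup>+y. indicator ?B y * ennreal \<bar>w (x + y) - w x\<bar> \<partial>lborel)" for x
  proof -
    have A: "(LINT y|lborel. indicator ?B y * w x - indicator ?B y * w (x + y)) = m * w x - (LINT y|lborel. indicator ?B y * w (x + y))"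
      by (subst Bochner_Integration.integral_diff[OF iB shift_integrable_on_cball]) (simp add: m_def)
    have "w x - ball_mean \<delta> w x = (1 / m) * (LINT y|lborel. indicator ?B y * w x - indicator ?B y * w (x + y))"
      unfolding A ball_mean_def m_def[symmetric] using m by (simp add: diff_divide_distrib)
    then have "\<bar>w x - ball_mean \<delta> w x\<bar> = (1 / m) * norm (LINT y|lborel. indicator ?B y * w x - indicator ?B y * w (x + y))"
      using m by (simp add: abs_mult)
    then have "ennreal \<bar>w x - ball_mean \<delta> w x\<bar> = ennreal (1 / m) * ennreal (norm (LINT y|lborel. indicator ?B y * w x - indicator ?B y * w (x + y)))"
      using m by (subst ennreal_mult[symmetric]) auto
    also have "\<dots> \<le> ennreal (1 / m) * (\<integral>\<^sup>+y. norm (indicator ?B y * w x - indicator ?B y * w (x + y)) \<partial>lborel)"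
      using shift_integrable_on_cball iB by (intro mult_left_mono integral_norm_bound_ennreal) auto
    also have "(\<integral>\<^sup>+y. norm (indicator ?B y * w x - indicator ?B y * w (x + y)) \<partial>lborel) = (\<integral>\<^sup>+y. indicator ?B y * ennreal \<bar>w (x + y) - w x\<bar> \<partial>lborel)"
      by (intro nn_integral_cong) (auto simp: indicator_def abs_minus_commute)
    finally show ?thesis .
  qed
  have meas: "(\<lambda>(x, y). indicator ?B y * ennreal \<bar>w (x + y) - w x\<bar>) \<in> borel_measurable (lborel \<Otimes>\<^sub>M lborel)"
  proof -
    have [measurable]: "?B \<in> sets borel" by simp
    have "(\<lambda>(x, y). indicator ?B y * ennreal \<bar>w (x + y) - w x\<bar>) \<in> borel_measurable (borel \<Otimes>\<^sub>M borel)"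
      by measurable
    then show ?thesis
      by (subst measurable_cong_sets[OF sets_pair_measure_cong[OF sets_lborel sets_lborel] refl])
  qed
  have "(\<integral>\<^sup>+x. ennreal \<bar>w x - ball_mean \<delta> w x\<bar> \<partial>lborel) \<le> (\<integral>\<^sup>+x. ennreal (1 / m) * (\<integral>\<^sup>+y. indicator ?B y * ennreal \<bar>w (x + y) - w x\<bar> \<partial>lborel) \<partial>lborel)"
    by (intro nn_integral_mono pt)
  also have "\<dots> = ennreal (1 / m) * (\<integral>\<^sup>+x. (\<integral>\<^sup>+y. indicator ?B y * ennreal \<bar>w (x + y) - w x\<bar> \<partial>lborel) \<partial>lborel)"
    by (intro nn_integral_cmult lborel.borel_measurable_nn_integral) (use meas in simp)
  also have "(\<integral>\<^sup>+x. (\<integral>\<^sup>+y. indicator ?B y * ennreal \<bar>w (x + y) - w x\<bar> \<partial>lborel) \<partial>lborel)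
     = (\<integral>\<^sup>+y. (\<integral>\<^sup>+x. indicator ?B y * ennreal \<bar>w (x + y) - w x\<bar> \<partial>lborel) \<partial>lborel)"
    using meas by (rule lborel_pair.Fubini'[symmetric])
  also have "\<dots> \<le> (\<integral>\<^sup>+y. ennreal (\<delta> * M) * indicator ?B y \<partial>lborel)"
  proof (rule nn_integral_mono)
    fix y :: 'a
    show "(\<integral>\<^sup>+x. indicator ?B y * ennreal \<bar>w (x + y) - w x\<bar> \<partial>lborel) \<le> ennreal (\<delta> * M) * indicator ?B y"
    proof (cases "norm y \<le> \<delta>")
      case True
      have "integrable lborel (\<lambda>x. \<bar>w (x + y) - w x\<bar>)"
        using integrable_lborel_shift[OF C1_compactD(5)[OF w] C1_compact_integrable(1)[OF w], of y] C1_compact_integrable(1)[OF w]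
        by simp
      then have "(\<integral>\<^sup>+x. ennreal \<bar>w (x + y) - w x\<bar> \<partial>lborel) = ennreal (LINT x|lborel. \<bar>w (x + y) - w x\<bar>)"
        by (simp add: nn_integral_eq_integral)
      also have "\<dots> \<le> ennreal (\<delta> * M)"
      proof (rule ennreal_leI)
        have "(LINT x|lborel. \<bar>w (x + y) - w x\<bar>) \<le> norm y * M" unfolding M_def by (rule translation_estimate[OF w])
        also have "\<dots> \<le> \<delta> * M" using True M by (rule mult_right_mono)
        finally show "(LINT x|lborel. \<bar>w (x + y) - w x\<bar>) \<le> \<delta> * M" .
      qed
      finally show ?thesis using True by (simp add: indicator_def)
    qed simp
  qed
  also have "(\<integral>\<^sup>+y. ennreal (\<delta> * M) * indicator ?B y \<partial>lborel) = ennreal (\<delta> * M) * ennreal m"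
    by (simp add: nn_integral_cmult_indicator em)
  also have "ennreal (1 / m) * (ennreal (\<delta> * M) * ennreal m) = ennreal (\<delta> * M)"
    using m M \<delta> by (simp add: ennreal_mult[symmetric])
  finally show ?thesis by (simp add: M_def mult_left_mono)
qed

end

text \<open>Bolzano-Weierstrass with a diagonal argument.\<close>

lemma diagonal_convergent_subsequence:
  fixes c :: "nat \<Rightarrow> nat \<Rightarrow> real"
  assumes "\<And>n. bounded (range (c n))"
  obtains r :: "nat \<Rightarrow> nat" where "strict_mono r" "\<And>n. convergent (\<lambda>i. c n (r i))"
proof -
  interpret subseqs "\<lambda>n s. convergent (\<lambda>i. c n (s i))"
  proof
    fix n and s :: "nat \<Rightarrow> nat" assume "strict_mono s"
    have "bounded (range (\<lambda>i. c n (s i)))" using assms[of n] by (rule bounded_subset) auto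
    from bounded_imp_convergent_subsequence[OF this]
    show "\<exists>r'. strict_mono r' \<and> convergent (\<lambda>i. c n ((s \<circ> r') i))"
      by (auto simp: convergent_def o_def)
  qed
  have "convergent (\<lambda>i. c n (diagseq i))" for n
  proof -
    have "convergent (\<lambda>i. c n ((diagseq \<circ> ((+) (Suc n))) i))"
    proof (rule diagseq_holds)
      fix r s :: "nat \<Rightarrow> nat" and n assume "strict_mono r" "convergent (\<lambda>i. c n (s i))"
      then show "convergent (\<lambda>i. c n ((s \<circ> r) i))"
        using convergent_subseq_convergent[of "\<lambda>i. c n (s i)" r] by (simp add: o_def)
    qed
    then have "convergent (\<lambda>i. c n (diagseq (i + Suc n)))" by (simp add: add.commute)
    then show ?thesis using convergent_ignore_initial_segment[of "\<lambda>i. c n (diagseq i)" "Suc n"] by simp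
  qed
  then show ?thesis using that subseq_diagseq by blast
qed

text \<open>For each radius \<open>1/k\<close> the ball means are uniformly bounded and uniformly Lipschitz. A
  diagonal subsequence makes them converge on a countable dense set, hence everywhere by
  equicontinuity, and in \<open>L\<^sup>1\<close> by dominated convergence. As the means are
  within \<open>M/k\<close> of the functions in \<open>L\<^sup>1\<close>, the subsequence is
  Cauchy.\<close>

lemma rellich_L1:
  fixes w :: "nat \<Rightarrow> 'a::euclidean_space \<Rightarrow> real"
  assumes w: "\<And>n. C1_compact (w n)" and R: "\<And>n x. norm x \<ge> R \<Longrightarrow> w n x = 0"
    and M: "\<And>n. (LINT x|lborel. \<bar>w n x\<bar>) \<le> M" "\<And>n. (LINT x|lborel. norm (grad (w n) x)) \<le> M"
  obtains r :: "nat \<Rightarrow> nat" where "strict_mono r"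
    "\<forall>e>0. \<exists>N. \<forall>i\<ge>N. \<forall>j\<ge>N. (LINT x|lborel. \<bar>w (r i) x - w (r j) x\<bar>) < e"
proof -
  have M0: "M \<ge> 0" using M(1)[of 0] by (rule order_trans[rotated]) simp
  obtain D :: "'a set" where D: "countable D" "\<And>X. open X \<Longrightarrow> X \<noteq> {} \<Longrightarrow> \<exists>d\<in>D. d \<in> X"
    using countable_dense_setE by metis
  have Dne: "D \<noteq> {}" using D(2)[of UNIV] by auto
  define d where "d = from_nat_into D"
  have d: "range d = D" unfolding d_def by (rule range_from_nat_into[OF Dne D(1)])
  define \<delta> where "\<delta> k = 1 / real (Suc k)" for k
  have \<delta>: "\<delta> k > 0" for k by (simp add: \<delta>_def)
  define m where "m k = measure lborel (cball (0::'a) (\<delta> k))" for k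
  have m: "m k > 0" for k unfolding m_def by (rule content_cball_pos[OF \<delta>])
  define c where "c n i = ball_mean (\<delta> (fst (prod_decode n))) (w i) (d (snd (prod_decode n)))" for n i
  have bm: "\<bar>ball_mean (\<delta> k) (w i) x\<bar> \<le> M / m k" for k i x
  proof -
    have "\<bar>ball_mean (\<delta> k) (w i) x\<bar> \<le> (LINT x|lborel. \<bar>w i x\<bar>) / m k"
      unfolding m_def by (rule ball_mean_bounded[OF w \<delta>])
    also have "\<dots> \<le> M / m k" using M(1) m[of k] by (intro divide_right_mono) auto
    finally show ?thesis .
  qed
  have "bounded (range (c n))" for n
    unfolding bounded_iff using bm by (auto simp: c_def)
  then obtain r where r: "strict_mono r" "\<And>n. convergent (\<lambda>i. c n (r i))"
    using diagonal_convergent_subsequence by metis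
  have convD: "Cauchy (\<lambda>i. ball_mean (\<delta> k) (w (r i)) (d j))" for k j
    using r(2)[of "prod_encode (k, j)"] by (simp add: c_def convergent_Cauchy)
  have conv: "convergent (\<lambda>i. ball_mean (\<delta> k) (w (r i)) x)" for k x
  proof (rule Cauchy_convergent, rule metric_CauchyI)
    fix e :: real assume e: "e > 0"
    \<comment> \<open>\<open>M / m k\<close> is a Lipschitz constant of all ball means with radius \<open>\<delta> k\<close>\<close>
    define \<eta> where "\<eta> = e / (4 * (M / m k + 1))"
    have Mm: "M / m k \<ge> 0" using M0 m[of k] by simp
    then have \<eta>: "\<eta> > 0" using e by (simp add: \<eta>_def)
    obtain y where "y \<in> D" "y \<in> ball x \<eta>" using D(2)[of "ball x \<eta>"] \<eta> by auto
    then obtain j where j: "dist x (d j) < \<eta>" using d by (auto simp: image_iff)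
    have close: "\<bar>ball_mean (\<delta> k) (w i) x - ball_mean (\<delta> k) (w i) (d j)\<bar> \<le> e / 4" for i
    proof -
      have "\<bar>ball_mean (\<delta> k) (w i) x - ball_mean (\<delta> k) (w i) (d j)\<bar> \<le> norm (x - d j) * ((LINT x|lborel. norm (grad (w i) x)) / m k)"
        unfolding m_def by (rule ball_mean_lipschitz[OF w \<delta>])
      also have "\<dots> \<le> \<eta> * (M / m k)"
        using j M(2)[of i] m[of k] \<eta> by (intro mult_mono divide_right_mono) (auto simp: dist_norm)
      also have "\<dots> \<le> \<eta> * (M / m k + 1)" using \<eta> by (intro mult_left_mono) auto
      also have "\<dots> = e / 4"
      proof -
        have "e / (4 * (t + 1)) * (t + 1) = e / 4" if "t \<ge> 0" for t :: real
          using that by (simp add: divide_simps)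
        from this[OF Mm] show ?thesis by (simp only: \<eta>_def)
      qed
      finally show ?thesis .
    qed
    obtain N where N: "\<And>i i'. i \<ge> N \<Longrightarrow> i' \<ge> N \<Longrightarrow> dist (ball_mean (\<delta> k) (w (r i)) (d j)) (ball_mean (\<delta> k) (w (r i')) (d j)) < e / 4"
      using metric_CauchyD[OF convD[of k j], of "e / 4"] e by auto
    show "\<exists>N. \<forall>i\<ge>N. \<forall>i'\<ge>N. dist (ball_mean (\<delta> k) (w (r i)) x) (ball_mean (\<delta> k) (w (r i')) x) < e"
    proof (intro exI allI impI)
      fix i i' assume "N \<le> i" "N \<le> i'"
      from N[OF this] close[of "r i"] close[of "r i'"] e
      show "dist (ball_mean (\<delta> k) (w (r i)) x) (ball_mean (\<delta> k) (w (r i')) x) < e"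
        unfolding dist_real_def by linarith
    qed
  qed
  have L1: "\<exists>N. \<forall>i\<ge>N. (\<integral>\<^sup>+x. ennreal \<bar>ball_mean (\<delta> k) (w (r i)) x - lim (\<lambda>i. ball_mean (\<delta> k) (w (r i)) x)\<bar> \<partial>lborel) < ennreal e"
    if e: "e > 0" for k and e :: real
  proof -
    define L where "L x = lim (\<lambda>i. ball_mean (\<delta> k) (w (r i)) x)" for x
    have lim: "(\<lambda>i. ball_mean (\<delta> k) (w (r i)) x) \<longlonglongrightarrow> L x" for x
      unfolding L_def using conv by (simp add: convergent_LIMSEQ_iff)
    have [measurable]: "ball_mean (\<delta> k) (w i) \<in> borel_measurable borel" for i
      by (intro borel_measurable_continuous_onI ball_mean_continuous[OF w \<delta>])
    have [measurable]: "L \<in> borel_measurable borel"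
      by (rule borel_measurable_LIMSEQ_real[OF lim]) simp
    let ?f = "\<lambda>i x. \<bar>ball_mean (\<delta> k) (w (r i)) x - L x\<bar>"
    let ?g = "\<lambda>x. 2 * (M / m k) * indicator (cball (0::'a) (R + \<delta> k)) x"
    have bnd: "?f i x \<le> ?g x" for i x
    proof (cases "norm x \<le> R + \<delta> k")
      case True
      have "\<bar>L x\<bar> \<le> M / m k"
        using bm by (intro LIMSEQ_le_const2[OF tendsto_rabs[OF lim]]) auto
      then show ?thesis using bm[of k "r i" x] True by (simp add: indicator_def)
    next
      case False
      then have z: "ball_mean (\<delta> k) (w (r i)) x = 0" for i
        by (intro ball_mean_outside[OF w \<delta> R]) auto
      have "L x = 0" unfolding L_def z by simp
      then show ?thesis using z False by (simp add: indicator_def)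
    qed
    have gi: "integrable lborel ?g"
      by (intro integrable_mult_right integrable_real_indicator) (auto simp: emeasure_bounded_finite[unfolded infinity_ennreal_def])
    have "(\<lambda>i. LINT x|lborel. ?f i x) \<longlonglongrightarrow> (LINT x|(lborel::'a measure). (0::real))"
    proof (rule integral_dominated_convergence[where w="?g"])
      show "integrable lborel ?g" by (rule gi)
      show "AE x in lborel. (\<lambda>i. ?f i x) \<longlonglongrightarrow> 0"
        using lim by (intro AE_I2 tendsto_rabs_zero) (simp add: LIM_zero_iff)
      show "AE x in lborel. norm (?f i x) \<le> ?g x" for i using bnd by (intro AE_I2) simp
    qed simp_all
    then have "eventually (\<lambda>i. (LINT x|lborel. ?f i x) < e) sequentially"
      using e by (intro order_tendstoD(2)) auto
    moreover have "(\<integral>\<^sup>+x. ennreal (?f i x) \<partial>lborel) = ennreal (LINT x|lborel. ?f i x)" for i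
    proof (rule nn_integral_eq_integral)
      show "integrable lborel (?f i)"
      proof (rule Bochner_Integration.integrable_bound[OF gi])
        show "AE x in lborel. norm (?f i x) \<le> norm (?g x)"
        proof (rule AE_I2)
          fix x
          show "norm (?f i x) \<le> norm (?g x)"
            using bnd[of i x] abs_ge_self[of "?g x"] unfolding real_norm_def abs_idempotent by linarith
        qed
      qed simp
    qed simp
    ultimately show ?thesis unfolding L_def[symmetric] eventually_sequentially
      using e by (metis ennreal_lessI)
  qed
  have wi: "integrable lborel (\<lambda>x. \<bar>w i x - w j x\<bar>)" for i j
    using C1_compact_integrable(1)[OF w] by simp
  show ?thesis
  proof (rule that[OF r(1)], intro allI impI)
    fix e :: real assume e: "e > 0"
    obtain k where k: "\<delta> k * M < e / 8"
    proof -
      obtain k where "real k > 8 * M / e" using reals_Archimedean2 by blast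
      then have "M * 8 < e * real (Suc k)" using e by (simp add: field_simps)
      then have "\<delta> k * M < e / 8" by (simp add: \<delta>_def field_simps)
      then show ?thesis by (rule that)
    qed
    define L where "L x = lim (\<lambda>i. ball_mean (\<delta> k) (w (r i)) x)" for x
    have lim: "(\<lambda>i. ball_mean (\<delta> k) (w (r i)) x) \<longlonglongrightarrow> L x" for x
      unfolding L_def using conv by (simp add: convergent_LIMSEQ_iff)
    have [measurable]: "w i \<in> borel_measurable borel" for i using C1_compactD[OF w] by auto
    have [measurable]: "ball_mean (\<delta> k) (w i) \<in> borel_measurable borel" for i
      by (intro borel_measurable_continuous_onI ball_mean_continuous[OF w \<delta>])
    have [measurable]: "L \<in> borel_measurable borel"
      by (rule borel_measurable_LIMSEQ_real[OF lim]) simp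
    obtain N where N: "\<And>i. i \<ge> N \<Longrightarrow> (\<integral>\<^sup>+x. ennreal \<bar>ball_mean (\<delta> k) (w (r i)) x - L x\<bar> \<partial>lborel) < ennreal (e / 8)"
      using L1[of "e / 8" k] e unfolding L_def[symmetric] by auto
    have half: "(\<integral>\<^sup>+x. ennreal \<bar>w (r i) x - L x\<bar> \<partial>lborel) \<le> ennreal (e / 4)" if "i \<ge> N" for i
    proof -
      have "(\<integral>\<^sup>+x. ennreal \<bar>w (r i) x - L x\<bar> \<partial>lborel) \<le>
        (\<integral>\<^sup>+x. ennreal \<bar>w (r i) x - ball_mean (\<delta> k) (w (r i)) x\<bar> + ennreal \<bar>ball_mean (\<delta> k) (w (r i)) x - L x\<bar> \<partial>lborel)"
        by (intro nn_integral_mono) (rule ennreal_le_add; linarith)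
      also have "\<dots> = (\<integral>\<^sup>+x. ennreal \<bar>w (r i) x - ball_mean (\<delta> k) (w (r i)) x\<bar> \<partial>lborel) + (\<integral>\<^sup>+x. ennreal \<bar>ball_mean (\<delta> k) (w (r i)) x - L x\<bar> \<partial>lborel)"
        by (intro nn_integral_add) measurable
      also have "\<dots> \<le> ennreal (e / 8) + ennreal (e / 8)"
      proof (rule add_mono)
        have "(\<integral>\<^sup>+x. ennreal \<bar>w (r i) x - ball_mean (\<delta> k) (w (r i)) x\<bar> \<partial>lborel) \<le> ennreal (\<delta> k * (LINT x|lborel. norm (grad (w (r i)) x)))"
          by (rule ball_mean_close[OF w \<delta>])
        also have "\<dots> \<le> ennreal (e / 8)"
          using k mult_left_mono[OF M(2)[of "r i"], of "\<delta> k"] \<delta>[of k] by (intro ennreal_leI) linarith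
        finally show "(\<integral>\<^sup>+x. ennreal \<bar>w (r i) x - ball_mean (\<delta> k) (w (r i)) x\<bar> \<partial>lborel) \<le> ennreal (e / 8)" .
      qed (rule less_imp_le[OF N[OF that]])
      also have "\<dots> = ennreal (e / 4)" using e by (simp flip: ennreal_plus)
      finally show ?thesis .
    qed
    have "(LINT x|lborel. \<bar>w (r i) x - w (r j) x\<bar>) < e" if "i \<ge> N" "j \<ge> N" for i j
    proof -
      have "ennreal (LINT x|lborel. \<bar>w (r i) x - w (r j) x\<bar>) = (\<integral>\<^sup>+x. ennreal \<bar>w (r i) x - w (r j) x\<bar> \<partial>lborel)"
        using wi by (simp add: nn_integral_eq_integral)
      also have "\<dots> \<le> (\<integral>\<^sup>+x. ennreal \<bar>w (r i) x - L x\<bar> + ennreal \<bar>w (r j) x - L x\<bar> \<partial>lborel)"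
        by (intro nn_integral_mono) (rule ennreal_le_add; linarith)
      also have "\<dots> = (\<integral>\<^sup>+x. ennreal \<bar>w (r i) x - L x\<bar> \<partial>lborel) + (\<integral>\<^sup>+x. ennreal \<bar>w (r j) x - L x\<bar> \<partial>lborel)"
        by (intro nn_integral_add) measurable
      also have "\<dots> \<le> ennreal (e / 4) + ennreal (e / 4)"
        using half[OF that(1)] half[OF that(2)] by (rule add_mono)
      also have "\<dots> = ennreal (e / 2)" using e by (simp flip: ennreal_plus)
      finally have "(LINT x|lborel. \<bar>w (r i) x - w (r j) x\<bar>) \<le> e / 2" using e by (simp add: ennreal_le_iff)
      then show ?thesis using e by simp
    qed
    then show "\<exists>N. \<forall>i\<ge>N. \<forall>j\<ge>N. (LINT x|lborel. \<bar>w (r i) x - w (r j) x\<bar>) < e" by blast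
  qed
qed

section \<open>The Sobolev space with zero boundary values\<close>

text \<open>Completeness of Lebesgue measure.\<close>

lemma borel_measurable_lebesgue_on_AE:
  fixes f g :: "'a::euclidean_space \<Rightarrow> 'b::euclidean_space"
  assumes f: "f \<in> borel_measurable (lebesgue_on \<Omega>)" and ae: "AE x in lebesgue_on \<Omega>. f x = g x"
    and \<Omega>: "\<Omega> \<in> sets lebesgue"
  shows "g \<in> borel_measurable (lebesgue_on \<Omega>)"
proof -
  have "AE x in lebesgue. x \<in> \<Omega> \<longrightarrow> f x = g x"
    using ae \<Omega> by (simp add: AE_restrict_space_iff)
  show ?thesis
  proof (rule borel_measurableI)
    fix S :: "'b set" assume "open S"
    then have "f -` S \<inter> space (lebesgue_on \<Omega>) \<in> sets (lebesgue_on \<Omega>)"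
      using f by (intro measurable_sets) auto
    then have A: "f -` S \<inter> \<Omega> \<in> sets lebesgue" using \<Omega>
      by (simp add: sets_restrict_space_iff)
    have ae':  "AE x in lebesgue. x \<in> f -` S \<inter> \<Omega> \<longleftrightarrow> x \<in> g -` S \<inter> \<Omega>"
      using \<open>AE x in lebesgue. x \<in> \<Omega> \<longrightarrow> f x = g x\<close> by eventually_elim auto
    have "g -` S \<inter> \<Omega> \<in> sets lebesgue"
      by (rule completion.in_sets_AE[OF ae' A]) simp
    then show "g -` S \<inter> space (lebesgue_on \<Omega>) \<in> sets (lebesgue_on \<Omega>)"
      using \<Omega> by (simp add: sets_restrict_space_iff)
  qed
qed

lemma test_function_lincomb:
  assumes "test_function \<Omega> \<phi>" "test_function \<Omega> \<psi>"
  shows "test_function \<Omega> (\<lambda>x. a * \<phi> x + b * \<psi> x)"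
    "grad (\<lambda>x. a * \<phi> x + b * \<psi> x) x = a *\<^sub>R grad \<phi> x + b *\<^sub>R grad \<psi> x"
proof -
  let ?f = "\<lambda>x. a * \<phi> x + b * \<psi> x"
  have "smooth ?f" using assms unfolding test_function_def smooth_def
    by (intro allI k_smooth_add k_smooth_mult k_smooth_const) auto
  moreover have "{x. ?f x \<noteq> 0} \<subseteq> closure {x. \<phi> x \<noteq> 0} \<union> closure {x. \<psi> x \<noteq> 0}"
  proof
    fix x assume "x \<in> {x. ?f x \<noteq> 0}"
    then have "x \<in> {x. \<phi> x \<noteq> 0} \<or> x \<in> {x. \<psi> x \<noteq> 0}" by auto
    then show "x \<in> closure {x. \<phi> x \<noteq> 0} \<union> closure {x. \<psi> x \<noteq> 0}"
    proof (elim disjE)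
      assume "x \<in> {x. \<phi> x \<noteq> 0}"
      from subsetD[OF closure_subset this] show ?thesis by (rule UnI1)
    next
      assume "x \<in> {x. \<psi> x \<noteq> 0}"
      from subsetD[OF closure_subset this] show ?thesis by (rule UnI2)
    qed
  qed
  then have c: "closure {x. ?f x \<noteq> 0} \<subseteq> closure {x. \<phi> x \<noteq> 0} \<union> closure {x. \<psi> x \<noteq> 0}"
    by (intro closure_minimal closed_Un closed_closure)
  moreover have K: "compact (closure {x. \<phi> x \<noteq> 0} \<union> closure {x. \<psi> x \<noteq> 0})"
    using assms unfolding test_function_def by (intro compact_Un) blast+
  have "closure {x. \<phi> x \<noteq> 0} \<union> closure {x. \<psi> x \<noteq> 0} \<subseteq> \<Omega>"
    using assms unfolding test_function_def by blast
  moreover have "compact (closure {x. ?f x \<noteq> 0})"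
    using compact_Int_closed[OF K closed_closure, of "{x. ?f x \<noteq> 0}"] c by (simp only: Int_absorb1)
  ultimately show "test_function \<Omega> ?f" unfolding test_function_def by blast
  have "(?f has_derivative (\<lambda>v. (a *\<^sub>R grad \<phi> x + b *\<^sub>R grad \<psi> x) \<bullet> v)) (at x)"
    using has_derivative_add[OF has_derivative_mult_right[OF C1_compactD(2)[OF test_function_C1_compact[OF assms(1)]], of a x]
        has_derivative_mult_right[OF C1_compactD(2)[OF test_function_C1_compact[OF assms(2)]], of b x]]
    by (simp add: inner_add_left)
  then show "grad ?f x = a *\<^sub>R grad \<phi> x + b *\<^sub>R grad \<psi> x" by (rule grad_eqI)
qed

locale sobolev_space =
  fixes \<Omega> :: "'a::euclidean_space set" and p :: real
  assumes open_dom: "open \<Omega>" and bounded_dom: "bounded \<Omega>" and p: "1 < p" "p < real DIM('a)"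
begin

abbreviation "M \<equiv> lebesgue_on \<Omega>"

lemma dom_sets: "\<Omega> \<in> sets lebesgue" using open_dom by simp

sublocale finite_measure M
proof -
  have "\<Omega> \<in> lmeasurable" by (rule lmeasurable_open[OF bounded_dom open_dom])
  then show "finite_measure M" by (rule finite_measure_lebesgue_on)
qed

lemma test_function_p:
  assumes "test_function \<Omega> \<phi>"
  shows "p_int M p \<phi>" "p_int M p (grad \<phi>)"
    "p_mass M p \<phi> = (LINT x|lborel. \<bar>\<phi> x\<bar> powr p)" "p_mass M p (grad \<phi>) = (LINT x|lborel. norm (grad \<phi> x) powr p)"
    "(LINT x|M. \<bar>\<phi> x\<bar>) = (LINT x|lborel. \<bar>\<phi> x\<bar>)" "(LINT x|M. norm (grad \<phi> x)) = (LINT x|lborel. norm (grad \<phi> x))"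
proof -
  note C1 = test_function_C1_compact[OF assms]
  note out = test_function_outside[OF assms]
  have [measurable]: "\<phi> \<in> borel_measurable borel" "grad \<phi> \<in> borel_measurable borel" using C1_compactD[OF C1] by auto
  obtain R where R: "\<And>x. norm x \<ge> R \<Longrightarrow> \<phi> x = 0" "\<And>x. norm x \<ge> R \<Longrightarrow> grad \<phi> x = 0"
    using C1_compact_radius[OF C1] by metis
  have 1: "integrable lborel (\<lambda>x. norm (\<phi> x) powr p)" "integrable lborel (\<lambda>x. norm (grad \<phi> x) powr p)"
    using C1_compactD(3,4)[OF C1] R p
    by (intro integrable_continuous_compact[where R=R] continuous_intros continuous_on_powr'; simp)+
  note L = lebesgue_on_lborel[OF _ _ dom_sets]
  show "p_int M p \<phi>" unfolding p_int_def
    using 1(1) L(2)[of "\<lambda>x. norm (\<phi> x) powr p"] L(3)[of \<phi>] out by simp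
  show "p_int M p (grad \<phi>)" unfolding p_int_def
    using 1(2) L(2)[of "\<lambda>x. norm (grad \<phi> x) powr p"] L(3)[of "grad \<phi>"] out by simp
  show "p_mass M p \<phi> = (LINT x|lborel. \<bar>\<phi> x\<bar> powr p)" unfolding p_mass_def
    using L(1)[of "\<lambda>x. norm (\<phi> x) powr p"] out by simp
  show "p_mass M p (grad \<phi>) = (LINT x|lborel. norm (grad \<phi> x) powr p)" unfolding p_mass_def
    using L(1)[of "\<lambda>x. norm (grad \<phi> x) powr p"] out by simp
  show "(LINT x|M. \<bar>\<phi> x\<bar>) = (LINT x|lborel. \<bar>\<phi> x\<bar>)"
    using L(1)[of "\<lambda>x. \<bar>\<phi> x\<bar>"] out by simp
  show "(LINT x|M. norm (grad \<phi> x)) = (LINT x|lborel. norm (grad \<phi> x))"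
    using L(1)[of "\<lambda>x. norm (grad \<phi> x)"] out by simp
qed

text \<open>The closure of the pairs \<open>(\<phi>, \<nabla>\<phi>)\<close>. Keeping the gradient as a second
  component makes linearity and limits independent of the choice operator in
  \<open>weak_grad\<close>; \<open>W0_imp_W1_0\<close> and \<open>W1_0_imp_W0\<close> translate
  between the two descriptions.\<close>

definition W0 :: "('a \<Rightarrow> real) \<Rightarrow> ('a \<Rightarrow> 'a) \<Rightarrow> bool" where
  "W0 v G \<longleftrightarrow> p_int M p v \<and> p_int M p G \<and>
    (\<forall>\<epsilon>>0. \<exists>\<phi>. test_function \<Omega> \<phi> \<and> p_mass M p (\<lambda>x. v x - \<phi> x) < \<epsilon> \<and> p_mass M p (\<lambda>x. G x - grad \<phi> x) < \<epsilon>)"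

lemma W0_p_int: "W0 v G \<Longrightarrow> p_int M p v" "W0 v G \<Longrightarrow> p_int M p G"
  by (auto simp: W0_def)

lemma W0_approx:
  assumes "W0 v G" "\<epsilon> > 0"
  obtains \<phi> where "test_function \<Omega> \<phi>" "p_mass M p (\<lambda>x. v x - \<phi> x) < \<epsilon>" "p_mass M p (\<lambda>x. G x - grad \<phi> x) < \<epsilon>"
  using assms unfolding W0_def by blast

lemma p_int_locally_integrable:
  fixes g :: "'a \<Rightarrow> 'b::euclidean_space"
  assumes "p_int M p g" shows "locally_integrable \<Omega> g"
  unfolding locally_integrable_def
proof (intro allI impI, elim conjE)
  fix K assume K: "compact K" "K \<subseteq> \<Omega>"
  have Km: "K \<in> sets lebesgue" using K(1) by (simp add: compact_imp_closed)
  have "integrable lebesgue (\<lambda>x. indicator \<Omega> x *\<^sub>R g x)"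
    using p_int_imp_integrable[OF p(1) assms] dom_sets by (simp add: integrable_restrict_space)
  from integrable_mult_indicator[OF Km this]
  have "integrable lebesgue (\<lambda>x. indicator K x *\<^sub>R indicator \<Omega> x *\<^sub>R g x)" .
  also have "(\<lambda>x. indicator K x *\<^sub>R indicator \<Omega> x *\<^sub>R g x) = (\<lambda>x. indicator K x *\<^sub>R g x)"
    using K(2) by (auto simp: indicator_def fun_eq_iff)
  finally show "integrable (lebesgue_on K) g" using Km by (simp add: integrable_restrict_space)
qed

lemma abs_integral_mult_le:
  fixes g :: "'a \<Rightarrow> 'b::euclidean_space"
  assumes g: "p_int M p g" and f: "integrable M (\<lambda>x. f x :: real)" and C: "\<And>x. \<bar>f x\<bar> \<le> norm (g x) * C"
  shows "\<bar>LINT x|M. f x\<bar> \<le> C * (LINT x|M. norm (g x))"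
proof -
  have "\<bar>LINT x|M. f x\<bar> \<le> (LINT x|M. \<bar>f x\<bar>)" by (rule integral_abs_bound)
  also have "\<dots> \<le> (LINT x|M. norm (g x) * C)"
    using p_int_imp_integrable[OF p(1) g] f C by (intro integral_mono) auto
  also have "\<dots> = C * (LINT x|M. norm (g x))" by simp
  finally show ?thesis .
qed

text \<open>The defect in the integration by parts formula is continuous with respect to
  \<open>L\<^sup>1\<close> convergence of the function and its gradient, and vanishes for test
  functions.\<close>

lemma W0_has_weak_grad:
  assumes "W0 v G" shows "has_weak_grad \<Omega> v G"
  unfolding has_weak_grad_iff
proof (intro conjI allI impI ballI)
  note vG = W0_p_int[OF assms]
  show lv: "locally_integrable \<Omega> v" and lG: "locally_integrable \<Omega> G"
    using vG by (auto intro: p_int_locally_integrable)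
  fix \<psi> and i :: 'a assume \<psi>: "test_function \<Omega> \<psi>" and i: "i \<in> Basis"
  obtain C where C: "C > 0" "\<And>x. \<bar>\<psi> x\<bar> \<le> C" "\<And>x. norm (grad \<psi> x) \<le> C"
    using C1_compact_bounded[OF test_function_C1_compact[OF \<psi>]] by metis
  note ip = integrable_test_mult[OF dom_sets \<psi>]
  define I where "I = (LINT x|M. v x * (grad \<psi> x \<bullet> i)) + (LINT x|M. (G x \<bullet> i) * \<psi> x)"
  have small: "\<bar>I\<bar> \<le> 2 * C * e" if e: "e > 0" for e
  proof -
    obtain \<delta>1 where \<delta>1: "\<delta>1 > 0" "\<And>g :: 'a \<Rightarrow> real. p_int M p g \<Longrightarrow> p_mass M p g < \<delta>1 \<Longrightarrow> (LINT x|M. norm (g x)) < e"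
      using integral_norm_small[OF p(1) e] by metis
    obtain \<delta>2 where \<delta>2: "\<delta>2 > 0" "\<And>g :: 'a \<Rightarrow> 'a. p_int M p g \<Longrightarrow> p_mass M p g < \<delta>2 \<Longrightarrow> (LINT x|M. norm (g x)) < e"
      using integral_norm_small[OF p(1) e] by metis
    obtain \<phi> where \<phi>: "test_function \<Omega> \<phi>" "p_mass M p (\<lambda>x. v x - \<phi> x) < min \<delta>1 \<delta>2" "p_mass M p (\<lambda>x. G x - grad \<phi> x) < min \<delta>1 \<delta>2"
      using W0_approx[OF assms, of "min \<delta>1 \<delta>2"] \<delta>1(1) \<delta>2(1) by auto
    note t = test_function_p[OF \<phi>(1)]
    note d1 = p_int_diff(1)[OF p(1) vG(1) t(1)] and d2 = p_int_diff(1)[OF p(1) vG(2) t(2)]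
    note l1 = p_int_locally_integrable[OF d1] and l2 = p_int_locally_integrable[OF d2]
    have "\<bar>LINT x|M. (v x - \<phi> x) * (grad \<psi> x \<bullet> i)\<bar> \<le> C * (LINT x|M. norm (v x - \<phi> x))"
    proof (rule abs_integral_mult_le[OF d1 ip(2)[OF l1 i]])
      show "\<bar>(v x - \<phi> x) * (grad \<psi> x \<bullet> i)\<bar> \<le> norm (v x - \<phi> x) * C" for x
        unfolding abs_mult real_norm_def using C(3)[of x] Basis_le_norm[OF i, of "grad \<psi> x"] by (intro mult_left_mono) auto
    qed
    also have "\<dots> \<le> C * e" using \<delta>1(2)[OF d1] \<phi>(2) C by (intro mult_left_mono) auto
    finally have 1: "\<bar>LINT x|M. (v x - \<phi> x) * (grad \<psi> x \<bullet> i)\<bar> \<le> C * e" .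
    have "\<bar>LINT x|M. ((G x - grad \<phi> x) \<bullet> i) * \<psi> x\<bar> \<le> C * (LINT x|M. norm (G x - grad \<phi> x))"
    proof (rule abs_integral_mult_le[OF d2 ip(3)[OF l2]])
      show "\<bar>((G x - grad \<phi> x) \<bullet> i) * \<psi> x\<bar> \<le> norm (G x - grad \<phi> x) * C" for x
        unfolding abs_mult using C(2)[of x] Basis_le_norm[OF i, of "G x - grad \<phi> x"] by (intro mult_mono) auto
    qed
    also have "\<dots> \<le> C * e" using \<delta>2(2)[OF d2] \<phi>(3) C by (intro mult_left_mono) auto
    finally have 2: "\<bar>LINT x|M. ((G x - grad \<phi> x) \<bullet> i) * \<psi> x\<bar> \<le> C * e" .
    note h = has_weak_grad_test_function[OF open_dom \<phi>(1), unfolded has_weak_grad_iff]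
    have eq: "(LINT x|M. \<phi> x * (grad \<psi> x \<bullet> i)) = - (LINT x|M. (grad \<phi> x \<bullet> i) * \<psi> x)" using h \<psi> i by blast
    have a: "(LINT x|M. (v x - \<phi> x) * (grad \<psi> x \<bullet> i)) = (LINT x|M. v x * (grad \<psi> x \<bullet> i)) - (LINT x|M. \<phi> x * (grad \<psi> x \<bullet> i))"
      unfolding left_diff_distrib using h by (intro Bochner_Integration.integral_diff ip(2)[OF lv i] ip(2)[OF _ i]) blast
    have b: "(LINT x|M. ((G x - grad \<phi> x) \<bullet> i) * \<psi> x) = (LINT x|M. (G x \<bullet> i) * \<psi> x) - (LINT x|M. (grad \<phi> x \<bullet> i) * \<psi> x)"
      unfolding inner_diff_left left_diff_distrib using h by (intro Bochner_Integration.integral_diff ip(3)[OF lG] ip(3)) blast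
    show ?thesis using 1 2 eq unfolding a b I_def by linarith
  qed
  have "\<bar>I\<bar> \<le> 0"
  proof (rule field_le_epsilon)
    fix e :: real assume "e > 0"
    then show "\<bar>I\<bar> \<le> 0 + e" using small[of "e / (2 * C)"] C by simp
  qed
  then show "(LINT x|M. v x * (grad \<psi> x \<bullet> i)) = - (LINT x|M. (G x \<bullet> i) * \<psi> x)" by (simp add: I_def)
qed

lemma weak_grad_AE_eq:
  assumes "has_weak_grad \<Omega> v G" shows "AE x in M. G x = weak_grad \<Omega> v x"
proof -
  have "has_weak_grad \<Omega> v (weak_grad \<Omega> v)" unfolding weak_grad_def
    by (rule someI[where P = "has_weak_grad \<Omega> v", OF assms])
  then show ?thesis by (rule has_weak_grad_unique[OF open_dom assms])
qed

lemma weak_grad_measurable: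
  assumes "has_weak_grad \<Omega> v G" "G \<in> borel_measurable M" shows "weak_grad \<Omega> v \<in> borel_measurable M"
  using assms(2) weak_grad_AE_eq[OF assms(1)] dom_sets by (rule borel_measurable_lebesgue_on_AE)

text \<open>The norm is defined through a chosen weak gradient; by uniqueness any weak gradient gives the same
  value.\<close>

lemma W1_norm_eq:
  assumes "has_weak_grad \<Omega> v G" "G \<in> borel_measurable M"
  shows "W1_norm \<Omega> p v = p_mass M p v powr (1/p) + p_mass M p G powr (1/p)"
proof -
  have "(LINT x|M. norm (weak_grad \<Omega> v x) powr p) = p_mass M p G"
    unfolding p_mass_def using weak_grad_AE_eq[OF assms(1)] weak_grad_measurable[OF assms] assms(2)
    by (intro integral_cong_AE) auto
  then show ?thesis by (simp add: W1_norm_def Lp_norm_def p_mass_def)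
qed

lemma Lp_iff: "g \<in> Lp \<Omega> q \<longleftrightarrow> p_int M q g"
  by (simp add: Lp_def p_int_def)

lemma powr_root_less:
  assumes "0 \<le> m" "m < e powr p" "e > 0" shows "m powr (1/p) < e"
proof -
  have "m powr (1/p) < (e powr p) powr (1/p)" using assms p by (intro powr_less_mono2) auto
  then show ?thesis using assms p by (simp add: powr_powr)
qed

lemma W0_imp_W1_0:
  assumes W: "W0 v G" shows "v \<in> W1_0 \<Omega> p"
proof -
  note vG = W0_p_int[OF W] and h = W0_has_weak_grad[OF W]
  have "\<exists>\<phi>. test_function \<Omega> \<phi> \<and> W1_norm \<Omega> p (\<lambda>x. v x - \<phi> x) < \<epsilon>" if \<epsilon>: "\<epsilon> > 0" for \<epsilon>
  proof -
    obtain \<phi> where \<phi>: "test_function \<Omega> \<phi>" "p_mass M p (\<lambda>x. v x - \<phi> x) < (\<epsilon>/2) powr p" "p_mass M p (\<lambda>x. G x - grad \<phi> x) < (\<epsilon>/2) powr p"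
      using W0_approx[OF W, of "(\<epsilon>/2) powr p"] \<epsilon> by auto
    note t = test_function_p[OF \<phi>(1)]
    have "W1_norm \<Omega> p (\<lambda>x. v x - \<phi> x) = p_mass M p (\<lambda>x. v x - \<phi> x) powr (1/p) + p_mass M p (\<lambda>x. G x - grad \<phi> x) powr (1/p)"
      using p_int_measurable[OF p_int_diff(1)[OF p(1) vG(2) t(2)]]
      by (rule W1_norm_eq[OF has_weak_grad_diff[OF open_dom h has_weak_grad_test_function[OF open_dom \<phi>(1)]]])
    also have "\<dots> < \<epsilon> / 2 + \<epsilon> / 2"
      using \<phi>(2,3) \<epsilon> by (intro add_strict_mono powr_root_less p_mass_nonneg) auto
    finally show ?thesis using \<phi>(1) by auto
  qed
  then show ?thesis using vG h unfolding W1_0_def W1_def by (auto simp: Lp_iff)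
qed

lemma W1_0_imp_W0:
  assumes "v \<in> W1_0 \<Omega> p" shows "W0 v (weak_grad \<Omega> v)"
proof -
  obtain G where v: "p_int M p v" and G: "p_int M p G" "has_weak_grad \<Omega> v G"
    using assms by (auto simp: W1_0_def W1_def Lp_iff)
  note Gm = p_int_measurable[OF G(1)]
  have WG: "W0 v G" unfolding W0_def
  proof (intro conjI allI impI v G)
    fix \<epsilon> :: real assume \<epsilon>: "\<epsilon> > 0"
    define e where "e = \<epsilon> powr (1/p)"
    have e: "e > 0" "e powr p = \<epsilon>" using \<epsilon> p by (auto simp: e_def powr_powr)
    obtain \<phi> where \<phi>: "test_function \<Omega> \<phi>" "W1_norm \<Omega> p (\<lambda>x. v x - \<phi> x) < e"
      using assms e(1) unfolding W1_0_def by blast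
    note t = test_function_p[OF \<phi>(1)]
    have "W1_norm \<Omega> p (\<lambda>x. v x - \<phi> x) = p_mass M p (\<lambda>x. v x - \<phi> x) powr (1/p) + p_mass M p (\<lambda>x. G x - grad \<phi> x) powr (1/p)"
      using p_int_measurable[OF p_int_diff(1)[OF p(1) G(1) t(2)]]
      by (rule W1_norm_eq[OF has_weak_grad_diff[OF open_dom G(2) has_weak_grad_test_function[OF open_dom \<phi>(1)]]])
    then have "p_mass M p (\<lambda>x. v x - \<phi> x) powr (1/p) < e" "p_mass M p (\<lambda>x. G x - grad \<phi> x) powr (1/p) < e"
      using \<phi>(2) powr_ge_zero[of "p_mass M p (\<lambda>x. v x - \<phi> x)" "1/p"] powr_ge_zero[of "p_mass M p (\<lambda>x. G x - grad \<phi> x)" "1/p"] by linarith+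
    then have "(p_mass M p (\<lambda>x. v x - \<phi> x) powr (1/p)) powr p < e powr p" "(p_mass M p (\<lambda>x. G x - grad \<phi> x) powr (1/p)) powr p < e powr p"
      using p by (auto intro!: powr_less_mono2)
    then show "\<exists>\<phi>. test_function \<Omega> \<phi> \<and> p_mass M p (\<lambda>x. v x - \<phi> x) < \<epsilon> \<and> p_mass M p (\<lambda>x. G x - grad \<phi> x) < \<epsilon>"
      using \<phi>(1) p e(2) by (auto simp: powr_powr p_mass_nonneg)
  qed
  note ae = weak_grad_AE_eq[OF G(2)] and wm = weak_grad_measurable[OF G(2) Gm]
  have "p_mass M p (\<lambda>x. weak_grad \<Omega> v x - grad \<phi> x) = p_mass M p (\<lambda>x. G x - grad \<phi> x)" if t: "test_function \<Omega> \<phi>" for \<phi>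
    using ae wm Gm p_int_measurable[OF test_function_p(2)[OF t]] by (intro p_mass_cong_AE) auto
  then show ?thesis using WG p_int_cong_AE[OF ae G(1) wm] unfolding W0_def by metis
qed

text \<open>A diagonal argument: approximate an approximant.\<close>

lemma W0_closed:
  assumes W: "\<And>n. W0 (u n) (G n)" and l: "p_int M p v" "p_int M p H"
    and lim: "(\<lambda>n. p_mass M p (\<lambda>x. u n x - v x)) \<longlonglongrightarrow> 0" "(\<lambda>n. p_mass M p (\<lambda>x. G n x - H x)) \<longlonglongrightarrow> 0"
  shows "W0 v H"
  unfolding W0_def
proof (intro conjI allI impI l)
  fix \<epsilon> :: real assume \<epsilon>: "\<epsilon> > 0"
  define e where "e = \<epsilon> / (2 powr p * 2)"
  have e: "e > 0" "2 powr p * (e + e) = \<epsilon>" using \<epsilon> by (auto simp: e_def)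
  have "eventually (\<lambda>n. p_mass M p (\<lambda>x. u n x - v x) < e \<and> p_mass M p (\<lambda>x. G n x - H x) < e) sequentially"
    using order_tendstoD(2)[OF lim(1) e(1)] order_tendstoD(2)[OF lim(2) e(1)] by (rule eventually_conj)
  then obtain n where n: "p_mass M p (\<lambda>x. u n x - v x) < e" "p_mass M p (\<lambda>x. G n x - H x) < e"
    by (auto simp: eventually_sequentially)
  obtain \<phi> where \<phi>: "test_function \<Omega> \<phi>" "p_mass M p (\<lambda>x. u n x - \<phi> x) < e" "p_mass M p (\<lambda>x. G n x - grad \<phi> x) < e"
    using W0_approx[OF W e(1)] by metis
  note t = test_function_p[OF \<phi>(1)]
  have "p_mass M p (\<lambda>x. v x - \<phi> x) \<le> 2 powr p * (p_mass M p (\<lambda>x. v x - u n x) + p_mass M p (\<lambda>x. u n x - \<phi> x))"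
    by (rule p_mass_triangle[OF p(1) l(1) W0_p_int(1)[OF W] t(1)])
  also have "\<dots> < 2 powr p * (e + e)" using n \<phi> by (intro mult_strict_left_mono add_strict_mono) (auto simp: p_mass_commute)
  finally have 1: "p_mass M p (\<lambda>x. v x - \<phi> x) < \<epsilon>" using e by simp
  have "p_mass M p (\<lambda>x. H x - grad \<phi> x) \<le> 2 powr p * (p_mass M p (\<lambda>x. H x - G n x) + p_mass M p (\<lambda>x. G n x - grad \<phi> x))"
    by (rule p_mass_triangle[OF p(1) l(2) W0_p_int(2)[OF W] t(2)])
  also have "\<dots> < 2 powr p * (e + e)" using n \<phi> by (intro mult_strict_left_mono add_strict_mono) (auto simp: p_mass_commute)
  finally have 2: "p_mass M p (\<lambda>x. H x - grad \<phi> x) < \<epsilon>" using e by simp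
  show "\<exists>\<phi>. test_function \<Omega> \<phi> \<and> p_mass M p (\<lambda>x. v x - \<phi> x) < \<epsilon> \<and> p_mass M p (\<lambda>x. H x - grad \<phi> x) < \<epsilon>"
    using \<phi>(1) 1 2 by blast
qed

lemma W0_lincomb:
  assumes "W0 u G" "W0 v H"
  shows "W0 (\<lambda>x. a * u x + b * v x) (\<lambda>x. a *\<^sub>R G x + b *\<^sub>R H x)"
  unfolding W0_def
proof (intro conjI allI impI)
  note u = W0_p_int[OF assms(1)] and v = W0_p_int[OF assms(2)]
  have lin: "p_int M p (\<lambda>x. a *\<^sub>R f x + b *\<^sub>R g x)"
      "p_mass M p (\<lambda>x. a *\<^sub>R f x + b *\<^sub>R g x) \<le> 2 powr p * (\<bar>a\<bar> powr p * p_mass M p f + \<bar>b\<bar> powr p * p_mass M p g)"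
    if "p_int M p f" "p_int M p g" for f g :: "'a \<Rightarrow> 'b::euclidean_space"
    using p_int_add[OF p(1) p_int_scaleR(1)[OF that(1), of a] p_int_scaleR(1)[OF that(2), of b]]
    by (auto simp: p_int_scaleR(2)[OF that(1)] p_int_scaleR(2)[OF that(2)])
  show "p_int M p (\<lambda>x. a * u x + b * v x)" using lin(1)[OF u(1) v(1)] by simp
  show "p_int M p (\<lambda>x. a *\<^sub>R G x + b *\<^sub>R H x)" by (rule lin(1)[OF u(2) v(2)])
  fix \<epsilon> :: real assume \<epsilon>: "\<epsilon> > 0"
  define c where "c = 2 powr p * (\<bar>a\<bar> powr p + \<bar>b\<bar> powr p) + 1"
  have c: "c > 0" by (simp add: c_def add_nonneg_pos)
  define e where "e = \<epsilon> / c"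
  have e: "e > 0" using \<epsilon> c by (simp add: e_def)
  have ce: "2 powr p * (\<bar>a\<bar> powr p * e + \<bar>b\<bar> powr p * e) < \<epsilon>"
  proof -
    have "2 powr p * (\<bar>a\<bar> powr p * e + \<bar>b\<bar> powr p * e) = (c - 1) * e" by (simp add: c_def algebra_simps)
    also have "\<dots> < c * e" using e by simp
    also have "\<dots> = \<epsilon>" using c by (simp add: e_def)
    finally show ?thesis .
  qed
  have bound: "2 powr p * (\<bar>a\<bar> powr p * s + \<bar>b\<bar> powr p * t) < \<epsilon>" if "s < e" "t < e" for s t
  proof -
    have "2 powr p * (\<bar>a\<bar> powr p * s + \<bar>b\<bar> powr p * t) \<le> 2 powr p * (\<bar>a\<bar> powr p * e + \<bar>b\<bar> powr p * e)"
      using that by (intro mult_left_mono add_mono) auto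
    then show ?thesis using ce by linarith
  qed
  obtain \<phi> where \<phi>: "test_function \<Omega> \<phi>" "p_mass M p (\<lambda>x. u x - \<phi> x) < e" "p_mass M p (\<lambda>x. G x - grad \<phi> x) < e"
    using W0_approx[OF assms(1) e] by metis
  obtain \<psi> where \<psi>: "test_function \<Omega> \<psi>" "p_mass M p (\<lambda>x. v x - \<psi> x) < e" "p_mass M p (\<lambda>x. H x - grad \<psi> x) < e"
    using W0_approx[OF assms(2) e] by metis
  note t = test_function_p[OF \<phi>(1)] and s = test_function_p[OF \<psi>(1)]
  let ?\<eta> = "\<lambda>x. a * \<phi> x + b * \<psi> x"
  have "(\<lambda>x. (a * u x + b * v x) - ?\<eta> x) = (\<lambda>x. a *\<^sub>R (u x - \<phi> x) + b *\<^sub>R (v x - \<psi> x))"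
    by (simp add: algebra_simps)
  then have "p_mass M p (\<lambda>x. (a * u x + b * v x) - ?\<eta> x) < \<epsilon>"
    using lin(2)[OF p_int_diff(1)[OF p(1) u(1) t(1)] p_int_diff(1)[OF p(1) v(1) s(1)]] bound[OF \<phi>(2) \<psi>(2)] by simp
  moreover have "(\<lambda>x. (a *\<^sub>R G x + b *\<^sub>R H x) - grad ?\<eta> x) = (\<lambda>x. a *\<^sub>R (G x - grad \<phi> x) + b *\<^sub>R (H x - grad \<psi> x))"
    by (simp add: test_function_lincomb(2)[OF \<phi>(1) \<psi>(1)] algebra_simps)
  then have "p_mass M p (\<lambda>x. (a *\<^sub>R G x + b *\<^sub>R H x) - grad ?\<eta> x) < \<epsilon>"
    using lin(2)[OF p_int_diff(1)[OF p(1) u(2) t(2)] p_int_diff(1)[OF p(1) v(2) s(2)]] bound[OF \<phi>(3) \<psi>(3)] by simp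
  ultimately show "\<exists>\<eta>. test_function \<Omega> \<eta> \<and> p_mass M p (\<lambda>x. (a * u x + b * v x) - \<eta> x) < \<epsilon> \<and> p_mass M p (\<lambda>x. (a *\<^sub>R G x + b *\<^sub>R H x) - grad \<eta> x) < \<epsilon>"
    using test_function_lincomb(1)[OF \<phi>(1) \<psi>(1)] by blast
qed

definition crit :: real where "crit = real DIM('a) * p / (real DIM('a) - p)"

lemma crit_gt: "p < crit"
proof -
  have "p * (real DIM('a) - p) < real DIM('a) * p" using p by (simp add: algebra_simps)
  then show ?thesis unfolding crit_def using p by (simp add: pos_less_divide_eq)
qed

lemma sobolev_bound:
  obtains S where "\<And>\<phi>. test_function \<Omega> \<phi> \<Longrightarrow> p_mass M p (grad \<phi>) \<le> C \<Longrightarrow> (LINT x|lborel. \<bar>\<phi> x\<bar> powr crit) \<le> S"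
proof -
  define q where "q = p * (real DIM('a) - 1) / (real DIM('a) - p)"
  have q: "q \<ge> 0" using p by (simp add: q_def)
  have "(LINT x|lborel. \<bar>\<phi> x\<bar> powr crit) \<le> (q * (max C 0) powr (1/p)) powr crit" if "test_function \<Omega> \<phi>" "p_mass M p (grad \<phi>) \<le> C" for \<phi>
  proof -
    have "(LINT x|lborel. \<bar>\<phi> x\<bar> powr crit) \<le> (q * (LINT x|lborel. norm (grad \<phi> x) powr p) powr (1/p)) powr crit"
      unfolding q_def by (rule sobolev_inequality[OF test_function_C1_compact[OF that(1)] p crit_def])
    also have "\<dots> \<le> (q * (max C 0) powr (1/p)) powr crit"
      using that test_function_p(4)[OF that(1)] p_mass_nonneg[of M p "grad \<phi>"] q p crit_gt
      by (intro powr_mono2 mult_left_mono) auto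
    finally show ?thesis .
  qed
  then show ?thesis by (rule that)
qed

lemma test_crit_integrable:
  assumes "test_function \<Omega> \<phi>"
  shows "integrable lborel (\<lambda>x. \<bar>\<phi> x\<bar> powr crit)" "integrable M (\<lambda>x. \<bar>\<phi> x\<bar> powr crit)"
    "(LINT x|M. \<bar>\<phi> x\<bar> powr crit) = (LINT x|lborel. \<bar>\<phi> x\<bar> powr crit)"
proof -
  note C1 = test_function_C1_compact[OF assms]
  obtain R where R: "\<And>x. norm x \<ge> R \<Longrightarrow> \<phi> x = 0" using C1_compact_radius[OF C1] by metis
  have [measurable]: "\<phi> \<in> borel_measurable borel" using C1_compactD[OF C1] by auto
  show 1: "integrable lborel (\<lambda>x. \<bar>\<phi> x\<bar> powr crit)"
    using C1_compactD(3)[OF C1] R p crit_gt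
    by (intro integrable_continuous_compact[where R=R] continuous_intros continuous_on_powr') auto
  show "integrable M (\<lambda>x. \<bar>\<phi> x\<bar> powr crit)" "(LINT x|M. \<bar>\<phi> x\<bar> powr crit) = (LINT x|lborel. \<bar>\<phi> x\<bar> powr crit)"
    using 1 lebesgue_on_lborel[of "\<lambda>x. \<bar>\<phi> x\<bar> powr crit", OF _ _ dom_sets] test_function_outside(1)[OF assms] by auto
qed

text \<open>Sobolev's inequality for approximating test functions and Fatou's lemma along an almost everywhere
  convergent subsequence.\<close>

lemma W0_crit_integrable:
  assumes W: "W0 u G" shows "p_int M crit u"
proof -
  have "\<exists>\<phi>. test_function \<Omega> \<phi> \<and> p_mass M p (\<lambda>x. u x - \<phi> x) < 1 / real (Suc n) \<and> p_mass M p (\<lambda>x. G x - grad \<phi> x) < 1 / real (Suc n)" for n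
    using W unfolding W0_def by simp
  then obtain \<phi> where \<phi>: "\<And>n. test_function \<Omega> (\<phi> n)" "\<And>n. p_mass M p (\<lambda>x. u x - \<phi> n x) < 1 / real (Suc n)"
    "\<And>n. p_mass M p (\<lambda>x. G x - grad (\<phi> n) x) < 1 / real (Suc n)" by metis
  note t = test_function_p[OF \<phi>(1)] and uG = W0_p_int[OF W]
  define C where "C = 2 powr p * (p_mass M p G + 1)"
  have C: "p_mass M p (grad (\<phi> n)) \<le> C" for n
  proof -
    have "p_mass M p (\<lambda>x. G x - (G x - grad (\<phi> n) x)) \<le> 2 powr p * (p_mass M p G + p_mass M p (\<lambda>x. G x - grad (\<phi> n) x))"
      by (rule p_int_diff(2)[OF p(1) uG(2) p_int_diff(1)[OF p(1) uG(2) t(2)]])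
    also have "\<dots> \<le> C" unfolding C_def
      using \<phi>(3)[of n] by (intro mult_left_mono add_left_mono) (auto intro: order_trans[OF less_imp_le])
    finally show ?thesis by simp
  qed
  obtain S where S: "\<And>\<phi>. test_function \<Omega> \<phi> \<Longrightarrow> p_mass M p (grad \<phi>) \<le> C \<Longrightarrow> (LINT x|lborel. \<bar>\<phi> x\<bar> powr crit) \<le> S"
    using sobolev_bound by metis
  have "(\<lambda>n. p_mass M p (\<lambda>x. \<phi> n x - u x)) \<longlonglongrightarrow> 0"
  proof (rule tendsto_sandwich[OF _ _ tendsto_const LIMSEQ_inverse_real_of_nat])
    show "eventually (\<lambda>n. p_mass M p (\<lambda>x. \<phi> n x - u x) \<le> inverse (real (Suc n))) sequentially"
      using \<phi>(2) by (intro always_eventually allI) (simp add: p_mass_commute[of M p _ u] inverse_eq_divide less_imp_le)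
  qed (simp add: p_mass_nonneg)
  from p_mass_AE_subseq[OF p(1) t(1) uG(1) this]
  obtain r where r: "strict_mono r" "AE x in M. (\<lambda>n. \<phi> (r n) x) \<longlonglongrightarrow> u x" by metis
  have [measurable]: "u \<in> borel_measurable M" using uG(1) by (rule p_int_measurable)
  have "integrable M (\<lambda>x. \<bar>u x\<bar> powr crit)"
  proof (rule fatou_bound(1)[where k = "\<lambda>n x. \<bar>\<phi> (r n) x\<bar> powr crit" and c = S])
    show "AE x in M. (\<lambda>n. \<bar>\<phi> (r n) x\<bar> powr crit) \<longlonglongrightarrow> \<bar>u x\<bar> powr crit"
      using r(2)
    proof eventually_elim
      case (elim x)
      then show ?case using crit_gt p by (intro tendsto_powr' tendsto_rabs tendsto_const) auto
    qed
    show "eventually (\<lambda>n. (LINT x|M. \<bar>\<phi> (r n) x\<bar> powr crit) \<le> S) sequentially"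
      using S[OF \<phi>(1) C] by (simp add: test_crit_integrable(3)[OF \<phi>(1)])
  qed (simp_all add: test_crit_integrable(2)[OF \<phi>(1)])
  then show ?thesis by (simp add: p_int_def)
qed

end

context sobolev_space
begin

section \<open>Compactness of bounded sequences\<close>

text \<open>Small values of \<open>z\<close> are controlled by the first power, large values by the critical
  power; \<open>K\<close> is the threshold.\<close>

lemma interpolation_pointwise:
  fixes z K :: real
  assumes "K > 0"
  shows "\<bar>z\<bar> powr p \<le> K powr (p - 1) * \<bar>z\<bar> + K powr (p - crit) * \<bar>z\<bar> powr crit"
proof (cases "\<bar>z\<bar> \<le> K")
  case True
  have "\<bar>z\<bar> powr p = \<bar>z\<bar> powr (p - 1) * \<bar>z\<bar>" using p by (cases "z = 0") (auto simp: powr_diff)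
  also have "\<dots> \<le> K powr (p - 1) * \<bar>z\<bar>" using True p by (intro mult_right_mono powr_mono2) auto
  finally show ?thesis by (simp add: add_increasing2)
next
  case False
  have "\<bar>z\<bar> powr p = \<bar>z\<bar> powr (p - crit) * \<bar>z\<bar> powr crit" by (simp flip: powr_add)
  also have "\<dots> \<le> K powr (p - crit) * \<bar>z\<bar> powr crit"
    using False assms crit_gt by (intro mult_right_mono powr_mono2') auto
  finally show ?thesis using assms by (simp add: add_increasing)
qed

text \<open>Rellich's theorem gives a subsequence that is Cauchy in \<open>L\<^sup>1\<close>. Its members are
  bounded in the critical norm, so interpolation makes it Cauchy in \<open>L\<^sup>p\<close>.\<close>

lemma test_functions_precompact:
  assumes \<phi>: "\<And>n. test_function \<Omega> (\<phi> n)" and C: "\<And>n. p_mass M p (\<phi> n) \<le> C" "\<And>n. p_mass M p (grad (\<phi> n)) \<le> C"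
  obtains r :: "nat \<Rightarrow> nat" and u where "strict_mono r" "p_int M p u" "(\<lambda>n. p_mass M p (\<lambda>x. \<phi> (r n) x - u x)) \<longlonglongrightarrow> 0"
proof -
  note t = test_function_p[OF \<phi>] and C1 = test_function_C1_compact[OF \<phi>]
  obtain R where R: "\<forall>x\<in>\<Omega>. norm x \<le> R" using bounded_dom by (auto simp: bounded_iff)
  have R': "\<phi> n x = 0" if "norm x \<ge> R + 1" for n x
  proof -
    have "x \<notin> \<Omega>" using R that by auto
    then show ?thesis by (rule test_function_outside(1)[OF \<phi>])
  qed
  define m where "m = measure M (space M) + C"
  have b1: "(LINT x|lborel. \<bar>\<phi> n x\<bar>) \<le> m" for n
    using integral_norm_le_p_mass[OF p(1) t(1), of 1 n] C(1)[of n] by (simp add: t(5)[symmetric] m_def)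
  have b2: "(LINT x|lborel. norm (grad (\<phi> n) x)) \<le> m" for n
    using integral_norm_le_p_mass[OF p(1) t(2), of 1 n] C(2)[of n] by (simp add: t(6)[symmetric] m_def)
  obtain r :: "nat \<Rightarrow> nat" where r: "strict_mono r" "\<forall>e>0. \<exists>N. \<forall>i\<ge>N. \<forall>j\<ge>N. (LINT x|lborel. \<bar>\<phi> (r i) x - \<phi> (r j) x\<bar>) < e"
    by (rule rellich_L1[where w = \<phi>, OF C1 R' b1 b2]) blast
  obtain S where S: "\<And>\<phi>. test_function \<Omega> \<phi> \<Longrightarrow> p_mass M p (grad \<phi>) \<le> C \<Longrightarrow> (LINT x|lborel. \<bar>\<phi> x\<bar> powr crit) \<le> S"
    using sobolev_bound by metis
  have S0: "S \<ge> 0" using S[OF \<phi>[of 0] C(2)[of 0]] by (rule order_trans[rotated]) simp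
  have crit_gt_1: "crit > 1" using crit_gt p by simp
  have Cauchy: "\<exists>N. \<forall>i\<ge>N. \<forall>j\<ge>N. p_mass M p (\<lambda>x. \<phi> (r i) x - \<phi> (r j) x) < e" if e: "e > 0" for e
  proof -
    \<comment> \<open>bounds the critical mass of a difference; the negative power of \<open>K\<close> makes its contribution small\<close>
    define B where "B = 2 powr crit * (S + S)"
    have B: "B \<ge> 0" using S0 by (simp add: B_def)
    obtain K where K: "K > 0" "K powr (p - crit) * B < e / 2"
    proof -
      have "((\<lambda>K. K powr (p - crit) * B) \<longlongrightarrow> 0 * B) at_top"
        using crit_gt by (intro tendsto_mult tendsto_const tendsto_neg_powr filterlim_ident) auto
      then have "eventually (\<lambda>K. K powr (p - crit) * B < e / 2) at_top"
        using e by (intro order_tendstoD(2)) auto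
      then have "eventually (\<lambda>K::real. K > 0 \<and> K powr (p - crit) * B < e / 2) at_top"
        using eventually_gt_at_top[of 0] by eventually_elim auto
      then show ?thesis using that eventually_happens[of _ "at_top::real filter"] by force
    qed
    obtain N where N: "\<And>i j. i \<ge> N \<Longrightarrow> j \<ge> N \<Longrightarrow> (LINT x|lborel. \<bar>\<phi> (r i) x - \<phi> (r j) x\<bar>) < e / 2 / K powr (p - 1)"
      using r(2)[rule_format, of "e / 2 / K powr (p - 1)"] e K(1) by auto
    have "p_mass M p (\<lambda>x. \<phi> (r i) x - \<phi> (r j) x) < e" if "i \<ge> N" "j \<ge> N" for i j
    proof -
      let ?d = "\<lambda>x. 1 * \<phi> (r i) x + (-1) * \<phi> (r j) x"
      have dt: "test_function \<Omega> ?d" by (rule test_function_lincomb(1)[OF \<phi> \<phi>])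
      note dd = test_function_p[OF dt] and dc = test_crit_integrable[OF dt]
      note dC = C1_compact_integrable(1)[OF test_function_C1_compact[OF dt]]
      have "p_mass M p ?d \<le> (LINT x|lborel. K powr (p - 1) * \<bar>?d x\<bar> + K powr (p - crit) * \<bar>?d x\<bar> powr crit)"
      proof -
        have "integrable lborel (\<lambda>x. \<bar>?d x\<bar> powr p)"
          using dd(1) lebesgue_on_lborel(2)[of "\<lambda>x. \<bar>?d x\<bar> powr p", OF _ _ dom_sets]
            C1_compactD(5)[OF test_function_C1_compact[OF dt]] test_function_outside(1)[OF dt]
          by (simp add: p_int_def)
        then show ?thesis unfolding dd(3) using dc(1) C1_compact_integrable(1)[OF C1]
          by (intro integral_mono Bochner_Integration.integrable_add integrable_mult_right integrable_abs interpolation_pointwise K(1))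
      qed
      also have "\<dots> = K powr (p - 1) * (LINT x|lborel. \<bar>?d x\<bar>) + K powr (p - crit) * (LINT x|lborel. \<bar>?d x\<bar> powr crit)"
        using dc(1) dC by simp
      also have "\<dots> < e / 2 + e / 2"
      proof (rule add_less_le_mono)
        have "(LINT x|lborel. \<bar>?d x\<bar>) < e / 2 / K powr (p - 1)" using N[OF that] by simp
        then show "K powr (p - 1) * (LINT x|lborel. \<bar>?d x\<bar>) < e / 2" using K(1) by (simp add: pos_less_divide_eq mult.commute)
        have "(LINT x|lborel. \<bar>?d x\<bar> powr crit) \<le> (LINT x|lborel. 2 powr crit * (\<bar>\<phi> (r i) x\<bar> powr crit + \<bar>\<phi> (r j) x\<bar> powr crit))"
          using dc(1) test_crit_integrable(1)[OF \<phi>] norm_powr_diff_le[OF crit_gt_1, of "\<phi> (r i) _" "\<phi> (r j) _"]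
          by (intro integral_mono) auto
        also have "\<dots> = 2 powr crit * ((LINT x|lborel. \<bar>\<phi> (r i) x\<bar> powr crit) + (LINT x|lborel. \<bar>\<phi> (r j) x\<bar> powr crit))"
          using test_crit_integrable(1)[OF \<phi>] by simp
        also have "\<dots> \<le> B" unfolding B_def using S[OF \<phi> C(2)] by (intro mult_left_mono add_mono) auto
        finally have "K powr (p - crit) * (LINT x|lborel. \<bar>?d x\<bar> powr crit) \<le> K powr (p - crit) * B"
          by (intro mult_left_mono) auto
        then show "K powr (p - crit) * (LINT x|lborel. \<bar>?d x\<bar> powr crit) \<le> e / 2" using K(2) by simp
      qed
      finally show ?thesis by simp
    qed
    then show ?thesis by blast
  qed
  obtain u where "p_int M p u" "(\<lambda>n. p_mass M p (\<lambda>x. \<phi> (r n) x - u x)) \<longlonglongrightarrow> 0"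
    by (rule p_mass_complete[where g = "\<lambda>n. \<phi> (r n)", OF p(1) t(1) Cauchy]) blast
  then show ?thesis using that r(1) by blast
qed

lemma tendsto_p_mass_triangle:
  fixes f g :: "nat \<Rightarrow> 'a \<Rightarrow> 'b::euclidean_space"
  assumes "\<And>n. p_int M p (f n)" "\<And>n. p_int M p (g n)" "p_int M p l"
    and "(\<lambda>n. p_mass M p (\<lambda>x. f n x - g n x)) \<longlonglongrightarrow> 0" "(\<lambda>n. p_mass M p (\<lambda>x. g n x - l x)) \<longlonglongrightarrow> 0"
  shows "(\<lambda>n. p_mass M p (\<lambda>x. f n x - l x)) \<longlonglongrightarrow> 0"
proof (rule tendsto_sandwich[OF _ _ tendsto_const])
  show "eventually (\<lambda>n. p_mass M p (\<lambda>x. f n x - l x) \<le> 2 powr p * (p_mass M p (\<lambda>x. f n x - g n x) + p_mass M p (\<lambda>x. g n x - l x))) sequentially"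
    using p_mass_triangle[OF p(1) assms(1,2,3)] by (intro always_eventually allI)
  have "(\<lambda>n. 2 powr p * (p_mass M p (\<lambda>x. f n x - g n x) + p_mass M p (\<lambda>x. g n x - l x))) \<longlonglongrightarrow> 2 powr p * (0 + 0)"
    by (intro tendsto_intros assms)
  then show "(\<lambda>n. 2 powr p * (p_mass M p (\<lambda>x. f n x - g n x) + p_mass M p (\<lambda>x. g n x - l x))) \<longlonglongrightarrow> 0" by simp
qed (simp add: p_mass_nonneg)

lemma W0_rellich:
  assumes W: "\<And>n. W0 (u n) (G n)" and C: "\<And>n. p_mass M p (u n) \<le> C" "\<And>n. p_mass M p (G n) \<le> C"
  obtains r :: "nat \<Rightarrow> nat" and v where "strict_mono r" "p_int M p v" "(\<lambda>n. p_mass M p (\<lambda>x. u (r n) x - v x)) \<longlonglongrightarrow> 0"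
proof -
  have "\<exists>\<phi>. test_function \<Omega> \<phi> \<and> p_mass M p (\<lambda>x. u n x - \<phi> x) < 1 / real (Suc n) \<and> p_mass M p (\<lambda>x. G n x - grad \<phi> x) < 1 / real (Suc n)" for n
    using W[of n] unfolding W0_def by simp
  then obtain \<phi> where \<phi>: "\<And>n. test_function \<Omega> (\<phi> n)" "\<And>n. p_mass M p (\<lambda>x. u n x - \<phi> n x) < 1 / real (Suc n)"
    "\<And>n. p_mass M p (\<lambda>x. G n x - grad (\<phi> n) x) < 1 / real (Suc n)" by metis
  note t = test_function_p[OF \<phi>(1)] and uG = W0_p_int[OF W]
  define B where "B = 2 powr p * (C + 1)"
  have inv1: "1 / real (Suc n) \<le> 1" for n by simp
  have B: "p_mass M p (\<phi> n) \<le> B" "p_mass M p (grad (\<phi> n)) \<le> B" for n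
  proof -
    have "p_mass M p (\<lambda>x. G n x - (G n x - grad (\<phi> n) x)) \<le> 2 powr p * (p_mass M p (G n) + p_mass M p (\<lambda>x. G n x - grad (\<phi> n) x))"
      by (rule p_int_diff(2)[OF p(1) uG(2) p_int_diff(1)[OF p(1) uG(2) t(2)]])
    also have "\<dots> \<le> B" unfolding B_def
      using \<phi>(3)[of n] C(2)[of n] inv1[of n] by (intro mult_left_mono add_mono) (linarith | simp)+
    finally show "p_mass M p (grad (\<phi> n)) \<le> B" by simp
    have "p_mass M p (\<lambda>x. u n x - (u n x - \<phi> n x)) \<le> 2 powr p * (p_mass M p (u n) + p_mass M p (\<lambda>x. u n x - \<phi> n x))"
      by (rule p_int_diff(2)[OF p(1) uG(1) p_int_diff(1)[OF p(1) uG(1) t(1)]])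
    also have "\<dots> \<le> B" unfolding B_def
      using \<phi>(2)[of n] C(1)[of n] inv1[of n] by (intro mult_left_mono add_mono) (linarith | simp)+
    finally show "p_mass M p (\<phi> n) \<le> B" by simp
  qed
  obtain r v where r: "strict_mono r" "p_int M p v" "(\<lambda>n. p_mass M p (\<lambda>x. \<phi> (r n) x - v x)) \<longlonglongrightarrow> 0"
    using that by (rule test_functions_precompact[where \<phi> = \<phi>, OF \<phi>(1) B])
  have "(\<lambda>n. p_mass M p (\<lambda>x. u n x - \<phi> n x)) \<longlonglongrightarrow> 0"
  proof (rule tendsto_sandwich[OF _ _ tendsto_const LIMSEQ_inverse_real_of_nat])
    show "eventually (\<lambda>n. p_mass M p (\<lambda>x. u n x - \<phi> n x) \<le> inverse (real (Suc n))) sequentially"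
      using \<phi>(2) by (intro always_eventually allI) (simp add: inverse_eq_divide less_imp_le)
  qed (simp add: p_mass_nonneg)
  from LIMSEQ_subseq_LIMSEQ[OF this r(1)]
  have "(\<lambda>n. p_mass M p (\<lambda>x. u (r n) x - \<phi> (r n) x)) \<longlonglongrightarrow> 0" by (simp add: o_def)
  from tendsto_p_mass_triangle[OF uG(1) t(1) r(2) this r(3)]
  show ?thesis using that r(1,2) by blast
qed

section \<open>Limits of gradients by uniform convexity\<close>

text \<open>Iterated midpoints of the tail from index \<open>n\<close>, taken simultaneously for functions and
  gradients. Midpoints suffice for the uniform convexity argument.\<close>

inductive mid_hull :: "(nat \<Rightarrow> 'a \<Rightarrow> real) \<Rightarrow> (nat \<Rightarrow> 'a \<Rightarrow> 'a) \<Rightarrow> nat \<Rightarrow> ('a \<Rightarrow> real) \<Rightarrow> ('a \<Rightarrow> 'a) \<Rightarrow> bool"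
  for v H n where
  base: "n \<le> k \<Longrightarrow> mid_hull v H n (v k) (H k)"
| mid: "mid_hull v H n w g \<Longrightarrow> mid_hull v H n w' g' \<Longrightarrow>
    mid_hull v H n (\<lambda>x. (1/2) *\<^sub>R (w x + w' x)) (\<lambda>x. (1/2) *\<^sub>R (g x + g' x))"

lemma mid_hull_mono: "mid_hull v H n w g \<Longrightarrow> m \<le> n \<Longrightarrow> mid_hull v H m w g"
proof (induction rule: mid_hull.induct)
  case (base k)
  then show ?case by (intro mid_hull.base) simp
next
  case (mid w g w' g')
  then show ?case by (intro mid_hull.mid) simp_all
qed

lemma mid_hull_W0:
  assumes "mid_hull v H n w g" "\<And>k. W0 (v k) (H k)" shows "W0 w g"
  using assms(1)
proof (induction rule: mid_hull.induct)
  case (mid w g w' g')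
  then show ?case using W0_lincomb[OF mid.IH, of "1/2" "1/2"] by (simp add: scaleR_add_right distrib_left)
qed (rule assms(2))

lemma mid_hull_mass:
  assumes "mid_hull v H n w g" "\<And>k. W0 (v k) (H k)" "\<And>k. k \<ge> n \<Longrightarrow> p_mass M p (H k) \<le> C" shows "p_mass M p g \<le> C"
  using assms(1)
proof (induction rule: mid_hull.induct)
  case (mid w g w' g')
  then show ?case
    using p_int_midpoint(2)[OF p(1) W0_p_int(2)[OF mid_hull_W0[OF mid.hyps(1) assms(2)]] W0_p_int(2)[OF mid_hull_W0[OF mid.hyps(2) assms(2)]]]
    by simp
qed (rule assms(3))

lemma mid_hull_close:
  assumes "mid_hull v H n w g" "\<And>k. W0 (v k) (H k)" "p_int M p u" "\<And>k. k \<ge> n \<Longrightarrow> p_mass M p (\<lambda>x. v k x - u x) \<le> e"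
  shows "p_mass M p (\<lambda>x. w x - u x) \<le> e"
  using assms(1)
proof (induction rule: mid_hull.induct)
  case (mid w g w' g')
  have "(\<lambda>x. (1/2) *\<^sub>R (w x + w' x) - u x) = (\<lambda>x. (1/2) *\<^sub>R ((w x - u x) + (w' x - u x)))"
    by (simp add: fun_eq_iff field_simps)
  then show ?case
    using p_int_midpoint(2)[OF p(1)
        p_int_diff(1)[OF p(1) W0_p_int(1)[OF mid_hull_W0[OF mid.hyps(1) assms(2)]] assms(3)]
        p_int_diff(1)[OF p(1) W0_p_int(1)[OF mid_hull_W0[OF mid.hyps(2) assms(2)]] assms(3)]] mid.IH
    by simp
qed (rule assms(4))

lemma Phi_integrable:
  assumes "p_int M p G" shows "integrable M (\<lambda>x. Phi p (G x))"
proof (rule Bochner_Integration.integrable_bound[OF p_int_integrable[OF assms]])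
  show "(\<lambda>x. Phi p (G x)) \<in> borel_measurable M"
    using borel_measurable_continuous_onI[OF continuous_on_Phi[OF p(1)]] p_int_measurable[OF assms] by measurable
  show "AE x in M. norm (Phi p (G x)) \<le> norm (norm (G x) powr p)"
    using Phi_le[OF p(1)] by (intro AE_I2) (simp add: Phi_nonneg)
qed

lemma mid_hull_Phi:
  assumes "mid_hull v H n w g" "\<And>k. W0 (v k) (H k)" "\<And>k. k \<ge> n \<Longrightarrow> (LINT x|M. Phi p (H k x)) \<le> c"
  shows "(LINT x|M. Phi p (g x)) \<le> c"
  using assms(1)
proof (induction rule: mid_hull.induct)
  case (mid w g w' g')
  note i = W0_p_int(2)[OF mid_hull_W0[OF mid.hyps(1) assms(2)]] W0_p_int(2)[OF mid_hull_W0[OF mid.hyps(2) assms(2)]]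
  have "(LINT x|M. Phi p ((1/2) *\<^sub>R (g x + g' x))) \<le> (LINT x|M. (Phi p (g x) + Phi p (g' x)) / 2)"
    using Phi_integrable[OF i(1)] Phi_integrable[OF i(2)] Phi_integrable[OF p_int_midpoint(1)[OF p(1) i]] Phi_midpoint_le[OF p(1)]
    by (intro integral_mono) auto
  also have "\<dots> \<le> c" using Phi_integrable[OF i(1)] Phi_integrable[OF i(2)] mid.IH by simp
  finally show ?case .
qed (rule assms(3))

text \<open>Let \<open>m\<^sub>n\<close> be the infimum of the \<open>p\<close>-mass over the hull of the
  \<open>n\<close>-th tail. These infima increase to a finite limit. For \<open>i \<le> j\<close>
  the midpoint of near-minimizers for \<open>i\<close> and \<open>j\<close> lies in the
  \<open>i\<close>-th hull, so its mass is at least \<open>m\<^sub>i\<close>, which is close to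
  the masses of both; uniform convexity forces the two to be close.\<close>

lemma mid_hull_minimizing_limit:
  assumes W: "\<And>n. W0 (v n) (H n)" and C: "\<And>n. p_mass M p (H n) \<le> C"
  obtains w g l where "\<And>n. mid_hull v H n (w n) (g n)" "p_int M p l" "(\<lambda>n. p_mass M p (\<lambda>x. g n x - l x)) \<longlonglongrightarrow> 0"
proof -
  define S where "S n = {p_mass M p g | w g. mid_hull v H n w g}" for n
  define m where "m n = Inf (S n)" for n
  have Sne: "S n \<noteq> {}" for n unfolding S_def using mid_hull.base[of n n v H] by blast
  have bdd: "bdd_below (S n)" for n unfolding S_def by (intro bdd_belowI[of _ 0]) (auto simp: p_mass_nonneg)
  have m_le: "m n \<le> p_mass M p g" if "mid_hull v H n w g" for n w g
    unfolding m_def using that bdd by (intro cInf_lower) (auto simp: S_def)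
  have m_mono: "m i \<le> m j" if "i \<le> j" for i j
    unfolding m_def using that bdd Sne by (intro cInf_superset_mono) (auto simp: S_def intro: mid_hull_mono)
  have m_C: "m n \<le> C" for n using m_le[OF mid_hull.base[OF order_refl]] C[of n] by (rule order_trans)
  obtain L where L: "m \<longlonglongrightarrow> L"
  proof -
    have "incseq m" using m_mono by (simp add: incseq_def)
    from incseq_convergent[OF this, of C] m_C that show ?thesis by metis
  qed
  have "\<exists>w g. mid_hull v H n w g \<and> p_mass M p g < m n + 1 / real (Suc n)" for n
  proof -
    have "\<exists>s\<in>S n. s < m n + 1 / real (Suc n)"
      using cInf_lessD[OF Sne, of n "m n + 1 / real (Suc n)"] by (simp add: m_def)
    then show ?thesis by (auto simp: S_def)
  qed
  then obtain w g where wg: "\<And>n. mid_hull v H n (w n) (g n)" "\<And>n. p_mass M p (g n) < m n + 1 / real (Suc n)" by metis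
  have gi: "p_int M p (g n)" for n by (rule W0_p_int(2)[OF mid_hull_W0[OF wg(1) W]])
  have gC: "p_mass M p (g n) \<le> C" for n using mid_hull_mass[OF wg(1) W C] .
  have C0: "C \<ge> 0" using C[of 0] p_mass_nonneg[of M p "H 0"] by simp
  have Cauchy: "\<exists>N. \<forall>i\<ge>N. \<forall>j\<ge>N. p_mass M p (\<lambda>x. g i x - g j x) < e" if e: "e > 0" for e
  proof -
    define \<epsilon> where "\<epsilon> = e / (4 * (C + 1))"
    have \<epsilon>: "\<epsilon> > 0" "\<epsilon> * (C + C) < e / 2"
    proof -
      show "\<epsilon> > 0" using e C0 by (simp add: \<epsilon>_def)
      then have "\<epsilon> * (C + C) < \<epsilon> * (2 * (C + 1))" by (intro mult_strict_left_mono) auto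
      also have "\<dots> = e / 2" using C0 by (simp add: \<epsilon>_def divide_simps)
      finally show "\<epsilon> * (C + C) < e / 2" .
    qed
    obtain c where c: "c > 0" "\<And>a b :: 'a. norm (a - b) powr p \<le> \<epsilon> * (norm a powr p + norm b powr p)
         + c * ((norm a powr p + norm b powr p) / 2 - norm ((1/2) *\<^sub>R (a + b)) powr p)"
      using norm_powr_uniformly_convex[OF p(1) \<epsilon>(1)] by metis
    define \<eta> where "\<eta> = e / (8 * c)"
    have \<eta>: "\<eta> > 0" using e c by (simp add: \<eta>_def)
    have "eventually (\<lambda>n. \<bar>m n - L\<bar> < \<eta> \<and> 1 / real (Suc n) < \<eta>) sequentially"
    proof (rule eventually_conj)
      show "eventually (\<lambda>n. \<bar>m n - L\<bar> < \<eta>) sequentially"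
        using tendstoD[OF L \<eta>] by (simp add: dist_real_def)
      show "eventually (\<lambda>n. 1 / real (Suc n) < \<eta>) sequentially"
        using order_tendstoD(2)[OF LIMSEQ_inverse_real_of_nat \<eta>] by (simp add: inverse_eq_divide)
    qed
    then obtain N where N: "\<And>n. n \<ge> N \<Longrightarrow> \<bar>m n - L\<bar> < \<eta>" "\<And>n. n \<ge> N \<Longrightarrow> 1 / real (Suc n) < \<eta>"
      by (auto simp: eventually_sequentially)
    have le: "p_mass M p (\<lambda>x. g i x - g j x) < e" if ij: "N \<le> i" "i \<le> j" for i j
    proof -
      let ?a = "p_mass M p (g i)" and ?b = "p_mass M p (g j)"
      let ?h = "\<lambda>x. (1/2) *\<^sub>R (g i x + g j x)"
      have hi: "p_int M p ?h" by (rule p_int_midpoint(1)[OF p(1) gi gi])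
      have "mid_hull v H i (\<lambda>x. (1/2) *\<^sub>R (w i x + w j x)) ?h"
        using wg(1) mid_hull_mono[OF wg(1) ij(2)] by (intro mid_hull.mid)
      then have h: "m i \<le> p_mass M p ?h" by (rule m_le)
      have "p_mass M p (\<lambda>x. g i x - g j x) \<le> (LINT x|M. \<epsilon> * (norm (g i x) powr p + norm (g j x) powr p)
         + c * ((norm (g i x) powr p + norm (g j x) powr p) / 2 - norm (?h x) powr p))"
        unfolding p_mass_def
        using p_int_integrable[OF gi] p_int_integrable[OF hi] p_int_integrable[OF p_int_diff(1)[OF p(1) gi gi]]
        by (intro integral_mono c(2)) auto
      also have "\<dots> = \<epsilon> * (?a + ?b) + c * ((?a + ?b) / 2 - p_mass M p ?h)"
        unfolding p_mass_def
        using p_int_integrable[OF gi] p_int_integrable[OF hi] by simp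
      also have "\<dots> \<le> \<epsilon> * (C + C) + c * (3 * \<eta>)"
      proof (intro add_mono mult_left_mono gC)
        have jN: "N \<le> j" using ij by simp
        have "?a < m i + \<eta>" "?b < m j + \<eta>"
          using wg(2)[of i] N(2)[OF ij(1)] wg(2)[of j] N(2)[OF jN] by linarith+
        then show "(?a + ?b) / 2 - p_mass M p ?h \<le> 3 * \<eta>"
        proof -
          have "?a < L + 2 * \<eta>" "?b < L + 2 * \<eta>" "L - \<eta> < p_mass M p ?h"
            using \<open>?a < m i + \<eta>\<close> \<open>?b < m j + \<eta>\<close> N(1)[OF ij(1)] N(1)[OF jN] h unfolding abs_less_iff by linarith+
          then show ?thesis by (simp add: field_simps)
        qed
      qed (use \<epsilon> c in auto)
      also have "\<dots> < e"
      proof -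
        have c\<eta>: "c * (3 * \<eta>) = 3 * e / 8" using c by (simp add: \<eta>_def)
        show ?thesis unfolding c\<eta> using \<epsilon>(2) e by linarith
      qed
      finally show ?thesis .
    qed
    have "p_mass M p (\<lambda>x. g i x - g j x) < e" if "N \<le> i" "N \<le> j" for i j
      using le[of i j] le[of j i] that p_mass_commute[of M p "g i" "g j"] by (cases "i \<le> j") auto
    then show ?thesis by blast
  qed
  obtain l where "p_int M p l" "(\<lambda>n. p_mass M p (\<lambda>x. g n x - l x)) \<longlonglongrightarrow> 0"
    by (rule p_mass_complete[where g = g, OF p(1) gi Cauchy]) blast
  then show ?thesis using wg(1) that by blast
qed

text \<open>The substitute for weak compactness. The hull elements converge strongly to a pair in
  \<open>W0\<close> whose function is the Rellich limit, because all functions in a late tail are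
  close to that limit. Convexity passes a bound on the \<open>Phi\<close>-integrals from the tails
  to the hull elements, and Fatou's lemma to their limit.\<close>

theorem W0_compactness:
  assumes W: "\<And>n. W0 (u n) (G n)" and C: "\<And>n. p_mass M p (u n) \<le> C" "\<And>n. p_mass M p (G n) \<le> C"
  obtains r :: "nat \<Rightarrow> nat" and v H where "strict_mono r" "W0 v H" "(\<lambda>n. p_mass M p (\<lambda>x. u (r n) x - v x)) \<longlonglongrightarrow> 0"
    "\<forall>c. eventually (\<lambda>n. (LINT x|M. Phi p (G (r n) x)) \<le> c) sequentially \<longrightarrow> (LINT x|M. Phi p (H x)) \<le> c"
proof -
  obtain r v where r: "strict_mono r" "p_int M p v" "(\<lambda>n. p_mass M p (\<lambda>x. u (r n) x - v x)) \<longlonglongrightarrow> 0"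
    using that by (rule W0_rellich[where u = u and G = G, OF W C])
  let ?v = "\<lambda>n. u (r n)" and ?H = "\<lambda>n. G (r n)"
  obtain w g l where wg: "\<And>n. mid_hull ?v ?H n (w n) (g n)" and l: "p_int M p l" "(\<lambda>n. p_mass M p (\<lambda>x. g n x - l x)) \<longlonglongrightarrow> 0"
    using that by (rule mid_hull_minimizing_limit[where v = ?v and H = ?H and C = C, OF W C(2)])
  have Wwg: "W0 (w n) (g n)" for n by (rule mid_hull_W0[OF wg W])
  have wv: "(\<lambda>n. p_mass M p (\<lambda>x. w n x - v x)) \<longlonglongrightarrow> 0"
  proof (rule LIMSEQ_I)
    fix e :: real assume e: "e > 0"
    obtain N where N: "\<And>n. n \<ge> N \<Longrightarrow> p_mass M p (\<lambda>x. u (r n) x - v x) < e / 2"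
      using order_tendstoD(2)[OF r(3), of "e / 2"] e by (auto simp: eventually_sequentially)
    have "p_mass M p (\<lambda>x. w n x - v x) \<le> e / 2" if "n \<ge> N" for n
      by (rule mid_hull_close[OF wg W r(2)]) (use N that in \<open>auto intro: less_imp_le order_trans\<close>)
    then show "\<exists>N. \<forall>n\<ge>N. norm (p_mass M p (\<lambda>x. w n x - v x) - 0) < e"
      using e by (intro exI[of _ N]) (force simp: p_mass_nonneg)
  qed
  have "W0 v l" by (rule W0_closed[OF Wwg r(2) l(1) wv l(2)])
  moreover have "(LINT x|M. Phi p (l x)) \<le> c"
    if ev: "eventually (\<lambda>n. (LINT x|M. Phi p (G (r n) x)) \<le> c) sequentially" for c
  proof -
    obtain N where N: "\<And>n. n \<ge> N \<Longrightarrow> (LINT x|M. Phi p (G (r n) x)) \<le> c" using ev by (auto simp: eventually_sequentially)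
    have gc: "(LINT x|M. Phi p (g n x)) \<le> c" if "n \<ge> N" for n
      by (rule mid_hull_Phi[OF wg W]) (use N that in auto)
    note gi = W0_p_int(2)[OF Wwg]
    obtain s where s: "strict_mono s" "AE x in M. (\<lambda>n. g (s n) x) \<longlonglongrightarrow> l x"
      using p_mass_AE_subseq[OF p(1) gi l] by metis
    show ?thesis
    proof (rule fatou_bound(2)[where k = "\<lambda>n x. Phi p (g (s n) x)"])
      show "AE x in M. (\<lambda>n. Phi p (g (s n) x)) \<longlonglongrightarrow> Phi p (l x)"
        using s(2)
      proof eventually_elim
        case (elim x)
        have "isCont (Phi p) (l x)" using continuous_on_Phi[OF p(1), where 'a = 'a] by (simp add: continuous_on_eq_continuous_at)
        then show ?case using elim by (rule isCont_tendsto_compose)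
      qed
      show "eventually (\<lambda>n. (LINT x|M. Phi p (g (s n) x)) \<le> c) sequentially"
        unfolding eventually_sequentially
      proof (intro exI allI impI)
        fix n assume "n \<ge> N"
        then show "(LINT x|M. Phi p (g (s n) x)) \<le> c" using gc seq_suble[OF s(1), of n] by simp
      qed
    qed (use Phi_integrable[OF gi] Phi_integrable[OF l(1)] in \<open>auto simp: Phi_nonneg\<close>)
  qed
  ultimately show ?thesis using that r(1,3) by blast
qed

end

section \<open>Caratheodory functions and their primitives\<close>

text \<open>Rounding \<open>s\<close> to multiples of \<open>1/(n + 1)\<close> gives countably many values,
  hence joint measurability, and continuity passes it to the limit.\<close>

lemma measurable_continuous_section:
  fixes g :: "'a \<Rightarrow> real \<Rightarrow> real"
  assumes cont: "\<And>x. continuous_on UNIV (g x)" and meas: "\<And>s. (\<lambda>x. g x s) \<in> borel_measurable M"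
  shows "(\<lambda>(x, s). g x s) \<in> borel_measurable (M \<Otimes>\<^sub>M borel)"
proof -
  define k where "k n s = real_of_int \<lfloor>real (Suc n) * s\<rfloor> / real (Suc n)" for n and s :: real
  have k: "(\<lambda>n. k n s) \<longlonglongrightarrow> s" for s
  proof (rule LIMSEQ_I)
    fix r :: real assume "r > 0"
    obtain N where N: "1 / real (Suc N) < r" using \<open>r > 0\<close> nat_approx_posE by blast
    have "norm (k n s - s) < r" if "n \<ge> N" for n
    proof -
      have "\<bar>real_of_int \<lfloor>real (Suc n) * s\<rfloor> - real (Suc n) * s\<bar> \<le> 1" by linarith
      then have "\<bar>real_of_int \<lfloor>real (Suc n) * s\<rfloor> - real (Suc n) * s\<bar> / real (Suc n) \<le> 1 / real (Suc n)"
        by (intro divide_right_mono) auto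
      moreover have "k n s - s = (real_of_int \<lfloor>real (Suc n) * s\<rfloor> - real (Suc n) * s) / real (Suc n)"
        by (simp add: k_def field_simps)
      moreover have "1 / real (Suc n) \<le> 1 / real (Suc N)" using that by (intro divide_left_mono) auto
      ultimately show ?thesis using N by simp
    qed
    then show "\<exists>no. \<forall>n\<ge>no. norm (k n s - s) < r" by blast
  qed
  have m: "(\<lambda>z. g (fst z) (k n (snd z))) \<in> borel_measurable (M \<Otimes>\<^sub>M borel)" for n
  proof -
    have fl: "(\<lambda>z::'a \<times> real. \<lfloor>real (Suc n) * snd z\<rfloor>) \<in> measurable (M \<Otimes>\<^sub>M borel) (count_space UNIV)"
      by measurable
    have "(\<lambda>z::'a \<times> real. g (fst z) (real_of_int j / real (Suc n))) \<in> borel_measurable (M \<Otimes>\<^sub>M borel)" for j :: int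
      by (rule measurable_compose[OF measurable_fst meas])
    from measurable_compose_countable[OF this fl] show ?thesis by (simp add: k_def)
  qed
  have "(\<lambda>z. g (fst z) (snd z)) \<in> borel_measurable (M \<Otimes>\<^sub>M borel)"
  proof (rule borel_measurable_LIMSEQ_real[OF _ m])
    fix z :: "'a \<times> real"
    have "isCont (g (fst z)) (snd z)" using cont[of "fst z"] by (simp add: continuous_on_eq_continuous_at)
    then show "(\<lambda>n. g (fst z) (k n (snd z))) \<longlonglongrightarrow> g (fst z) (snd z)" using k by (rule isCont_tendsto_compose)
  qed
  then show ?thesis by (simp add: split_def)
qed

text \<open>Redefining \<open>f\<close> on a null set makes every section continuous; completeness preserves
  measurability in \<open>x\<close>.\<close>

lemma caratheodory_regular_version:
  assumes \<Omega>: "\<Omega> \<in> sets lebesgue" and f: "caratheodory \<Omega> f"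
  obtains g where "\<And>x. continuous_on UNIV (g x)" "(\<lambda>(x, s). g x s) \<in> borel_measurable (lebesgue_on \<Omega> \<Otimes>\<^sub>M borel)"
    "AE x in lebesgue_on \<Omega>. f x = g x"
proof -
  define g where "g x = (if continuous_on UNIV (f x) then f x else (\<lambda>s. 0))" for x
  have c: "continuous_on UNIV (g x)" for x by (simp add: g_def)
  have ae: "AE x in lebesgue_on \<Omega>. f x = g x"
    using f unfolding caratheodory_def by (auto simp: g_def elim: eventually_mono)
  have "(\<lambda>x. g x s) \<in> borel_measurable (lebesgue_on \<Omega>)" for s
  proof (rule borel_measurable_lebesgue_on_AE[OF _ _ \<Omega>])
    show "(\<lambda>x. f x s) \<in> borel_measurable (lebesgue_on \<Omega>)" using f by (simp add: caratheodory_def)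
    show "AE x in lebesgue_on \<Omega>. f x s = g x s" using ae by eventually_elim simp
  qed
  from measurable_continuous_section[OF c this] show ?thesis using that c ae by blast
qed

lemma caratheodory_comp_measurable:
  fixes u :: "'a::euclidean_space \<Rightarrow> real"
  assumes \<Omega>: "\<Omega> \<in> sets lebesgue" and f: "caratheodory \<Omega> f" and u: "u \<in> borel_measurable (lebesgue_on \<Omega>)"
  shows "(\<lambda>x. f x (u x)) \<in> borel_measurable (lebesgue_on \<Omega>)"
proof -
  obtain g where g: "\<And>x. continuous_on UNIV (g x)" "(\<lambda>(x, s). g x s) \<in> borel_measurable (lebesgue_on \<Omega> \<Otimes>\<^sub>M borel)"
    "AE x in lebesgue_on \<Omega>. f x = g x" using caratheodory_regular_version[OF \<Omega> f] by blast
  have "(\<lambda>x. (x, u x)) \<in> measurable (lebesgue_on \<Omega>) (lebesgue_on \<Omega> \<Otimes>\<^sub>M borel)"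
    using u by (intro measurable_Pair measurable_ident_sets refl)
  from measurable_compose[OF this g(2)]
  have "(\<lambda>x. g x (u x)) \<in> borel_measurable (lebesgue_on \<Omega>)" by simp
  moreover have "AE x in lebesgue_on \<Omega>. g x (u x) = f x (u x)" using g(3) by eventually_elim simp
  ultimately show ?thesis using \<Omega> by (rule borel_measurable_lebesgue_on_AE)
qed

lemma primitive_eq:
  "primitive f x t = (if 0 \<le> t then (LINT s|lborel. indicator {0<..<t} s * f x s) else - (LINT s|lborel. indicator {t<..<0} s * f x s))"
  by (simp add: primitive_def interval_lebesgue_integral_def set_lebesgue_integral_def einterval_eq)

lemma primitive_comp_measurable:
  fixes u :: "'a::euclidean_space \<Rightarrow> real"
  assumes \<Omega>: "\<Omega> \<in> sets lebesgue" and f: "caratheodory \<Omega> f" and u: "u \<in> borel_measurable (lebesgue_on \<Omega>)"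
  shows "(\<lambda>x. primitive f x (u x)) \<in> borel_measurable (lebesgue_on \<Omega>)"
proof -
  let ?M = "lebesgue_on \<Omega>"
  obtain g where g: "\<And>x. continuous_on UNIV (g x)" "(\<lambda>(x, s). g x s) \<in> borel_measurable (?M \<Otimes>\<^sub>M borel)"
    "AE x in ?M. f x = g x" using caratheodory_regular_version[OF \<Omega> f] by blast
  note [measurable] = u
  have gm: "(\<lambda>z. g (fst z) (snd z)) \<in> borel_measurable (?M \<Otimes>\<^sub>M lborel)"
    using g(2) by (simp add: split_def cong: measurable_cong_sets sets_pair_measure_cong)
  have um: "(\<lambda>z. u (fst z)) \<in> borel_measurable (?M \<Otimes>\<^sub>M lborel)" by measurable
  have sm: "(\<lambda>z::'a \<times> real. snd z) \<in> borel_measurable (?M \<Otimes>\<^sub>M lborel)" by measurable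
  have i1: "(\<lambda>(x, s). indicator {0<..<u x} s * g x s) \<in> borel_measurable (?M \<Otimes>\<^sub>M lborel)"
  proof -
    have "{z \<in> space (?M \<Otimes>\<^sub>M lborel). 0 < snd z \<and> snd z < u (fst z)} \<in> sets (?M \<Otimes>\<^sub>M lborel)"
      using um sm by measurable
    then have "(\<lambda>z. if 0 < snd z \<and> snd z < u (fst z) then g (fst z) (snd z) else 0) \<in> borel_measurable (?M \<Otimes>\<^sub>M lborel)"
      using gm by (intro measurable_If) auto
    also have "(\<lambda>z. if 0 < snd z \<and> snd z < u (fst z) then g (fst z) (snd z) else 0) = (\<lambda>(x, s). indicator {0<..<u x} s * g x s)"
      by (auto simp: fun_eq_iff indicator_def)
    finally show ?thesis .
  qed
  have i2: "(\<lambda>(x, s). indicator {u x<..<0} s * g x s) \<in> borel_measurable (?M \<Otimes>\<^sub>M lborel)"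
  proof -
    have "{z \<in> space (?M \<Otimes>\<^sub>M lborel). u (fst z) < snd z \<and> snd z < 0} \<in> sets (?M \<Otimes>\<^sub>M lborel)"
      using um sm by measurable
    then have "(\<lambda>z. if u (fst z) < snd z \<and> snd z < 0 then g (fst z) (snd z) else 0) \<in> borel_measurable (?M \<Otimes>\<^sub>M lborel)"
      using gm by (intro measurable_If) auto
    also have "(\<lambda>z. if u (fst z) < snd z \<and> snd z < 0 then g (fst z) (snd z) else 0) = (\<lambda>(x, s). indicator {u x<..<0} s * g x s)"
      by (auto simp: fun_eq_iff indicator_def)
    finally show ?thesis .
  qed
  have pos: "{x \<in> space ?M. 0 \<le> u x} \<in> sets ?M" by measurable
  have "(\<lambda>x. primitive g x (u x)) \<in> borel_measurable ?M"
    unfolding primitive_eq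
    using pos lborel.borel_measurable_lebesgue_integral[OF i1] lborel.borel_measurable_lebesgue_integral[OF i2]
    by (intro measurable_If borel_measurable_uminus) simp_all
  moreover have "AE x in ?M. primitive g x (u x) = primitive f x (u x)"
    using g(3) by eventually_elim (simp add: primitive_def)
  ultimately show ?thesis using \<Omega> by (rule borel_measurable_lebesgue_on_AE)
qed

lemma primitive_DERIV:
  assumes "continuous_on UNIV (f x)"
  shows "(primitive f x has_real_derivative f x t) (at t)"
proof -
  define a where "a = - \<bar>t\<bar> - 1"
  define b where "b = \<bar>t\<bar> + 1"
  have ab: "a \<le> 0" "0 \<le> b" "a < t" "t < b" by (auto simp: a_def b_def)
  have "((\<lambda>v. LBINT y=ereal 0..ereal v. f x y) has_vector_derivative f x t) (at t within {a..b})"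
    using ab by (intro interval_integral_FTC2 continuous_on_subset[OF assms]) auto
  moreover have "at t within {a..b} = at t" using ab by (intro at_within_Icc_at) auto
  ultimately have "((\<lambda>v. LBINT y=ereal 0..ereal v. f x y) has_real_derivative f x t) (at t)"
    by (simp add: has_real_derivative_iff_has_vector_derivative)
  then show ?thesis by (simp add: primitive_def[abs_def])
qed

lemma primitive_0: "primitive f x 0 = 0"
  by (simp add: primitive_eq)

lemma primitive_increment:
  assumes "continuous_on UNIV (f x)"
  obtains \<xi> where "min s t \<le> \<xi>" "\<xi> \<le> max s t" "primitive f x t - primitive f x s = (t - s) * f x \<xi>"
proof -
  have *: "\<exists>\<xi>. min s t \<le> \<xi> \<and> \<xi> \<le> max s t \<and> primitive f x t - primitive f x s = (t - s) * f x \<xi>" if "s < t" for s t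
    using MVT2[OF that, of "primitive f x" "f x"] primitive_DERIV[of f x, OF assms] that
    by (auto intro!: less_imp_le)
  consider "s < t" | "t < s" | "s = t" by linarith
  then show ?thesis
  proof cases
    case 1 then show ?thesis using *[OF 1] that by blast
  next
    case 2
    obtain \<xi> where "min t s \<le> \<xi>" "\<xi> \<le> max t s" "primitive f x s - primitive f x t = (s - t) * f x \<xi>" using *[OF 2] by blast
    then show ?thesis using that[of \<xi>] by (simp add: min.commute max.commute algebra_simps)
  next
    case 3 then show ?thesis using that[of t] by simp
  qed
qed

text \<open>The mean value theorem with the intermediate point bounded by \<open>|u| + |v|\<close>.\<close>

lemma primitive_increment_bound:
  assumes "continuous_on UNIV (f x)" and bound: "\<And>s. \<bar>f x s\<bar> \<le> a * \<bar>s\<bar> powr q + b" and "a \<ge> 0" "q \<ge> 0"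
  shows "\<bar>primitive f x (u + v) - primitive f x u\<bar> \<le> (a * (\<bar>u\<bar> + \<bar>v\<bar>) powr q + b) * \<bar>v\<bar>"
proof -
  obtain \<xi> where \<xi>: "min u (u + v) \<le> \<xi>" "\<xi> \<le> max u (u + v)" "primitive f x (u + v) - primitive f x u = (u + v - u) * f x \<xi>"
    using primitive_increment[where f = f and x = x, OF assms(1)] by blast
  have "\<bar>\<xi>\<bar> \<le> \<bar>u\<bar> + \<bar>v\<bar>" using \<xi>(1,2) by (auto simp: min_def max_def abs_if split: if_splits)
  then have "a * \<bar>\<xi>\<bar> powr q \<le> a * (\<bar>u\<bar> + \<bar>v\<bar>) powr q" using assms by (intro mult_left_mono powr_mono2) auto
  then have "\<bar>f x \<xi>\<bar> \<le> a * (\<bar>u\<bar> + \<bar>v\<bar>) powr q + b" using bound[of \<xi>] by linarith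
  then have "\<bar>v\<bar> * \<bar>f x \<xi>\<bar> \<le> \<bar>v\<bar> * (a * (\<bar>u\<bar> + \<bar>v\<bar>) powr q + b)" by (rule mult_left_mono) simp
  then show ?thesis using \<xi>(3) by (simp add: abs_mult mult.commute)
qed

section \<open>Coercivity of the energy\<close>

text \<open>The upper limit may be \<open>-\<infinity>\<close>, so the inequality is checked on strict lower
  bounds of the left-hand side.\<close>

lemma e2ennreal_liminf_diff:
  fixes g c :: "nat \<Rightarrow> real"
  assumes c: "c \<longlonglongrightarrow> l"
  shows "e2ennreal (ereal l - limsup (\<lambda>n. ereal (g n))) \<le> liminf (\<lambda>n. ennreal (c n - g n))"
  unfolding le_Liminf_iff
proof (intro allI impI)
  let ?w = "limsup (\<lambda>n. ereal (g n))"
  fix y assume y: "y < e2ennreal (ereal l - ?w)"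
  then have "y < top" by (rule less_le_trans) simp
  then obtain r where r: "y = ennreal r" "r \<ge> 0" by (cases y) auto
  have "ereal r < ereal l - ?w"
  proof (rule ccontr)
    assume "\<not> ereal r < ereal l - ?w"
    then have "e2ennreal (ereal l - ?w) \<le> e2ennreal (ereal r)" by (intro e2ennreal_mono) simp
    then show False using y r by simp
  qed
  then have "?w < ereal (l - r)" by (cases ?w) auto
  then obtain d where d: "?w < ereal d" "ereal d < ereal (l - r)" using ereal_dense2 by blast
  have "eventually (\<lambda>n. ereal (g n) < ereal d) sequentially" using d(1) by (rule Limsup_lessD)
  moreover have "eventually (\<lambda>n. d + r < c n) sequentially"
    using d(2) by (intro order_tendstoD(1)[OF c]) simp
  ultimately show "eventually (\<lambda>n. y < ennreal (c n - g n)) sequentially"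
    by eventually_elim (use r in \<open>auto simp: ennreal_less_iff\<close>)
qed

text \<open>\<open>(\<alpha> - w) + w\<^sup>+ = \<alpha> + w\<^sup>-\<close> without subtraction of infinite
  quantities; for \<open>w = -\<infinity>\<close> both sides are infinite.\<close>

lemma e2ennreal_parts:
  assumes "w \<le> ereal \<alpha>" "\<alpha> \<ge> 0"
  shows "e2ennreal (ereal \<alpha> - w) + e2ennreal w = ennreal \<alpha> + e2ennreal (- w)"
proof (cases w)
  case (real r)
  then have "r \<le> \<alpha>" using assms by simp
  show ?thesis
  proof (cases "r \<ge> 0")
    case True
    then show ?thesis using real \<open>r \<le> \<alpha>\<close> by (simp add: ennreal_neg flip: ennreal_plus)
  next
    case False
    then show ?thesis using real assms by (simp add: ennreal_neg flip: ennreal_plus)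
  qed
qed (use assms in auto)

text \<open>The hypotheses in terms of pairs in \<open>W0\<close>. The nonresonance condition speaks of each
  normalized pair, for which positivity of the infimum in (iii) yields it.\<close>

locale resonance_problem = sobolev_space \<Omega> p for \<Omega> :: "'a::euclidean_space set" and p :: real +
  fixes f :: "'a \<Rightarrow> real \<Rightarrow> real" and a A :: real and b B h :: "'a \<Rightarrow> real"
  assumes f: "caratheodory \<Omega> f"
    and a: "a \<ge> 0" and b: "p_int M (crit / (crit - 1)) b"
    and growth: "AE x in M. \<forall>s. \<bar>f x s\<bar> \<le> a * \<bar>s\<bar> powr (crit - 1) + b x"
    and A: "A \<ge> 0" and B: "integrable M B"
    and upper: "AE x in M. \<forall>s. primitive f x s \<le> A * \<bar>s\<bar> powr p + B x"
    and h: "p_int M (p / (p - 1)) h"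
    and nonresonance: "\<And>v H. W0 v H \<Longrightarrow> p_mass M p v = 1 \<Longrightarrow>
      0 < ereal (LINT x|M. Phi p (H x)) - ereal_integral (lebesgue_on {x \<in> \<Omega>. v x \<noteq> 0}) (\<lambda>x. A_inf p f x * ereal (\<bar>v x\<bar> powr p))"
begin

lemma crit_gt_1: "crit > 1" using crit_gt p by simp

lemma f_continuous: "AE x in M. continuous_on UNIV (f x)"
  using f by (simp add: caratheodory_def)

text \<open>Dominates \<open>(F(x, u + tw) - F(x, u))/t\<close> for \<open>0 < t \<le> 1\<close> as well as
  \<open>f(x,u) w\<close>.\<close>

definition increment_majorant :: "('a \<Rightarrow> real) \<Rightarrow> ('a \<Rightarrow> real) \<Rightarrow> 'a \<Rightarrow> real" where
  "increment_majorant u w x = (a * (\<bar>u x\<bar> + \<bar>w x\<bar>) powr (crit - 1) + b x) * \<bar>w x\<bar>"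

text \<open>Here the critical growth meets the Sobolev exponent: \<open>s\<^sup>c\<^sup>-\<^sup>1 |w| \<le>
  s\<^sup>c + |w|\<^sup>c\<close> for the critical exponent \<open>c\<close>, and \<open>b\<close>
  pairs with \<open>w\<close> by duality.\<close>

lemma increment_majorant_integrable:
  assumes "p_int M crit u" "p_int M crit w"
  shows "integrable M (increment_majorant u w)"
proof -
  have s: "p_int M crit (\<lambda>x. \<bar>u x\<bar> + \<bar>w x\<bar>)"
    using p_int_add(1)[OF crit_gt_1, of M "\<lambda>x. \<bar>u x\<bar>" "\<lambda>x. \<bar>w x\<bar>"] assms
    by (simp add: p_int_def borel_measurable_add borel_measurable_abs)
  have [measurable]: "u \<in> borel_measurable M" "w \<in> borel_measurable M" "b \<in> borel_measurable M"
    using assms b by (auto simp: p_int_def)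
  have w: "p_int M crit (\<lambda>x. \<bar>w x\<bar>)" using assms(2) by (simp add: p_int_def)
  have i1: "integrable M (\<lambda>x. (\<bar>u x\<bar> + \<bar>w x\<bar>) powr (crit - 1) * \<bar>w x\<bar>)"
  proof (rule Bochner_Integration.integrable_bound)
    show "integrable M (\<lambda>x. norm (\<bar>u x\<bar> + \<bar>w x\<bar>) powr crit + norm (w x) powr crit)"
      using s assms(2) by (auto simp: p_int_def)
    show "AE x in M. norm ((\<bar>u x\<bar> + \<bar>w x\<bar>) powr (crit - 1) * \<bar>w x\<bar>) \<le> norm (norm (\<bar>u x\<bar> + \<bar>w x\<bar>) powr crit + norm (w x) powr crit)"
    proof (rule AE_I2)
      fix x
      show "norm ((\<bar>u x\<bar> + \<bar>w x\<bar>) powr (crit - 1) * \<bar>w x\<bar>) \<le> norm (norm (\<bar>u x\<bar> + \<bar>w x\<bar>) powr crit + norm (w x) powr crit)"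
        using powr_mult_le_add[OF crit_gt_1, of "\<bar>u x\<bar> + \<bar>w x\<bar>" "\<bar>w x\<bar>"] by simp
    qed
  qed measurable
  have i2: "integrable M (\<lambda>x. b x * \<bar>w x\<bar>)" by (rule dual_pairing_integrable[OF crit_gt_1 b w])
  have "integrable M (\<lambda>x. a * ((\<bar>u x\<bar> + \<bar>w x\<bar>) powr (crit - 1) * \<bar>w x\<bar>) + b x * \<bar>w x\<bar>)"
    using i1 i2 by simp
  then show ?thesis by (simp add: increment_majorant_def[abs_def] algebra_simps)
qed

lemma primitive_increment_le_majorant:
  "AE x in M. \<forall>s t. \<bar>primitive f x (s + t) - primitive f x s\<bar> \<le> (a * (\<bar>s\<bar> + \<bar>t\<bar>) powr (crit - 1) + b x) * \<bar>t\<bar>"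
  using f_continuous growth
proof eventually_elim
  case (elim x)
  then show ?case using primitive_increment_bound[where f = f and x = x and q = "crit - 1"] a crit_gt_1 by simp
qed

lemma primitive_measurable:
  "u \<in> borel_measurable M \<Longrightarrow> (\<lambda>x. primitive f x (u x)) \<in> borel_measurable M"
  by (rule primitive_comp_measurable[OF dom_sets f])

lemma primitive_integrable:
  assumes "p_int M crit u" shows "integrable M (\<lambda>x. primitive f x (u x))"
proof (rule Bochner_Integration.integrable_bound)
  have z: "p_int M crit (\<lambda>x::'a. 0::real)" using crit_gt_1 by (simp add: p_int_def)
  show "integrable M (increment_majorant (\<lambda>x. 0) u)" by (rule increment_majorant_integrable[OF z assms])
  show "(\<lambda>x. primitive f x (u x)) \<in> borel_measurable M" by (intro primitive_measurable p_int_measurable[OF assms])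
  show "AE x in M. norm (primitive f x (u x)) \<le> norm (increment_majorant (\<lambda>x. 0) u x)"
    using primitive_increment_le_majorant
  proof eventually_elim
    case (elim x)
    from elim[rule_format, of 0 "u x"] have "\<bar>primitive f x (u x)\<bar> \<le> increment_majorant (\<lambda>x. 0) u x"
      by (simp add: increment_majorant_def primitive_0)
    then show ?case by simp
  qed
qed

lemma primitive_integral_le:
  assumes "W0 u G"
  shows "(LINT x|M. primitive f x (u x)) \<le> A * p_mass M p u + (LINT x|M. B x)"
proof -
  note u = p_int_integrable[OF W0_p_int(1)[OF assms]]
  have "(LINT x|M. primitive f x (u x)) \<le> (LINT x|M. A * norm (u x) powr p + B x)"
    using primitive_integrable[OF W0_crit_integrable[OF assms]] u B upper
    by (intro integral_mono_AE) (auto elim!: eventually_mono)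
  also have "\<dots> = A * p_mass M p u + (LINT x|M. B x)" using u B by (simp add: p_mass_def)
  finally show ?thesis .
qed

definition energy :: "('a \<Rightarrow> real) \<Rightarrow> ('a \<Rightarrow> 'a) \<Rightarrow> real" where
  "energy u G = (LINT x|M. Phi p (G x)) - (LINT x|M. primitive f x (u x)) - (LINT x|M. h x * u x)"

lemma p_mass_le_Phi:
  assumes "p_int M p (G :: 'a \<Rightarrow> 'a)"
  shows "p_mass M p G \<le> 2 powr p * ((LINT x|M. Phi p (G x)) + measure M (space M))"
proof -
  have "p_mass M p G \<le> (LINT x|M. 2 powr p * (Phi p (G x) + 1))"
    unfolding p_mass_def using Phi_integrable[OF assms] p_int_integrable[OF assms] norm_powr_le_Phi[OF p(1)]
    by (intro integral_mono) auto
  also have "\<dots> = 2 powr p * ((LINT x|M. Phi p (G x)) + measure M (space M))"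
    using Phi_integrable[OF assms] by simp
  finally show ?thesis .
qed

text \<open>\<open>F(x, t\<^sub>n v\<^sub>n)/t\<^sub>n\<^sup>p\<close> is \<open>|v\<^sub>n|\<^sup>p\<close>
  times the quotient defining \<open>A_inf\<close> at \<open>t\<^sub>n v\<^sub>n\<close>, and
  \<open>|t\<^sub>n v\<^sub>n|\<close> tends to infinity.\<close>

lemma limsup_primitive_le:
  assumes t: "filterlim t at_top sequentially" and v: "v \<longlonglongrightarrow> v0" "v0 \<noteq> 0" and t0: "\<And>n. t n > 0"
  shows "limsup (\<lambda>n. ereal (primitive f x (t n * v n) / t n powr p)) \<le> A_inf p f x * ereal (\<bar>v0\<bar> powr p)"
proof -
  define Q where "Q s = ereal (primitive f x s / \<bar>s\<bar> powr p)" for s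
  have inf: "filterlim (\<lambda>n. t n * v n) at_infinity sequentially"
    using tendsto_mult_filterlim_at_infinity[OF v filterlim_at_top_imp_at_infinity[OF t]] by (simp add: mult.commute)
  have "limsup (\<lambda>n. Q (t n * v n)) \<le> A_inf p f x"
    unfolding Limsup_le_iff
  proof (intro allI impI)
    fix y assume "y > A_inf p f x"
    then have "eventually (\<lambda>s. Q s < y) at_infinity"
      unfolding A_inf_def Q_def by (rule Limsup_lessD)
    then show "eventually (\<lambda>n. Q (t n * v n) < y) sequentially"
      using inf by (rule eventually_compose_filterlim)
  qed
  moreover have "limsup (\<lambda>n. ereal (\<bar>v n\<bar> powr p) * Q (t n * v n)) = ereal (\<bar>v0\<bar> powr p) * limsup (\<lambda>n. Q (t n * v n))"
  proof (rule ereal_limsup_lim_mult)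
    show "(\<lambda>n. ereal (\<bar>v n\<bar> powr p)) \<longlonglongrightarrow> ereal (\<bar>v0\<bar> powr p)"
      using v by (intro tendsto_ereal tendsto_powr tendsto_rabs tendsto_const) auto
  qed (use v in auto)
  moreover have "limsup (\<lambda>n. ereal (primitive f x (t n * v n) / t n powr p)) = limsup (\<lambda>n. ereal (\<bar>v n\<bar> powr p) * Q (t n * v n))"
  proof (rule Limsup_eq)
    have "eventually (\<lambda>n. v n \<noteq> 0) sequentially" using v by (rule tendsto_imp_eventually_ne)
    then show "eventually (\<lambda>n. ereal (primitive f x (t n * v n) / t n powr p) = ereal (\<bar>v n\<bar> powr p) * Q (t n * v n)) sequentially"
    proof eventually_elim
      case (elim n)
      then have "\<bar>t n * v n\<bar> powr p = t n powr p * \<bar>v n\<bar> powr p" using t0[of n] by (simp add: abs_mult powr_mult)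
      then show ?case using elim by (simp add: Q_def)
    qed
  qed
  ultimately have "limsup (\<lambda>n. ereal (primitive f x (t n * v n) / t n powr p)) = ereal (\<bar>v0\<bar> powr p) * limsup (\<lambda>n. Q (t n * v n))"
    "limsup (\<lambda>n. Q (t n * v n)) \<le> A_inf p f x" by simp_all
  then show ?thesis by (simp add: mult.commute[of "A_inf p f x"] ereal_mult_left_mono)
qed

text \<open>The core of coercivity. Fatou's lemma is applied to \<open>A|v\<^sub>n|\<^sup>p +
  B/t\<^sub>n\<^sup>p - F(x, t\<^sub>n v\<^sub>n)/t\<^sub>n\<^sup>p \<ge> 0\<close>. The argument
  compares positive and negative parts of the measurable function \<open>wt\<close>, the upper
  limit of the quotients, and passes to \<open>A_inf\<close> only at the end, by monotonicity of
  each part.\<close>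

lemma recession_contradiction:
  assumes W: "\<And>n. W0 (v n) (K n)" and one: "\<And>n. p_mass M p (v n) = 1"
    and t: "filterlim t at_top sequentially" "\<And>n. t n \<ge> 1"
    and \<epsilon>: "\<epsilon> \<longlonglongrightarrow> 0"
    and le: "\<And>n. (LINT x|M. Phi p (K n x)) \<le> (LINT x|M. primitive f x (t n * v n x) / t n powr p) + \<epsilon> n"
  shows False
proof -
  define b0 where "b0 = (LINT x|M. \<bar>B x\<bar>)"
  have b0: "b0 \<ge> 0" "(LINT x|M. B x) \<le> b0" unfolding b0_def using B by (auto intro!: integral_mono)
  have tp: "t n powr p \<ge> 1" for n using t(2)[of n] p by (simp add: ge_one_powr_ge_zero)
  have Wt: "W0 (\<lambda>x. t n * v n x) (\<lambda>x. t n *\<^sub>R K n x)" for n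
    using W0_lincomb[OF W[of n] W[of n], of "t n" 0] by simp
  have iF: "integrable M (\<lambda>x. primitive f x (t n * v n x) / t n powr p)" for n
    using primitive_integrable[OF W0_crit_integrable[OF Wt[of n]]] by simp
  have Fle: "(LINT x|M. primitive f x (t n * v n x) / t n powr p) \<le> A + b0" for n
  proof -
    have "(LINT x|M. primitive f x (t n * v n x)) \<le> A * p_mass M p (\<lambda>x. t n * v n x) + (LINT x|M. B x)"
      by (rule primitive_integral_le[OF Wt])
    also have "p_mass M p (\<lambda>x. t n * v n x) = t n powr p"
      using p_int_scaleR(2)[OF W0_p_int(1)[OF W[of n]], of "t n"] one[of n] t(2)[of n] by simp
    finally have "(LINT x|M. primitive f x (t n * v n x)) / t n powr p \<le> (A * t n powr p + b0) / t n powr p"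
      using b0 by (intro divide_right_mono) auto
    also have "\<dots> = A + b0 / t n powr p"
    proof -
      have "t n \<noteq> 0" using t(2)[of n] by linarith
      then show ?thesis by (simp add: add_divide_distrib)
    qed
    also have "\<dots> \<le> A + b0" using tp[of n] b0 by (simp add: divide_le_eq mult_le_cancel_left1)
    finally show ?thesis by simp
  qed
  obtain E where E: "\<And>n. \<bar>\<epsilon> n\<bar> \<le> E" using convergent_imp_Bseq[OF convergentI[OF \<epsilon>]] by (auto simp: Bseq_def)
  have Phi_bd: "(LINT x|M. Phi p (K n x)) \<le> A + b0 + E" for n
    using le[of n] Fle[of n] E[of n] by linarith
  have "bounded (range (\<lambda>n. LINT x|M. Phi p (K n x)))"
    unfolding bounded_iff using Phi_bd by (auto intro!: exI[of _ "A + b0 + E"] simp: Phi_nonneg)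
  \<comment> \<open>the integrals are made convergent first, so that later subsequences keep the same limit\<close>
  then obtain \<phi> r0 where r0: "strict_mono r0" "(\<lambda>n. LINT x|M. Phi p (K (r0 n) x)) \<longlonglongrightarrow> \<phi>"
    using bounded_imp_convergent_subsequence[of "\<lambda>n. LINT x|M. Phi p (K n x)"] by (auto simp: o_def)
  define C where "C = max 1 (2 powr p * (A + b0 + E + measure M (space M)))"
  have C: "p_mass M p (v (r0 n)) \<le> C" "p_mass M p (K (r0 n)) \<le> C" for n
  proof -
    show "p_mass M p (v (r0 n)) \<le> C" by (simp add: one C_def)
    have "p_mass M p (K (r0 n)) \<le> 2 powr p * ((LINT x|M. Phi p (K (r0 n) x)) + measure M (space M))"
      by (rule p_mass_le_Phi[OF W0_p_int(2)[OF W]])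
    also have "\<dots> \<le> 2 powr p * (A + b0 + E + measure M (space M))"
      using Phi_bd by (intro mult_left_mono add_right_mono) auto
    finally show "p_mass M p (K (r0 n)) \<le> C" by (simp add: C_def)
  qed
  obtain r1 :: "nat \<Rightarrow> nat" and w H where r1: "strict_mono r1" "W0 w H" "(\<lambda>n. p_mass M p (\<lambda>x. v (r0 (r1 n)) x - w x)) \<longlonglongrightarrow> 0"
    and lsc: "\<forall>c. eventually (\<lambda>n. (LINT x|M. Phi p (K (r0 (r1 n)) x)) \<le> c) sequentially \<longrightarrow> (LINT x|M. Phi p (H x)) \<le> c"
    by (rule W0_compactness[where u = "\<lambda>n. v (r0 n)" and G = "\<lambda>n. K (r0 n)", OF W C]) blast
  have wi: "p_int M p w" by (rule W0_p_int(1)[OF r1(2)])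
  have vi: "p_int M p (v n)" for n by (rule W0_p_int(1)[OF W])
  have w1: "p_mass M p w = 1"
    using LIMSEQ_unique[OF tendsto_p_mass[OF p(1) vi wi r1(3)]] by (simp add: one)
  obtain s where s: "strict_mono s" "AE x in M. (\<lambda>n. v (r0 (r1 (s n))) x) \<longlonglongrightarrow> w x"
    using p_mass_AE_subseq[OF p(1) vi wi r1(3)] by metis
  define \<sigma> where "\<sigma> n = r0 (r1 (s n))" for n
  have \<sigma>: "strict_mono \<sigma>" unfolding \<sigma>_def using r0(1) r1(1) s(1) by (auto simp: strict_mono_def)
  have lim_Phi1: "(\<lambda>n. LINT x|M. Phi p (K (r0 (r1 n)) x)) \<longlonglongrightarrow> \<phi>"
    using LIMSEQ_subseq_LIMSEQ[OF r0(2) r1(1)] by (simp add: o_def)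
  have lim_Phi: "(\<lambda>n. LINT x|M. Phi p (K (\<sigma> n) x)) \<longlonglongrightarrow> \<phi>"
    using LIMSEQ_subseq_LIMSEQ[OF lim_Phi1 s(1)] by (simp add: o_def \<sigma>_def)
  have I_le: "(LINT x|M. Phi p (H x)) \<le> \<phi>"
  proof (rule field_le_epsilon)
    fix e :: real assume "e > 0"
    then have "eventually (\<lambda>n. (LINT x|M. Phi p (K (r0 (r1 n)) x)) < \<phi> + e) sequentially"
      by (intro order_tendstoD(2)[OF lim_Phi1]) simp
    then show "(LINT x|M. Phi p (H x)) \<le> \<phi> + e" by (intro lsc[rule_format]) (auto elim: eventually_mono)
  qed
  have t\<sigma>: "filterlim (\<lambda>n. t (\<sigma> n)) at_top sequentially"
    using filterlim_compose[OF t(1) filterlim_subseq[OF \<sigma>]] .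
  have tpinf: "(\<lambda>n. 1 / t (\<sigma> n) powr p) \<longlonglongrightarrow> 0"
    using tendsto_neg_powr[of "- p", OF _ t\<sigma>] p by (simp add: powr_minus_divide)
  define g where "g n x = primitive f x (t (\<sigma> n) * v (\<sigma> n) x) / t (\<sigma> n) powr p" for n x
  define c where "c n x = A * \<bar>v (\<sigma> n) x\<bar> powr p + B x * (1 / t (\<sigma> n) powr p)" for n x
  have gi: "integrable M (g n)" for n unfolding g_def by (rule iF)
  have ci: "integrable M (c n)" for n
    using p_int_integrable[OF vi[of "\<sigma> n"]] B unfolding c_def by simp
  have gc: "AE x in M. g n x \<le> c n x" for n
    using upper
  proof eventually_elim
    case (elim x)
    have "primitive f x (t (\<sigma> n) * v (\<sigma> n) x) \<le> A * \<bar>t (\<sigma> n) * v (\<sigma> n) x\<bar> powr p + B x" using elim by blast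
    also have "\<bar>t (\<sigma> n) * v (\<sigma> n) x\<bar> powr p = t (\<sigma> n) powr p * \<bar>v (\<sigma> n) x\<bar> powr p"
      using t(2)[of "\<sigma> n"] by (simp add: abs_mult powr_mult)
    finally have "g n x \<le> (A * (t (\<sigma> n) powr p * \<bar>v (\<sigma> n) x\<bar> powr p) + B x) / t (\<sigma> n) powr p"
      unfolding g_def by (intro divide_right_mono) auto
    also have "\<dots> = c n x"
    proof -
      have "t (\<sigma> n) \<noteq> 0" using t(2)[of "\<sigma> n"] by linarith
      then show ?thesis by (simp add: c_def add_divide_distrib)
    qed
    finally show ?case .
  qed
  define wt where "wt x = limsup (\<lambda>n. ereal (g n x))" for x
  have [measurable]: "g n \<in> borel_measurable M" "c n \<in> borel_measurable M" "w \<in> borel_measurable M" for n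
    using gi ci wi by (auto simp: p_int_def)
  have wtm [measurable]: "wt \<in> borel_measurable M" unfolding wt_def by measurable
  have e2m: "(\<lambda>x. e2ennreal (q x)) \<in> borel_measurable M" if "q \<in> borel_measurable M" for q :: "'a \<Rightarrow> ereal"
    using measurable_compose[OF that borel_measurable_continuous_onI[OF continuous_on_e2ennreal]] .
  define \<alpha> where "\<alpha> x = A * \<bar>w x\<bar> powr p" for x
  have \<alpha>0: "\<alpha> x \<ge> 0" for x using A by (simp add: \<alpha>_def)
  have [measurable]: "\<alpha> \<in> borel_measurable M" unfolding \<alpha>_def by measurable
  have \<alpha>int: "(\<integral>\<^sup>+x. ennreal (\<alpha> x) \<partial>M) = ennreal A"
  proof -
    have "integrable M \<alpha>" using p_int_integrable[OF wi] unfolding \<alpha>_def by simp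
    then have "(\<integral>\<^sup>+x. ennreal (\<alpha> x) \<partial>M) = ennreal (LINT x|M. \<alpha> x)" using \<alpha>0 by (intro nn_integral_eq_integral) auto
    also have "(LINT x|M. \<alpha> x) = A" using w1 by (simp add: \<alpha>_def p_mass_def)
    finally show ?thesis .
  qed
  have clim: "AE x in M. (\<lambda>n. c n x) \<longlonglongrightarrow> \<alpha> x"
    using s(2)
  proof eventually_elim
    case (elim x)
    then have "(\<lambda>n. v (\<sigma> n) x) \<longlonglongrightarrow> w x" by (simp add: \<sigma>_def)
    then have "(\<lambda>n. c n x) \<longlonglongrightarrow> A * \<bar>w x\<bar> powr p + B x * 0"
      unfolding c_def using p tpinf by (intro tendsto_intros tendsto_powr') auto
    then show ?case by (simp add: \<alpha>_def)
  qed
  define \<beta> where "\<beta> n = A + b0 * (1 / t (\<sigma> n) powr p) + \<epsilon> (\<sigma> n) - (LINT x|M. Phi p (K (\<sigma> n) x))" for n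
  have \<beta>lim: "\<beta> \<longlonglongrightarrow> A - \<phi>"
  proof -
    have "\<beta> \<longlonglongrightarrow> A + b0 * 0 + 0 - \<phi>"
      unfolding \<beta>_def using tpinf LIMSEQ_subseq_LIMSEQ[OF \<epsilon> \<sigma>] lim_Phi
      by (intro tendsto_intros) (auto simp: o_def)
    then show ?thesis by simp
  qed
  have int_le: "(\<integral>\<^sup>+x. ennreal (c n x - g n x) \<partial>M) \<le> ennreal (\<beta> n)" and \<beta>0: "0 \<le> \<beta> n" for n
  proof -
    have ae: "AE x in M. 0 \<le> c n x - g n x" using gc[of n] by eventually_elim simp
    have "(\<integral>\<^sup>+x. ennreal (c n x - g n x) \<partial>M) = ennreal (LINT x|M. c n x - g n x)"
      using ae ci gi by (intro nn_integral_eq_integral) auto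
    moreover have "(LINT x|M. c n x - g n x) \<le> \<beta> n"
    proof -
      have "(LINT x|M. c n x) = A * p_mass M p (v (\<sigma> n)) + (LINT x|M. B x) * (1 / t (\<sigma> n) powr p)"
        using p_int_integrable[OF vi[of "\<sigma> n"]] B unfolding c_def p_mass_def by simp
      also have "\<dots> \<le> A + b0 * (1 / t (\<sigma> n) powr p)"
        unfolding one using b0 by (intro add_mono mult_right_mono) auto
      finally have "(LINT x|M. c n x) \<le> A + b0 * (1 / t (\<sigma> n) powr p)" .
      then show ?thesis using ci gi le[of "\<sigma> n"] by (simp add: \<beta>_def g_def[symmetric])
    qed
    moreover have "0 \<le> (LINT x|M. c n x - g n x)" using ae by (rule integral_nonneg_AE)
    ultimately show "(\<integral>\<^sup>+x. ennreal (c n x - g n x) \<partial>M) \<le> ennreal (\<beta> n)" "0 \<le> \<beta> n"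
      by (auto intro: ennreal_leI)
  qed
  \<comment> \<open>excludes that \<open>ennreal (A - \<phi>)\<close> is zero by truncation\<close>
  have A\<phi>: "A - \<phi> \<ge> 0" using \<beta>lim \<beta>0 by (intro LIMSEQ_le_const) auto
  have fatou: "(\<integral>\<^sup>+x. e2ennreal (ereal (\<alpha> x) - wt x) \<partial>M) \<le> ennreal (A - \<phi>)"
  proof -
    have "(\<integral>\<^sup>+x. e2ennreal (ereal (\<alpha> x) - wt x) \<partial>M) \<le> (\<integral>\<^sup>+x. liminf (\<lambda>n. ennreal (c n x - g n x)) \<partial>M)"
      using clim by (intro nn_integral_mono_AE, eventually_elim) (simp add: wt_def e2ennreal_liminf_diff)
    also have "\<dots> \<le> liminf (\<lambda>n. \<integral>\<^sup>+x. ennreal (c n x - g n x) \<partial>M)"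
      by (intro nn_integral_liminf) measurable
    also have "\<dots> \<le> liminf (\<lambda>n. ennreal (\<beta> n))"
      by (intro Liminf_mono always_eventually allI int_le)
    also have "\<dots> = ennreal (A - \<phi>)"
      using \<beta>lim by (intro lim_imp_Liminf tendsto_ennrealI) auto
    finally show ?thesis .
  qed
  define S where "S = {x \<in> \<Omega>. w x \<noteq> 0}"
  have SM: "S \<in> sets M"
  proof -
    have "{x \<in> space M. w x \<noteq> 0} \<in> sets M" by measurable
    then show ?thesis by (simp add: S_def)
  qed
  have SL: "S \<in> sets lebesgue" using SM dom_sets by (simp add: sets_restrict_space_iff)
  have onS: "(\<integral>\<^sup>+x. q x \<partial>lebesgue_on S) = (\<integral>\<^sup>+x. q x * indicator S x \<partial>M)" for q :: "'a \<Rightarrow> ennreal"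
  proof -
    have "(\<integral>\<^sup>+x. q x * indicator S x \<partial>M) = (\<integral>\<^sup>+x. q x * indicator S x * indicator \<Omega> x \<partial>lebesgue)"
      using dom_sets by (subst nn_integral_restrict_space) auto
    also have "\<dots> = (\<integral>\<^sup>+x. q x * indicator S x \<partial>lebesgue)"
      by (intro nn_integral_cong) (auto simp: S_def indicator_def)
    also have "\<dots> = (\<integral>\<^sup>+x. q x \<partial>lebesgue_on S)" using SL by (subst nn_integral_restrict_space) auto
    finally show ?thesis by simp
  qed
  have wt_le_\<alpha>: "AE x in M. wt x \<le> ereal (\<alpha> x)"
  proof -
    have gc': "AE x in M. \<forall>n. g n x \<le> c n x" using gc by (simp add: AE_all_countable)
    show ?thesis using clim gc'
    proof eventually_elim
      case (elim x)
      have "wt x \<le> limsup (\<lambda>n. ereal (c n x))" unfolding wt_def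
        using elim(2) by (intro Limsup_mono always_eventually) simp
      also have "\<dots> = ereal (\<alpha> x)" using elim(1) by (intro lim_imp_Limsup tendsto_ereal) auto
      finally show ?case .
    qed
  qed
  define P where "P = (\<integral>\<^sup>+x. e2ennreal (wt x) * indicator S x \<partial>M)"
  define Nn where "Nn = (\<integral>\<^sup>+x. e2ennreal (- wt x) * indicator S x \<partial>M)"
  have Pfin: "P \<le> ennreal A"
  proof -
    have "P \<le> (\<integral>\<^sup>+x. ennreal (\<alpha> x) \<partial>M)" unfolding P_def
      using wt_le_\<alpha>
    proof (intro nn_integral_mono_AE, eventually_elim)
      case (elim x)
      from e2ennreal_mono[OF elim(2)] show ?case by (auto simp: indicator_def)
    qed
    then show ?thesis by (simp add: \<alpha>int)
  qed
  have dm: "(\<lambda>x. ereal (\<alpha> x) - wt x) \<in> borel_measurable M" and um: "(\<lambda>x. - wt x) \<in> borel_measurable M"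
    by measurable
  have am: "(\<lambda>x. ennreal (\<alpha> x)) \<in> borel_measurable M" by measurable
  have ind: "(indicator S :: 'a \<Rightarrow> ennreal) \<in> borel_measurable M"
    using SM by (rule borel_measurable_indicator)
  have sum_eq: "(\<integral>\<^sup>+x. e2ennreal (ereal (\<alpha> x) - wt x) * indicator S x \<partial>M) + P = ennreal A + Nn"
  proof -
    have "(\<integral>\<^sup>+x. e2ennreal (ereal (\<alpha> x) - wt x) * indicator S x \<partial>M) + P
      = (\<integral>\<^sup>+x. e2ennreal (ereal (\<alpha> x) - wt x) * indicator S x + e2ennreal (wt x) * indicator S x \<partial>M)"
      unfolding P_def by (intro nn_integral_add[symmetric] borel_measurable_times_ennreal e2m dm wtm ind)
    also have "\<dots> = (\<integral>\<^sup>+x. ennreal (\<alpha> x) * indicator S x + e2ennreal (- wt x) * indicator S x \<partial>M)"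
      using wt_le_\<alpha>
    proof (intro nn_integral_cong_AE, eventually_elim)
      case (elim x)
      show ?case using e2ennreal_parts[OF elim(2) \<alpha>0] by (auto simp: indicator_def)
    qed
    also have "\<dots> = (\<integral>\<^sup>+x. ennreal (\<alpha> x) * indicator S x \<partial>M) + Nn"
      unfolding Nn_def by (intro nn_integral_add borel_measurable_times_ennreal e2m um am ind)
    \<comment> \<open>\<open>\<alpha>\<close> vanishes where \<open>w\<close> does\<close>
    also have "(\<integral>\<^sup>+x. ennreal (\<alpha> x) * indicator S x \<partial>M) = (\<integral>\<^sup>+x. ennreal (\<alpha> x) \<partial>M)"
      using p by (intro nn_integral_cong) (auto simp: S_def indicator_def \<alpha>_def)
    finally show ?thesis by (simp add: \<alpha>int)
  qed
  have "ennreal A + Nn \<le> ennreal (A - \<phi>) + P"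
    unfolding sum_eq[symmetric]
  proof (intro add_right_mono order_trans[OF _ fatou] nn_integral_mono)
    show "e2ennreal (ereal (\<alpha> x) - wt x) * indicator S x \<le> e2ennreal (ereal (\<alpha> x) - wt x)" for x
      by (auto simp: indicator_def)
  qed
  moreover obtain Pr where Pr: "P = ennreal Pr" "Pr \<ge> 0" using Pfin by (cases P) (auto simp: top_unique)
  ultimately obtain Nr where Nr: "Nn = ennreal Nr" "Nr \<ge> 0" by (cases Nn) (auto simp: top_unique simp flip: ennreal_plus)
  have real_le: "\<phi> \<le> Pr - Nr"
    using \<open>ennreal A + Nn \<le> ennreal (A - \<phi>) + P\<close> Pr Nr A A\<phi> by (simp add: ennreal_le_iff flip: ennreal_plus)
  define \<omega> where "\<omega> x = A_inf p f x * ereal (\<bar>w x\<bar> powr p)" for x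
  have WW: "AE x in M. x \<in> S \<longrightarrow> wt x \<le> \<omega> x"
    using s(2)
  proof eventually_elim
    case (elim x)
    then have "(\<lambda>n. v (\<sigma> n) x) \<longlonglongrightarrow> w x" by (simp add: \<sigma>_def)
    moreover have "t (\<sigma> n) > 0" for n using t(2)[of "\<sigma> n"] by simp
    ultimately show ?case unfolding wt_def \<omega>_def g_def
      by (intro impI limsup_primitive_le[OF t\<sigma>]) (auto simp: S_def)
  qed
  define P' where "P' = (\<integral>\<^sup>+x. e2ennreal (\<omega> x) \<partial>lebesgue_on S)"
  define N' where "N' = (\<integral>\<^sup>+x. e2ennreal (- \<omega> x) \<partial>lebesgue_on S)"
  have P'ge: "P \<le> P'" unfolding P_def P'_def onS using WW
  proof (intro nn_integral_mono_AE, eventually_elim)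
    case (elim x)
    from elim(2) show ?case using e2ennreal_mono[of "wt x" "\<omega> x"] by (auto simp: indicator_def)
  qed
  have N'le: "N' \<le> Nn" unfolding Nn_def N'_def onS using WW
  proof (intro nn_integral_mono_AE, eventually_elim)
    case (elim x)
    from elim(2) show ?case using e2ennreal_mono[of "- \<omega> x" "- wt x"] by (auto simp: indicator_def)
  qed
  obtain N'r where N'r: "N' = ennreal N'r" "N'r \<ge> 0" "N'r \<le> Nr"
    using N'le Nr by (cases N') (auto simp: top_unique)
  have nr: "0 < ereal (LINT x|M. Phi p (H x)) - (enn2ereal P' - enn2ereal N')"
    using nonresonance[OF r1(2) w1] unfolding ereal_integral_def P'_def N'_def S_def \<omega>_def .
  show False
  proof (cases P')
    case (real P'r)
    then have "Pr \<le> P'r" using P'ge Pr by simp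
    then show False using nr real N'r I_le real_le by simp
  next
    case top
    then show False using nr N'r by simp
  qed
qed

end

context resonance_problem
begin

text \<open>Rescale a sequence in the sublevel set with unbounded \<open>L\<^sup>p\<close> norm to norm one.
  The constant \<open>C0\<close> and the \<open>h\<close>-term become
  \<open>O(t\<^sup>-\<^sup>p)\<close> and \<open>O(t\<^sup>1\<^sup>-\<^sup>p)\<close>, which
  vanish in the limit as \<open>p > 1\<close>.\<close>

lemma sublevel_p_mass_bounded:
  obtains T where "\<And>u G. W0 u G \<Longrightarrow> energy u G \<le> C0 \<Longrightarrow> p_mass M p u \<le> T"
proof (rule ccontr)
  assume "\<not> thesis"
  then have "\<exists>u G. W0 u G \<and> energy u G \<le> C0 \<and> p_mass M p u > real (Suc n)" for n
    using that by (meson not_le)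
  then obtain u G where W: "\<And>n. W0 (u n) (G n)" and en: "\<And>n. energy (u n) (G n) \<le> C0"
    and big: "\<And>n. p_mass M p (u n) > real (Suc n)" by metis
  define t where "t n = p_mass M p (u n) powr (1/p)" for n
  have tau1: "p_mass M p (u n) \<ge> 1" for n using big[of n] by simp
  have t1: "t n \<ge> 1" for n unfolding t_def using tau1 p by (intro ge_one_powr_ge_zero) auto
  then have t0: "t n > 0" for n using less_le_trans[OF zero_less_one] by blast
  have tp: "t n powr p = p_mass M p (u n)" for n
    using tau1[of n] p by (simp add: t_def powr_powr)
  have tinf: "filterlim t at_top sequentially"
    unfolding filterlim_at_top
  proof
    fix Z :: real
    obtain n0 where n0: "real n0 \<ge> (max Z 0) powr p" using real_arch_simple by blast
    have "Z \<le> t n" if "n \<ge> n0" for n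
    proof -
      have "(max Z 0) powr p \<le> p_mass M p (u n)" using n0 that big[of n] by simp
      then have "((max Z 0) powr p) powr (1/p) \<le> t n" unfolding t_def using p by (intro powr_mono2) auto
      then show ?thesis using p by (simp add: powr_powr)
    qed
    then show "eventually (\<lambda>n. Z \<le> t n) sequentially" unfolding eventually_sequentially by blast
  qed
  define v where "v n = (\<lambda>x. (1 / t n) * u n x)" for n
  define K where "K n = (\<lambda>x. (1 / t n) *\<^sub>R G n x)" for n
  have Wv: "W0 (v n) (K n)" for n
    using W0_lincomb[OF W[of n] W[of n], of "1 / t n" 0] by (simp add: v_def K_def)
  have un: "u n x = t n * v n x" "G n x = t n *\<^sub>R K n x" for n x
    using t0[of n] by (auto simp: v_def K_def)
  have one: "p_mass M p (v n) = 1" for n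
  proof -
    have "p_mass M p (u n) = t n powr p * p_mass M p (v n)"
      using p_int_scaleR(2)[OF W0_p_int(1)[OF Wv[of n]], of "t n"] t0[of n] by (simp add: un(1)[symmetric])
    then show ?thesis using tp[of n] tau1[of n] by simp
  qed
  obtain C where C: "C > 0" "\<And>v :: 'a \<Rightarrow> real. p_int M p v \<Longrightarrow>
      \<bar>LINT x|M. h x * v x\<bar> \<le> 1 * p_mass M (p / (p - 1)) h + C * p_mass M p v"
    using dual_pairing_le[OF p(1) h zero_less_one] by metis
  define Kh where "Kh = p_mass M (p / (p - 1)) h + C"
  have hv: "\<bar>LINT x|M. h x * v n x\<bar> \<le> Kh" for n
    using C(2)[OF W0_p_int(1)[OF Wv[of n]]] by (simp add: one Kh_def)
  define \<epsilon> where "\<epsilon> n = C0 * (t n powr (- p)) + Kh * (t n powr (1 - p))" for n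
  have "\<epsilon> \<longlonglongrightarrow> C0 * 0 + Kh * 0"
    unfolding \<epsilon>_def using p tinf by (intro tendsto_intros tendsto_neg_powr) auto
  then have \<epsilon>0: "\<epsilon> \<longlonglongrightarrow> 0" by simp
  have "(LINT x|M. Phi p (K n x)) \<le> (LINT x|M. primitive f x (t n * v n x) / t n powr p) + \<epsilon> n" for n
  proof -
    have "t n powr p * (LINT x|M. Phi p (K n x)) = (LINT x|M. t n powr p * Phi p (K n x))" by simp
    also have "\<dots> \<le> (LINT x|M. Phi p (G n x))"
      using Phi_integrable[OF W0_p_int(2)[OF Wv[of n]]] Phi_integrable[OF W0_p_int(2)[OF W[of n]]] Phi_scaleR_ge[OF p(1) t1[of n]]
      by (intro integral_mono) (auto simp: un(2))
    also have "\<dots> \<le> C0 + (LINT x|M. primitive f x (u n x)) + (LINT x|M. h x * u n x)"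
      using en[of n] by (simp add: energy_def)
    also have "(LINT x|M. h x * u n x) = t n * (LINT x|M. h x * v n x)"
      by (simp add: un(1) mult.left_commute[of _ "t n"])
    also have "t n * (LINT x|M. h x * v n x) \<le> t n * Kh"
      using hv[of n] t0[of n] by (intro mult_left_mono) auto
    finally have "t n powr p * (LINT x|M. Phi p (K n x)) \<le> C0 + (LINT x|M. primitive f x (u n x)) + t n * Kh" by simp
    then have "(LINT x|M. Phi p (K n x)) \<le> (C0 + (LINT x|M. primitive f x (u n x)) + t n * Kh) / t n powr p"
      using t0[of n] by (simp add: pos_le_divide_eq mult.commute)
    also have "\<dots> = (LINT x|M. primitive f x (t n * v n x) / t n powr p) + \<epsilon> n"
      using t0[of n] by (simp add: un(1)[symmetric] \<epsilon>_def add_divide_distrib powr_minus_divide powr_diff mult.commute)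
    finally show ?thesis .
  qed
  from recession_contradiction[OF Wv one tinf t1 \<epsilon>0 this] show False .
qed

lemma W0_zero: "W0 (\<lambda>x. 0) (\<lambda>x. 0)"
proof -
  have "test_function \<Omega> (\<lambda>x. 0)"
    by (simp add: test_function_def smooth_def k_smooth_const)
  moreover have "grad (\<lambda>x::'a. 0) x = 0" for x by (rule grad_eqI) simp
  moreover have "p_int M p (\<lambda>x::'a. 0::real)" "p_int M p (\<lambda>x::'a. 0::'a)" using p by (auto simp: p_int_def)
  ultimately show ?thesis unfolding W0_def using p by (auto simp: p_mass_def intro!: exI[of _ "\<lambda>x. 0"])
qed

lemma sublevel_bounded:
  obtains T where "\<And>u G. W0 u G \<Longrightarrow> energy u G \<le> C0 \<Longrightarrow>
    p_mass M p u \<le> T \<and> p_mass M p G \<le> T \<and> (LINT x|M. Phi p (G x)) \<le> T \<and> - T \<le> energy u G"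
proof -
  obtain T0 where T0: "\<And>u G. W0 u G \<Longrightarrow> energy u G \<le> C0 \<Longrightarrow> p_mass M p u \<le> T0"
    using sublevel_p_mass_bounded by blast
  obtain C where C: "C > 0" "\<And>v :: 'a \<Rightarrow> real. p_int M p v \<Longrightarrow>
      \<bar>LINT x|M. h x * v x\<bar> \<le> 1 * p_mass M (p / (p - 1)) h + C * p_mass M p v"
    using dual_pairing_le[OF p(1) h zero_less_one] by metis
  define Kh where "Kh = p_mass M (p / (p - 1)) h + C * \<bar>T0\<bar>"
  define KF where "KF = A * \<bar>T0\<bar> + \<bar>LINT x|M. B x\<bar>"
  define T1 where "T1 = \<bar>C0\<bar> + KF + Kh"
  define T2 where "T2 = 2 powr p * (T1 + measure M (space M))"
  have "p_mass M p u \<le> \<bar>T0\<bar> \<and> p_mass M p G \<le> T2 \<and> (LINT x|M. Phi p (G x)) \<le> T1 \<and> - T1 \<le> energy u G"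
    if W: "W0 u G" and E: "energy u G \<le> C0" for u G
  proof -
    have 1: "p_mass M p u \<le> \<bar>T0\<bar>" using T0[OF W E] by simp
    have "C * p_mass M p u \<le> C * \<bar>T0\<bar>" using 1 C(1) by (intro mult_left_mono) auto
    then have 2: "\<bar>LINT x|M. h x * u x\<bar> \<le> Kh" using C(2)[OF W0_p_int(1)[OF W]] by (simp add: Kh_def)
    have "A * p_mass M p u \<le> A * \<bar>T0\<bar>" using 1 A by (intro mult_left_mono)
    then have 3: "(LINT x|M. primitive f x (u x)) \<le> KF" using primitive_integral_le[OF W] by (simp add: KF_def)
    have 4: "0 \<le> (LINT x|M. Phi p (G x))" by (simp add: Phi_nonneg)
    have 5: "(LINT x|M. Phi p (G x)) \<le> T1" using E 2 3 unfolding energy_def T1_def by linarith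
    have 6: "- T1 \<le> energy u G" using 2 3 4 unfolding energy_def T1_def by linarith
    have "p_mass M p G \<le> 2 powr p * ((LINT x|M. Phi p (G x)) + measure M (space M))"
      by (rule p_mass_le_Phi[OF W0_p_int(2)[OF W]])
    also have "\<dots> \<le> T2" unfolding T2_def using 5 by (intro mult_left_mono add_right_mono) auto
    finally show ?thesis using 1 5 6 by blast
  qed
  then show ?thesis using that[of "max \<bar>T0\<bar> (max T1 T2)"] by (smt (verit) max.cobounded1 max.cobounded2 max.coboundedI2)
qed

section \<open>Existence of a minimizer\<close>

text \<open>The term \<open>-F(x,u)\<close> is bounded below by \<open>-A|u|\<^sup>p - B\<close>, whose
  integral converges; so Fatou's lemma applies to \<open>A|u|\<^sup>p + B - F(x,u)\<close>, no
  matter how fast \<open>-F\<close> grows.\<close>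

lemma energy_lsc:
  assumes W: "\<And>n. W0 (u n) (G n)" and bd: "\<And>n. p_mass M p (u n) \<le> T" "\<And>n. p_mass M p (G n) \<le> T"
    and Phi_bd: "\<And>n. (LINT x|M. Phi p (G n x)) \<le> T"
    and m: "(\<lambda>n. energy (u n) (G n)) \<longlonglongrightarrow> m"
  obtains v H where "W0 v H" "energy v H \<le> m"
proof -
  have "bounded (range (\<lambda>n. LINT x|M. Phi p (G n x)))"
    unfolding bounded_iff using Phi_bd by (auto intro!: exI[of _ T] simp: Phi_nonneg)
  then obtain \<phi> r0 where r0: "strict_mono r0" "(\<lambda>n. LINT x|M. Phi p (G (r0 n) x)) \<longlonglongrightarrow> \<phi>"
    using bounded_imp_convergent_subsequence[of "\<lambda>n. LINT x|M. Phi p (G n x)"] by (auto simp: o_def)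
  obtain r1 :: "nat \<Rightarrow> nat" and v H where r1: "strict_mono r1" "W0 v H" "(\<lambda>n. p_mass M p (\<lambda>x. u (r0 (r1 n)) x - v x)) \<longlonglongrightarrow> 0"
    and lsc: "\<forall>c. eventually (\<lambda>n. (LINT x|M. Phi p (G (r0 (r1 n)) x)) \<le> c) sequentially \<longrightarrow> (LINT x|M. Phi p (H x)) \<le> c"
    by (rule W0_compactness[where u = "\<lambda>n. u (r0 n)" and G = "\<lambda>n. G (r0 n)", OF W bd]) blast
  have vi: "p_int M p v" by (rule W0_p_int(1)[OF r1(2)])
  have ui: "p_int M p (u n)" for n by (rule W0_p_int(1)[OF W])
  obtain s where s: "strict_mono s" "AE x in M. (\<lambda>n. u (r0 (r1 (s n))) x) \<longlonglongrightarrow> v x"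
    using p_mass_AE_subseq[OF p(1) ui vi r1(3)] by metis
  define \<sigma> where "\<sigma> n = r0 (r1 (s n))" for n
  have \<sigma>: "strict_mono \<sigma>" unfolding \<sigma>_def using r0(1) r1(1) s(1) by (auto simp: strict_mono_def)
  have lim_Phi1: "(\<lambda>n. LINT x|M. Phi p (G (r0 (r1 n)) x)) \<longlonglongrightarrow> \<phi>"
    using LIMSEQ_subseq_LIMSEQ[OF r0(2) r1(1)] by (simp add: o_def)
  have lim_Phi: "(\<lambda>n. LINT x|M. Phi p (G (\<sigma> n) x)) \<longlonglongrightarrow> \<phi>"
    using LIMSEQ_subseq_LIMSEQ[OF lim_Phi1 s(1)] by (simp add: o_def \<sigma>_def)
  have lim_u: "(\<lambda>n. p_mass M p (\<lambda>x. u (\<sigma> n) x - v x)) \<longlonglongrightarrow> 0"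
    using LIMSEQ_subseq_LIMSEQ[OF r1(3) s(1)] by (simp add: o_def \<sigma>_def)
  have lim_E: "(\<lambda>n. energy (u (\<sigma> n)) (G (\<sigma> n))) \<longlonglongrightarrow> m"
    using LIMSEQ_subseq_LIMSEQ[OF m \<sigma>] by (simp add: o_def)
  have I_le: "(LINT x|M. Phi p (H x)) \<le> \<phi>"
  proof (rule field_le_epsilon)
    fix e :: real assume "e > 0"
    then have "eventually (\<lambda>n. (LINT x|M. Phi p (G (r0 (r1 n)) x)) < \<phi> + e) sequentially"
      by (intro order_tendstoD(2)[OF lim_Phi1]) simp
    then show "(LINT x|M. Phi p (H x)) \<le> \<phi> + e" by (intro lsc[rule_format]) (auto elim: eventually_mono)
  qed
  have lim_h: "(\<lambda>n. LINT x|M. h x * u (\<sigma> n) x) \<longlonglongrightarrow> (LINT x|M. h x * v x)"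
    by (rule dual_pairing_tendsto[OF p(1) h ui vi lim_u])
  have lim_mass: "(\<lambda>n. p_mass M p (u (\<sigma> n))) \<longlonglongrightarrow> p_mass M p v"
    by (rule tendsto_p_mass[OF p(1) ui vi lim_u])
  define k where "k n x = A * \<bar>u (\<sigma> n) x\<bar> powr p + B x - primitive f x (u (\<sigma> n) x)" for n x
  define k0 where "k0 x = A * \<bar>v x\<bar> powr p + B x - primitive f x (v x)" for x
  have iu: "integrable M (\<lambda>x. \<bar>u n x\<bar> powr p)" for n using p_int_integrable[OF ui[of n]] by simp
  have iv: "integrable M (\<lambda>x. \<bar>v x\<bar> powr p)" using p_int_integrable[OF vi] by simp
  have iFu: "integrable M (\<lambda>x. primitive f x (u n x))" for n by (rule primitive_integrable[OF W0_crit_integrable[OF W]])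
  have iFv: "integrable M (\<lambda>x. primitive f x (v x))" by (rule primitive_integrable[OF W0_crit_integrable[OF r1(2)]])
  have ik: "integrable M (k n)" for n unfolding k_def using iu iFu B by simp
  have ik0: "integrable M k0" unfolding k0_def using iv iFv B by simp
  define \<beta> where "\<beta> n = A * p_mass M p (u (\<sigma> n)) + (LINT x|M. B x) + energy (u (\<sigma> n)) (G (\<sigma> n))
       - (LINT x|M. Phi p (G (\<sigma> n) x)) + (LINT x|M. h x * u (\<sigma> n) x)" for n
  \<comment> \<open>the limit of \<open>\<beta>\<close>\<close>
  define \<beta>0 where "\<beta>0 = A * p_mass M p v + (LINT x|M. B x) + m - \<phi> + (LINT x|M. h x * v x)"
  have k_int: "(LINT x|M. k n x) = \<beta> n" for n
    unfolding k_def \<beta>_def energy_def p_mass_def using iu iFu B by simp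
  have \<beta>lim: "\<beta> \<longlonglongrightarrow> \<beta>0"
    unfolding \<beta>_def \<beta>0_def by (intro tendsto_intros lim_mass lim_E lim_Phi lim_h)
  have AEk: "AE x in M. (\<lambda>n. k n x) \<longlonglongrightarrow> k0 x"
    using s(2) f_continuous
  proof eventually_elim
    case (elim x)
    have l: "(\<lambda>n. u (\<sigma> n) x) \<longlonglongrightarrow> v x" using elim(1) by (simp add: \<sigma>_def)
    have "isCont (primitive f x) (v x)" by (rule DERIV_isCont[OF primitive_DERIV[of f x, OF elim(2)]])
    then have "(\<lambda>n. primitive f x (u (\<sigma> n) x)) \<longlonglongrightarrow> primitive f x (v x)" using l by (rule isCont_tendsto_compose)
    then show ?case unfolding k_def k0_def using l p by (intro tendsto_intros tendsto_powr') auto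
  qed
  have "(LINT x|M. k0 x) \<le> \<beta>0"
  proof (rule field_le_epsilon)
    fix e :: real assume e: "e > 0"
    show "(LINT x|M. k0 x) \<le> \<beta>0 + e"
    proof (rule fatou_bound(2)[OF ik _ AEk])
      show "AE x in M. 0 \<le> k n x" for n
        using upper by eventually_elim (simp add: k_def)
      show "k0 \<in> borel_measurable M" using ik0 by simp
      have "eventually (\<lambda>n. \<beta> n < \<beta>0 + e) sequentially" using e by (intro order_tendstoD(2)[OF \<beta>lim]) simp
      then show "eventually (\<lambda>n. (LINT x|M. k n x) \<le> \<beta>0 + e) sequentially"
        unfolding k_int by (rule eventually_mono) simp
    qed
  qed
  moreover have "(LINT x|M. k0 x) = A * p_mass M p v + (LINT x|M. B x) - (LINT x|M. primitive f x (v x))"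
    unfolding k0_def p_mass_def using iv iFv B by simp
  ultimately have "energy v H \<le> m" using I_le by (simp add: energy_def \<beta>0_def)
  then show ?thesis using that r1(2) by blast
qed

lemma energy_minimizer:
  obtains v H where "W0 v H" "\<And>u G. W0 u G \<Longrightarrow> energy v H \<le> energy u G"
proof -
  define C0 where "C0 = energy (\<lambda>x. 0) (\<lambda>x. 0)"
  define S where "S = {energy u G | u G. W0 u G \<and> energy u G \<le> C0}"
  obtain T where T: "\<And>u G. W0 u G \<Longrightarrow> energy u G \<le> C0 \<Longrightarrow>
    p_mass M p u \<le> T \<and> p_mass M p G \<le> T \<and> (LINT x|M. Phi p (G x)) \<le> T \<and> - T \<le> energy u G"
    using sublevel_bounded by blast
  have C0S: "C0 \<in> S" unfolding S_def C0_def using W0_zero by blast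
  have bdd: "bdd_below S" by (rule bdd_belowI[of _ "- T"]) (use T in \<open>auto simp: S_def\<close>)
  define m where "m = Inf S"
  have "\<exists>u G. W0 u G \<and> energy u G \<le> C0 \<and> energy u G < m + 1 / real (Suc n)" for n
  proof -
    have "\<exists>e\<in>S. e < m + 1 / real (Suc n)"
      using cInf_lessD[of S "m + 1 / real (Suc n)"] C0S by (auto simp: m_def)
    then show ?thesis by (auto simp: S_def)
  qed
  then obtain u G where uG: "\<And>n. W0 (u n) (G n)" "\<And>n. energy (u n) (G n) \<le> C0" "\<And>n. energy (u n) (G n) < m + 1 / real (Suc n)"
    by metis
  have m_le: "m \<le> e" if "e \<in> S" for e unfolding m_def using that bdd by (rule cInf_lower)
  have lim: "(\<lambda>n. energy (u n) (G n)) \<longlonglongrightarrow> m"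
  proof (rule tendsto_sandwich[OF _ _ tendsto_const])
    show "eventually (\<lambda>n. m \<le> energy (u n) (G n)) sequentially"
      using uG(1,2) by (intro always_eventually allI m_le) (auto simp: S_def)
    show "eventually (\<lambda>n. energy (u n) (G n) \<le> m + inverse (real (Suc n))) sequentially"
      using uG(3) by (intro always_eventually allI) (simp add: inverse_eq_divide less_imp_le)
    show "(\<lambda>n. m + inverse (real (Suc n))) \<longlonglongrightarrow> m"
      using tendsto_add[OF tendsto_const LIMSEQ_inverse_real_of_nat, of m] by simp
  qed
  note Tn = T[OF uG(1,2)]
  obtain v H where vH: "W0 v H" "energy v H \<le> m"
    by (rule energy_lsc[where u = u and G = G and T = T and m = m, OF uG(1) _ _ _ lim]) (use Tn in blast)+
  have "energy v H \<le> energy u G" if W: "W0 u G" for u G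
  proof (cases "energy u G \<le> C0")
    case True
    then have "m \<le> energy u G" using W by (intro m_le) (auto simp: S_def)
    then show ?thesis using vH by simp
  next
    case False
    then show ?thesis using vH m_le[OF C0S] by simp
  qed
  then show ?thesis using that vH(1) by blast
qed

section \<open>The Euler equation\<close>

lemma flux_pairing_bound:
  fixes z k :: 'a
  assumes "0 \<le> t" "t \<le> 1"
  shows "\<bar>flux p (z + t *\<^sub>R k) \<bullet> k\<bar> \<le> p * (2 powr p * (norm z powr p + norm k powr p) + norm k powr p)"
proof -
  let ?s = "norm z + norm k"
  have "norm (z + t *\<^sub>R k) \<le> ?s"
    using norm_triangle_ineq[of z "t *\<^sub>R k"] mult_left_le_one_le[of "norm k" t] assms by simp
  then have "norm (z + t *\<^sub>R k) powr (p - 1) \<le> ?s powr (p - 1)" using p by (intro powr_mono2) auto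
  then have fl: "norm (flux p (z + t *\<^sub>R k)) \<le> p * ?s powr (p - 1)"
    using norm_flux_le[OF p(1), of "z + t *\<^sub>R k"] p by (smt (verit) mult_left_mono)
  have "\<bar>flux p (z + t *\<^sub>R k) \<bullet> k\<bar> \<le> norm (flux p (z + t *\<^sub>R k)) * norm k" by (rule Cauchy_Schwarz_ineq2)
  also have "\<dots> \<le> (p * ?s powr (p - 1)) * norm k" using fl by (rule mult_right_mono) simp
  also have "\<dots> = p * (?s powr (p - 1) * norm k)" by simp
  also have "\<dots> \<le> p * (?s powr p + norm k powr p)"
    using powr_mult_le_add[OF p(1), of ?s "norm k"] p by (intro mult_left_mono) auto
  also have "\<dots> \<le> p * (2 powr p * (norm z powr p + norm k powr p) + norm k powr p)"
    using norm_powr_add_le[OF p(1), of "norm z" "norm k"] p by (intro mult_left_mono add_right_mono) auto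
  finally show ?thesis .
qed

lemma flux_pairing_integrable:
  assumes H: "p_int M p (H :: 'a \<Rightarrow> 'a)" and K: "p_int M p K" and t: "0 \<le> t" "t \<le> 1"
  shows "integrable M (\<lambda>x. flux p (H x + t *\<^sub>R K x) \<bullet> K x)"
proof (rule Bochner_Integration.integrable_bound)
  show "integrable M (\<lambda>x. p * (2 powr p * (norm (H x) powr p + norm (K x) powr p) + norm (K x) powr p))"
    using H K by (auto simp: p_int_def)
  have [measurable]: "H \<in> borel_measurable M" "K \<in> borel_measurable M" using H K by (auto simp: p_int_def)
  have [measurable]: "flux p \<in> borel_measurable (borel :: 'a measure)"
    by (rule borel_measurable_continuous_onI[OF continuous_on_flux[OF p(1)]])
  show "(\<lambda>x. flux p (H x + t *\<^sub>R K x) \<bullet> K x) \<in> borel_measurable M" by measurable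
  show "AE x in M. norm (flux p (H x + t *\<^sub>R K x) \<bullet> K x) \<le> norm (p * (2 powr p * (norm (H x) powr p + norm (K x) powr p) + norm (K x) powr p))"
    using flux_pairing_bound[OF t] by (intro AE_I2) (metis abs_ge_self order_trans real_norm_def)
qed

lemma f_pairing_integrable:
  assumes "p_int M crit u" "p_int M crit w"
  shows "integrable M (\<lambda>x. f x (u x) * w x)"
proof (rule Bochner_Integration.integrable_bound[OF increment_majorant_integrable[OF assms]])
  show "(\<lambda>x. f x (u x) * w x) \<in> borel_measurable M"
    using caratheodory_comp_measurable[OF dom_sets f p_int_measurable[OF assms(1)]] p_int_measurable[OF assms(2)] by simp
  show "AE x in M. norm (f x (u x) * w x) \<le> norm (increment_majorant u w x)"
    using growth
  proof eventually_elim
    case (elim x)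
    have "\<bar>f x (u x)\<bar> \<le> a * \<bar>u x\<bar> powr (crit - 1) + b x" using elim by blast
    also have "\<dots> \<le> a * (\<bar>u x\<bar> + \<bar>w x\<bar>) powr (crit - 1) + b x"
      using a crit_gt_1 by (intro add_right_mono mult_left_mono powr_mono2) auto
    finally have "\<bar>f x (u x) * w x\<bar> \<le> increment_majorant u w x"
      unfolding increment_majorant_def abs_mult by (rule mult_right_mono) simp
    then show ?case by simp
  qed
qed

text \<open>Compare the energies at \<open>v\<close> and \<open>v + tw\<close>, divide by \<open>t\<close> and
  let \<open>t = 1/(n + 1)\<close> tend to \<open>0\<close>. The convex term is bounded above by
  the flux at the displaced point.\<close>

lemma minimizer_variational_inequality:
  assumes v: "W0 v H" and min: "\<And>u G. W0 u G \<Longrightarrow> energy v H \<le> energy u G" and w: "W0 w K"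
  shows "(LINT x|M. f x (v x) * w x) + (LINT x|M. h x * w x) \<le> (LINT x|M. flux p (H x) \<bullet> K x)"
proof -
  define t where "t n = 1 / real (Suc n)" for n
  have t: "0 < t n" "t n \<le> 1" for n by (auto simp: t_def)
  have t0: "t \<longlonglongrightarrow> 0" unfolding t_def using LIMSEQ_inverse_real_of_nat by (simp add: inverse_eq_divide)
  note vc = W0_crit_integrable[OF v] and wc = W0_crit_integrable[OF w]
  note Hi = W0_p_int(2)[OF v] and Ki = W0_p_int(2)[OF w]
  define D where "D n x = (primitive f x (v x + t n * w x) - primitive f x (v x)) / t n" for n x
  have W: "W0 (\<lambda>x. v x + t n * w x) (\<lambda>x. H x + t n *\<^sub>R K x)" for n
    using W0_lincomb[OF v w, of 1 "t n"] by simp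
  have Fn: "integrable M (\<lambda>x. primitive f x (v x + t n * w x))" for n by (rule primitive_integrable[OF W0_crit_integrable[OF W]])
  have F0: "integrable M (\<lambda>x. primitive f x (v x))" by (rule primitive_integrable[OF vc])
  have iD: "integrable M (D n)" for n unfolding D_def using Fn F0 by simp
  have ineq: "(LINT x|M. D n x) + (LINT x|M. h x * w x) \<le> (LINT x|M. flux p (H x + t n *\<^sub>R K x) \<bullet> K x)" for n
  proof -
    have tn: "t n > 0" "0 \<le> t n" "t n \<le> 1" using t[of n] by auto
    note ifl = flux_pairing_integrable[OF Hi Ki tn(2,3)]
    have "(LINT x|M. Phi p (H x + t n *\<^sub>R K x)) \<le> (LINT x|M. Phi p (H x) + t n * (flux p (H x + t n *\<^sub>R K x) \<bullet> K x))"
    proof (rule integral_mono)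
      show "Phi p (H x + t n *\<^sub>R K x) \<le> Phi p (H x) + t n * (flux p (H x + t n *\<^sub>R K x) \<bullet> K x)" for x
        using Phi_tangent[OF p(1), of "H x + t n *\<^sub>R K x" "H x"] by simp
    qed (use ifl Phi_integrable[OF Hi] Phi_integrable[OF W0_p_int(2)[OF W[of n]]] in auto)
    also have "\<dots> = (LINT x|M. Phi p (H x)) + t n * (LINT x|M. flux p (H x + t n *\<^sub>R K x) \<bullet> K x)"
      using ifl Phi_integrable[OF Hi] by simp
    finally have P: "(LINT x|M. Phi p (H x + t n *\<^sub>R K x)) - (LINT x|M. Phi p (H x)) \<le> t n * (LINT x|M. flux p (H x + t n *\<^sub>R K x) \<bullet> K x)" by simp
    have Fd: "(LINT x|M. primitive f x (v x + t n * w x)) - (LINT x|M. primitive f x (v x)) = t n * (LINT x|M. D n x)"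
      unfolding D_def using Fn F0 tn by simp
    have hd: "(LINT x|M. h x * (v x + t n * w x)) = (LINT x|M. h x * v x) + t n * (LINT x|M. h x * w x)"
    proof -
      have "(LINT x|M. h x * (v x + t n * w x)) = (LINT x|M. h x * v x + t n * (h x * w x))"
        by (simp add: algebra_simps)
      also have "\<dots> = (LINT x|M. h x * v x) + t n * (LINT x|M. h x * w x)"
        using dual_pairing_integrable[OF p(1) h W0_p_int(1)[OF v]] dual_pairing_integrable[OF p(1) h W0_p_int(1)[OF w]] by simp
      finally show ?thesis .
    qed
    have "energy v H \<le> energy (\<lambda>x. v x + t n * w x) (\<lambda>x. H x + t n *\<^sub>R K x)" by (rule min[OF W])
    then have "t n * (LINT x|M. D n x) + t n * (LINT x|M. h x * w x) \<le> t n * (LINT x|M. flux p (H x + t n *\<^sub>R K x) \<bullet> K x)"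
      using P Fd hd unfolding energy_def by linarith
    then have "t n * ((LINT x|M. D n x) + (LINT x|M. h x * w x)) \<le> t n * (LINT x|M. flux p (H x + t n *\<^sub>R K x) \<bullet> K x)"
      by (simp only: distrib_left)
    then show ?thesis using tn(1) by (simp only: mult_le_cancel_left_pos)
  qed
  have limD: "(\<lambda>n. LINT x|M. D n x) \<longlonglongrightarrow> (LINT x|M. f x (v x) * w x)"
  proof (rule integral_dominated_convergence[where w = "increment_majorant v w"])
    show "integrable M (increment_majorant v w)" by (rule increment_majorant_integrable[OF vc wc])
    show "(\<lambda>x. f x (v x) * w x) \<in> borel_measurable M" using f_pairing_integrable[OF vc wc] by simp
    show "D n \<in> borel_measurable M" for n using iD by simp
    show "AE x in M. norm (D n x) \<le> increment_majorant v w x" for n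
      using primitive_increment_le_majorant growth
    proof eventually_elim
      case (elim x)
      have tn: "t n > 0" "t n \<le> 1" using t[of n] by auto
      have b0: "b x \<ge> 0" using elim(2)[rule_format, of 0] crit_gt_1 by simp
      have "\<bar>primitive f x (v x + t n * w x) - primitive f x (v x)\<bar> \<le> (a * (\<bar>v x\<bar> + \<bar>t n * w x\<bar>) powr (crit - 1) + b x) * \<bar>t n * w x\<bar>"
        using elim(1) by blast
      also have "\<dots> \<le> (a * (\<bar>v x\<bar> + \<bar>w x\<bar>) powr (crit - 1) + b x) * \<bar>t n * w x\<bar>"
      proof (intro mult_right_mono add_right_mono mult_left_mono powr_mono2)
        show "\<bar>v x\<bar> + \<bar>t n * w x\<bar> \<le> \<bar>v x\<bar> + \<bar>w x\<bar>" using tn by (simp add: abs_mult mult_left_le_one_le)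
      qed (use a crit_gt_1 in auto)
      also have "\<dots> = t n * increment_majorant v w x" using tn by (simp add: increment_majorant_def abs_mult)
      finally show ?case using tn by (simp add: D_def pos_divide_le_eq mult.commute)
    qed
    show "AE x in M. (\<lambda>n. D n x) \<longlonglongrightarrow> f x (v x) * w x"
      using f_continuous
    proof eventually_elim
      case (elim x)
      have "((\<lambda>s. v x + s * w x) has_real_derivative w x) (at 0)" by (auto intro!: derivative_eq_intros)
      from DERIV_chain2[OF _ this, of "primitive f x" "f x (v x)"] primitive_DERIV[of f x, OF elim, of "v x"]
      have "((\<lambda>s. primitive f x (v x + s * w x)) has_real_derivative f x (v x) * w x) (at 0)" by simp
      then have "((\<lambda>s. (primitive f x (v x + s * w x) - primitive f x (v x)) / s) \<longlongrightarrow> f x (v x) * w x) (at 0)"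
        by (simp add: DERIV_def)
      moreover have "filterlim t (at 0) sequentially"
        unfolding filterlim_at using t0 t(1) by (auto simp: less_imp_neq[THEN not_sym] intro!: always_eventually)
      ultimately show ?case unfolding D_def by (rule filterlim_compose)
    qed
  qed
  have limFl: "(\<lambda>n. LINT x|M. flux p (H x + t n *\<^sub>R K x) \<bullet> K x) \<longlonglongrightarrow> (LINT x|M. flux p (H x) \<bullet> K x)"
  proof (rule integral_dominated_convergence[where w = "\<lambda>x. p * (2 powr p * (norm (H x) powr p + norm (K x) powr p) + norm (K x) powr p)"])
    show "integrable M (\<lambda>x. p * (2 powr p * (norm (H x) powr p + norm (K x) powr p) + norm (K x) powr p))"
      using Hi Ki by (auto simp: p_int_def)
    show "(\<lambda>x. flux p (H x) \<bullet> K x) \<in> borel_measurable M"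
      using flux_pairing_integrable[OF Hi Ki, of 0] by simp
    show "(\<lambda>x. flux p (H x + t n *\<^sub>R K x) \<bullet> K x) \<in> borel_measurable M" for n
      using flux_pairing_integrable[OF Hi Ki, of "t n"] t[of n] by simp
    show "AE x in M. norm (flux p (H x + t n *\<^sub>R K x) \<bullet> K x) \<le> p * (2 powr p * (norm (H x) powr p + norm (K x) powr p) + norm (K x) powr p)" for n
      using flux_pairing_bound[of "t n"] t[of n] by (intro AE_I2) simp
    show "AE x in M. (\<lambda>n. flux p (H x + t n *\<^sub>R K x) \<bullet> K x) \<longlonglongrightarrow> flux p (H x) \<bullet> K x"
    proof (rule AE_I2)
      fix x
      have "isCont (flux p) (H x)" using continuous_on_flux[OF p(1), where 'a = 'a] by (simp add: continuous_on_eq_continuous_at)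
      moreover have "(\<lambda>n. H x + t n *\<^sub>R K x) \<longlonglongrightarrow> H x"
        using tendsto_add[OF tendsto_const tendsto_scaleR[OF t0 tendsto_const], of "H x" "K x"] by simp
      ultimately have "(\<lambda>n. flux p (H x + t n *\<^sub>R K x)) \<longlonglongrightarrow> flux p (H x)" by (rule isCont_tendsto_compose)
      then show "(\<lambda>n. flux p (H x + t n *\<^sub>R K x) \<bullet> K x) \<longlonglongrightarrow> flux p (H x) \<bullet> K x" by (intro tendsto_inner tendsto_const)
    qed
  qed
  show ?thesis
    by (rule LIMSEQ_le[OF tendsto_add[OF limD tendsto_const] limFl]) (use ineq in blast)
qed

text \<open>The variational inequality for \<open>w\<close> and \<open>-w\<close> gives equality.\<close>

lemma weak_solution_exists: "\<exists>u. weak_solution \<Omega> p f h u"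
proof -
  obtain v H where v: "W0 v H" and min: "\<And>u G. W0 u G \<Longrightarrow> energy v H \<le> energy u G"
    using energy_minimizer by blast
  have vW: "v \<in> W1_0 \<Omega> p" by (rule W0_imp_W1_0[OF v])
  define H' where "H' = weak_grad \<Omega> v"
  have v': "W0 v H'" unfolding H'_def by (rule W1_0_imp_W0[OF vW])
  have ae: "AE x in M. H x = H' x" unfolding H'_def by (rule weak_grad_AE_eq[OF W0_has_weak_grad[OF v]])
  have "(LINT x|M. Phi p (H x)) = (LINT x|M. Phi p (H' x))"
    using ae Phi_integrable[OF W0_p_int(2)[OF v]] Phi_integrable[OF W0_p_int(2)[OF v']]
    by (intro integral_cong_AE) auto
  then have "energy v H' = energy v H" by (simp add: energy_def)
  with min have min': "\<And>u G. W0 u G \<Longrightarrow> energy v H' \<le> energy u G" by simp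
  have "weak_solution \<Omega> p f h v"
    unfolding weak_solution_def
  proof (intro conjI ballI vW)
    fix w assume "w \<in> W1_0 \<Omega> p"
    then have w: "W0 w (weak_grad \<Omega> w)" by (rule W1_0_imp_W0)
    have w': "W0 (\<lambda>x. - w x) (\<lambda>x. - weak_grad \<Omega> w x)" using W0_lincomb[OF w w, of "-1" 0] by simp
    show "integrable M (\<lambda>x. flux p (weak_grad \<Omega> v x) \<bullet> weak_grad \<Omega> w x)"
      using flux_pairing_integrable[OF W0_p_int(2)[OF v'] W0_p_int(2)[OF w], of 0] by (simp add: H'_def)
    show "integrable M (\<lambda>x. f x (v x) * w x)"
      by (rule f_pairing_integrable[OF W0_crit_integrable[OF v] W0_crit_integrable[OF w]])
    show "integrable M (\<lambda>x. h x * w x)" by (rule dual_pairing_integrable[OF p(1) h W0_p_int(1)[OF w]])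
    show "(LINT x|M. flux p (weak_grad \<Omega> v x) \<bullet> weak_grad \<Omega> w x) = (LINT x|M. f x (v x) * w x) + (LINT x|M. h x * w x)"
      using minimizer_variational_inequality[OF v' min' w] minimizer_variational_inequality[OF v' min' w']
      by (simp add: H'_def)
  qed
  then show ?thesis by blast
qed

end

theorem theorem2p4:
  fixes \<Omega> :: "'a::euclidean_space set"
    and \<gamma> \<gamma>s a A :: real
    and f :: "'a \<Rightarrow> real \<Rightarrow> real"
    and b B h :: "'a \<Rightarrow> real"
  assumes "bounded_smooth_domain \<Omega>"
    and "1 < \<gamma>" and "\<gamma> < real DIM('a)"
    and "\<gamma>s = real DIM('a) * \<gamma> / (real DIM('a) - \<gamma>)"
    and "caratheodory \<Omega> f"
    and "a \<ge> 0"
    and "b \<in> Lp \<Omega> (\<gamma>s / (\<gamma>s - 1))"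
    and "AE x in lebesgue_on \<Omega>. b x \<ge> 0"
    and "AE x in lebesgue_on \<Omega>. \<forall>s. \<bar>f x s\<bar> \<le> a * \<bar>s\<bar> powr (\<gamma>s - 1) + b x"
    and "A \<ge> 0"
    and "B \<in> Lp \<Omega> 1"
    and "AE x in lebesgue_on \<Omega>. B x \<ge> 0"
    and "AE x in lebesgue_on \<Omega>. \<forall>s. primitive f x s \<le> A * \<bar>s\<bar> powr \<gamma> + B x"
    and "(INF v\<in>{v \<in> W1_0 \<Omega> \<gamma>. Lp_norm \<Omega> \<gamma> v = 1}.
           ereal (LINT x|lebesgue_on \<Omega>.
             (sqrt (1 + (norm (weak_grad \<Omega> v x))\<^sup>2) - 1) powr \<gamma>)
           - ereal_integral (lebesgue_on {x \<in> \<Omega>. v x \<noteq> 0})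
               (\<lambda>x. A_inf \<gamma> f x * ereal (\<bar>v x\<bar> powr \<gamma>))) > 0"
    and "h \<in> Lp \<Omega> (\<gamma> / (\<gamma> - 1))"
  shows "\<exists>u. weak_solution \<Omega> \<gamma> f h u"
proof -
  interpret sobolev_space \<Omega> \<gamma>
    using assms(1-3) by unfold_locales (auto simp: bounded_smooth_domain_def)
  have crit: "crit = \<gamma>s" using assms(4) by (simp add: crit_def)
  interpret resonance_problem \<Omega> \<gamma> f a A b B h
  proof unfold_locales
    show "p_int M (crit / (crit - 1)) b" using assms(7) by (simp add: crit Lp_iff)
    show "AE x in M. \<forall>s. \<bar>f x s\<bar> \<le> a * \<bar>s\<bar> powr (crit - 1) + b x" using assms(9) by (simp add: crit)
    show "integrable M B"
    proof -
      have Bm: "B \<in> borel_measurable M" and "integrable M (\<lambda>x. norm (B x) powr 1)"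
        using assms(11) by (auto simp: Lp_def)
      then have "integrable M (\<lambda>x. norm (B x))" by simp
      then show ?thesis using Bm by (rule integrable_norm_cancel)
    qed
    show "p_int M (\<gamma> / (\<gamma> - 1)) h" using assms(15) by (simp add: Lp_iff)
    fix v H assume v: "W0 v H" and one: "p_mass M \<gamma> v = 1"
    have vW: "v \<in> W1_0 \<Omega> \<gamma>" by (rule W0_imp_W1_0[OF v])
    have "Lp_norm \<Omega> \<gamma> v = 1" using one by (simp add: Lp_norm_def p_mass_def)
    then have mem: "v \<in> {v \<in> W1_0 \<Omega> \<gamma>. Lp_norm \<Omega> \<gamma> v = 1}" using vW by simp
    have "(LINT x|M. Phi \<gamma> (H x)) = (LINT x|M. Phi \<gamma> (weak_grad \<Omega> v x))"
      using weak_grad_AE_eq[OF W0_has_weak_grad[OF v]]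
        Phi_integrable[OF W0_p_int(2)[OF v]] Phi_integrable[OF W0_p_int(2)[OF W1_0_imp_W0[OF vW]]]
      by (intro integral_cong_AE) auto
    also have "\<dots> = (LINT x|M. (sqrt (1 + (norm (weak_grad \<Omega> v x))\<^sup>2) - 1) powr \<gamma>)"
      by (simp add: Phi_def area_excess_def)
    finally show "0 < ereal (LINT x|M. Phi \<gamma> (H x)) - ereal_integral (lebesgue_on {x \<in> \<Omega>. v x \<noteq> 0}) (\<lambda>x. A_inf \<gamma> f x * ereal (\<bar>v x\<bar> powr \<gamma>))"
      using less_le_trans[OF assms(14) INF_lower[OF mem]] by simp
  qed (use assms in auto)
  show ?thesis by (rule weak_solution_exists)
qed

end
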